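(* Let $G$ be a topological group (for instance an abstract group endowed with the discrete topology) admitting two co-amenable subgroups $H_1,H_2\leq G$ that commute with each other (every element of $H_1$ commutes with every element of $H_2$). Then every continuous action of $G$ by homeomorphisms on a dendrite is elementary.
   Context: A subgroup $H$ of a topological group $G$ is co-amenable if every continuous affine $G$-action on a (non-empty) convex compact set in a Hausdorff locally convex topological vector space has a $G$-fixed point whenever it has an $H$-fixed point. A continuum is a non-empty connected compact metrisable space. A dendrite is a locally connected continuum containing no simple closed curve. An action of $G$ on a dendrite $X$ is continuous if the action map $G\times X\to X$ is continuous. The action is elementary if $G$ fixes a point of $X$ or preserves (setwise) a pair of points of $X$. *)

theory Defs
  imports
    "HOL-Analysis.Analysis"
    "HOL-Algebra.Group_Action"
    "HOL-Library.Function_Algebras"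
begin

section \<open>Topological groups and continuous actions\<close>

locale topological_group = group G for G (structure) +
  fixes T :: "'a topology"
  assumes topspace_carrier: "topspace T = carrier G"
    and continuous_mult: "continuous_map (prod_topology T T) T (\<lambda>(x, y). x \<otimes> y)"
    and continuous_inv: "continuous_map T T (\<lambda>x. inv x)"

definition continuous_action ::
  "('g, 'm) monoid_scheme \<Rightarrow> 'g topology \<Rightarrow> 'x topology \<Rightarrow> ('g \<Rightarrow> 'x \<Rightarrow> 'x) \<Rightarrow> bool" where
  "continuous_action G T X \<phi> \<longleftrightarrow>
     group_action G (topspace X) \<phi> \<and>
     continuous_map (prod_topology T X) X (\<lambda>(g, x). \<phi> g x)"

definition has_fixed_point :: "'g set \<Rightarrow> 'x set \<Rightarrow> ('g \<Rightarrow> 'x \<Rightarrow> 'x) \<Rightarrow> bool" where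
  "has_fixed_point A X \<phi> \<longleftrightarrow> (\<exists>x\<in>X. \<forall>g\<in>A. \<phi> g x = x)"

definition elementary_action ::
  "('g, 'm) monoid_scheme \<Rightarrow> 'x topology \<Rightarrow> ('g \<Rightarrow> 'x \<Rightarrow> 'x) \<Rightarrow> bool" where
  "elementary_action G X \<phi> \<longleftrightarrow>
     has_fixed_point (carrier G) (topspace X) \<phi> \<or>
     (\<exists>x\<in>topspace X. \<exists>y\<in>topspace X. x \<noteq> y \<and> (\<forall>g\<in>carrier G. \<phi> g ` {x, y} = {x, y}))"


section \<open>Dendrites\<close>

definition continuum :: "'x topology \<Rightarrow> bool" where
  "continuum X \<longleftrightarrow>
     topspace X \<noteq> {} \<and> connected_space X \<and> compact_space X \<and> metrizable_space X"

definition simple_closed_curve_in :: "'x topology \<Rightarrow> 'x set \<Rightarrow> bool" where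
  "simple_closed_curve_in X C \<longleftrightarrow>
     C \<subseteq> topspace X \<and> subtopology X C homeomorphic_space top_of_set (sphere (0::complex) 1)"

definition dendrite :: "'x topology \<Rightarrow> bool" where
  "dendrite X \<longleftrightarrow>
     continuum X \<and> locally_connected_space X \<and> \<not> (\<exists>C. simple_closed_curve_in X C)"


section \<open>Co-amenable subgroups\<close>

text \<open>
  A topological vector space is a linear subspace \<open>V\<close> of a real vector space type together
  with a topology on \<open>V\<close>; nothing relates this topology to any other structure of the type.
\<close>

definition locally_convex_tvs :: "'v::real_vector set \<Rightarrow> 'v topology \<Rightarrow> bool" where
  "locally_convex_tvs V S \<longleftrightarrow>
     subspace V \<and> topspace S = V \<and>
     continuous_map (prod_topology S S) S (\<lambda>(x, y). x + y) \<and>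
     continuous_map (prod_topology euclideanreal S) S (\<lambda>(c, x). c *\<^sub>R x) \<and>
     neighbourhood_base_of convex S"

definition affine_action ::
  "('g, 'm) monoid_scheme \<Rightarrow> 'v::real_vector set \<Rightarrow> ('g \<Rightarrow> 'v \<Rightarrow> 'v) \<Rightarrow> bool" where
  "affine_action G K \<phi> \<longleftrightarrow>
     (\<forall>g\<in>carrier G. \<forall>x\<in>K. \<forall>y\<in>K. \<forall>t\<in>{0..1}.
        \<phi> g ((1 - t) *\<^sub>R x + t *\<^sub>R y) = (1 - t) *\<^sub>R \<phi> g x + t *\<^sub>R \<phi> g y)"

text \<open>Co-amenability, tested on the topological vector spaces carried by the type \<open>'v\<close>.\<close>

definition coamenable_in ::
  "'v::real_vector itself \<Rightarrow> ('g, 'm) monoid_scheme \<Rightarrow> 'g topology \<Rightarrow> 'g set \<Rightarrow> bool" where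
  "coamenable_in _ G T H \<longleftrightarrow>
     subgroup H G \<and>
     (\<forall>(V::'v set) S K \<phi>.
        locally_convex_tvs V S \<and> Hausdorff_space S \<and>
        K \<noteq> {} \<and> K \<subseteq> V \<and> convex K \<and> compactin S K \<and>
        continuous_action G T (subtopology S K) \<phi> \<and> affine_action G K \<phi> \<and>
        has_fixed_point H K \<phi> \<longrightarrow> has_fixed_point (carrier G) K \<phi>)"

instantiation "fun" :: (type, real_vector) real_vector
begin

definition scaleR_fun :: "real \<Rightarrow> ('a \<Rightarrow> 'b) \<Rightarrow> 'a \<Rightarrow> 'b" where
  "scaleR_fun c f = (\<lambda>x. c *\<^sub>R f x)"

instance
  by standard (simp_all add: scaleR_fun_def fun_eq_iff algebra_simps)

end

text \<open>
  HOL cannot quantify over all types \<open>'v\<close> inside a formula. This is no restriction: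
  the type \<open>'g vector_universe\<close> is large enough that testing on it amounts to testing on every
  Hausdorff locally convex space in every type, see \<open>coamenable_imp_coamenable_in\<close> below.
\<close>

type_synonym 'g vector_universe = "('g \<Rightarrow> real) set set \<Rightarrow> real"

definition coamenable :: "('g, 'm) monoid_scheme \<Rightarrow> 'g topology \<Rightarrow> 'g set \<Rightarrow> bool" where
  "coamenable G T H \<longleftrightarrow> coamenable_in TYPE('g vector_universe) G T H"


subsection \<open>Independence of the universe\<close>

lemma locally_convex_tvs_subtopology:
  assumes "locally_convex_tvs V S" "subspace W" "W \<subseteq> V"
  shows "locally_convex_tvs W (subtopology S W)"
proof -
  have V: "subspace V" "topspace S = V"
    and add: "continuous_map (prod_topology S S) S (\<lambda>(x, y). x + y)"
    and scale: "continuous_map (prod_topology euclideanreal S) S (\<lambda>(c, x). c *\<^sub>R x)"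
    and nb: "neighbourhood_base_of convex S"
    using assms(1) by (auto simp: locally_convex_tvs_def)
  have "continuous_map (prod_topology (subtopology S W) (subtopology S W)) (subtopology S W)
          (\<lambda>(x, y). x + y)"
    using add assms(2,3) V
    by (auto simp: continuous_map_in_subtopology subtopology_Times[symmetric]
        continuous_map_from_subtopology subspace_add)
  moreover have "continuous_map (prod_topology euclideanreal (subtopology S W)) (subtopology S W)
          (\<lambda>(c, x). c *\<^sub>R x)"
    using scale assms(2,3) V prod_topology_subtopology(2)[of euclideanreal S W]
    by (auto simp: continuous_map_in_subtopology continuous_map_from_subtopology subspace_scale)
  moreover have "neighbourhood_base_of convex (subtopology S W)"
    unfolding neighbourhood_base_of
  proof (intro allI impI)
    fix A x assume A: "openin (subtopology S W) A \<and> x \<in> A"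
    then obtain A' where A': "openin S A'" "A = A' \<inter> W" by (auto simp: openin_subtopology)
    then obtain U C where "openin S U" "convex C" "x \<in> U" "U \<subseteq> C" "C \<subseteq> A'"
      using nb A unfolding neighbourhood_base_of by (metis IntD1)
    then show "\<exists>U C. openin (subtopology S W) U \<and> convex C \<and> x \<in> U \<and> U \<subseteq> C \<and> C \<subseteq> A"
      using A A' assms(2)
      by (intro exI[of _ "U \<inter> W"] exI[of _ "C \<inter> W"])
        (auto simp: openin_subtopology intro: convex_Int subspace_imp_convex)
  qed
  ultimately show ?thesis
    using assms V by (auto simp: locally_convex_tvs_def)
qed

text \<open>Transport of the topology along an injective linear map.\<close>

lemma locally_convex_tvs_image:
  fixes f :: "'v::real_vector \<Rightarrow> 'w::real_vector"
  assumes "locally_convex_tvs V S" "linear f" "inj_on f V"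
  obtains S' where "locally_convex_tvs (f ` V) S'"
    "homeomorphic_maps S S' f (inv_into V f)"
proof -
  define g where "g = inv_into V f"
  define S' where "S' = pullback_topology (f ` V) g S"
  have V: "subspace V" "topspace S = V"
    and add: "continuous_map (prod_topology S S) S (\<lambda>(x, y). x + y)"
    and scale: "continuous_map (prod_topology euclideanreal S) S (\<lambda>(c, x). c *\<^sub>R x)"
    and nb: "neighbourhood_base_of convex S"
    using assms(1) by (auto simp: locally_convex_tvs_def)
  have gf: "g (f x) = x" if "x \<in> V" for x
    using that assms(3) by (simp add: g_def)
  have top: "topspace S' = f ` V"
    using gf V by (auto simp: S'_def topspace_pullback_topology)
  have g: "continuous_map S' S g"
    unfolding S'_def using continuous_map_pullback[OF continuous_map_id[of S]]
    by (simp add: comp_def id_def)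
  have f: "continuous_map S S' f"
    unfolding S'_def
  proof (rule continuous_map_pullback')
    show "continuous_map S S (g \<circ> f)"
      by (rule continuous_map_eq[OF continuous_map_id]) (use gf V in auto)
  qed (use V in auto)
  have hom: "homeomorphic_maps S S' f g"
    using f g gf V top by (auto simp: homeomorphic_maps_def)
  have sub: "subspace (f ` V)"
    using V assms(2) by (simp add: linear_subspace_image)
  have "continuous_map (prod_topology S' S') S' (\<lambda>(x, y). x + y)"
  proof (rule continuous_map_eq)
    show "continuous_map (prod_topology S' S') S' (f \<circ> (\<lambda>(x, y). x + y) \<circ> (\<lambda>(x, y). (g x, g y)))"
      by (rule continuous_map_compose[OF _ continuous_map_compose[OF add f]])
        (simp add: continuous_map_prod_top g)
  qed (auto simp: top gf linear_add[OF assms(2)] V subspace_add)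
  moreover have "continuous_map (prod_topology euclideanreal S') S' (\<lambda>(c, x). c *\<^sub>R x)"
  proof (rule continuous_map_eq)
    show "continuous_map (prod_topology euclideanreal S') S'
        (f \<circ> (\<lambda>(c, x). c *\<^sub>R x) \<circ> (\<lambda>(c, y). (id c, g y)))"
      by (rule continuous_map_compose[OF _ continuous_map_compose[OF scale f]])
        (use continuous_map_prod_top[of euclideanreal S' euclideanreal S id g] g in simp)
  qed (auto simp: top gf linear_scale[OF assms(2)] V subspace_scale)
  moreover have "neighbourhood_base_of convex S'"
    unfolding neighbourhood_base_of
  proof (intro allI impI)
    fix A y assume A: "openin S' A \<and> y \<in> A"
    then have "A \<subseteq> f ` V" using openin_subset[of S' A] top by simp
    then obtain x where x: "x \<in> V" "y = f x" using A by auto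
    have "openin S {x \<in> topspace S. f x \<in> A}"
      using f A by (auto simp: continuous_map_def)
    then obtain U C where UC: "openin S U" "convex C" "x \<in> U" "U \<subseteq> C" "C \<subseteq> {x \<in> topspace S. f x \<in> A}"
      using nb[unfolded neighbourhood_base_of, rule_format, of "{x \<in> topspace S. f x \<in> A}" x]
        A x V by auto
    have "openin S' (f ` U)"
      using homeomorphic_imp_open_map[OF homeomorphic_maps_imp_map[OF hom]] UC(1)
      by (simp add: open_map_def)
    then show "\<exists>U C. openin S' U \<and> convex C \<and> y \<in> U \<and> U \<subseteq> C \<and> C \<subseteq> A"
      using UC x convex_linear_image[OF assms(2) UC(2)]
      by (intro exI[of _ "f ` U"] exI[of _ "f ` C"]) auto
  qed
  ultimately have "locally_convex_tvs (f ` V) S'"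
    using sub top by (simp add: locally_convex_tvs_def)
  from that[OF this hom[unfolded g_def]] show ?thesis .
qed

lemma group_actionI:
  assumes "group G"
    and closed: "\<And>g x. g \<in> carrier G \<Longrightarrow> x \<in> E \<Longrightarrow> \<phi> g x \<in> E"
    and one: "\<And>x. x \<in> E \<Longrightarrow> \<phi> \<one>\<^bsub>G\<^esub> x = x"
    and mult: "\<And>g h x. g \<in> carrier G \<Longrightarrow> h \<in> carrier G \<Longrightarrow> x \<in> E \<Longrightarrow>
                 \<phi> (g \<otimes>\<^bsub>G\<^esub> h) x = \<phi> g (\<phi> h x)"
    and ext: "\<And>g. g \<in> carrier G \<Longrightarrow> \<phi> g \<in> extensional E"
  shows "group_action G E \<phi>"
proof -
  interpret group G by fact
  have "bij_betw (\<phi> g) E E" if g: "g \<in> carrier G" for g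
  proof (rule bij_betw_byWitness[where f' = "\<phi> (inv\<^bsub>G\<^esub> g)"])
    show "\<forall>x\<in>E. \<phi> (inv\<^bsub>G\<^esub> g) (\<phi> g x) = x"
      using g one mult[of "inv\<^bsub>G\<^esub> g" g] by simp
    show "\<forall>x\<in>E. \<phi> g (\<phi> (inv\<^bsub>G\<^esub> g) x) = x"
      using g one mult[of g "inv\<^bsub>G\<^esub> g"] by simp
  qed (use closed g in auto)
  then have Bij: "\<phi> g \<in> Bij E" if "g \<in> carrier G" for g
    using that ext by (simp add: Bij_def)
  have "\<phi> (g \<otimes>\<^bsub>G\<^esub> h) = compose E (\<phi> g) (\<phi> h)" if "g \<in> carrier G" "h \<in> carrier G" for g h
    using that ext[of "g \<otimes>\<^bsub>G\<^esub> h"] mult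
    by (intro extensionalityI[of _ E]) (auto simp: compose_def)
  then have "\<phi> \<in> hom G (BijGroup E)"
    using Bij by (auto simp: hom_def BijGroup_def)
  then show ?thesis
    by (simp add: group_action_def group_hom_def group_hom_axioms_def is_group group_BijGroup)
qed

lemma continuous_action_subtopology:
  assumes act: "continuous_action G T X \<phi>" and W: "W \<subseteq> topspace X"
    and inv: "\<And>g x. g \<in> carrier G \<Longrightarrow> x \<in> W \<Longrightarrow> \<phi> g x \<in> W" and T: "topspace T = carrier G"
  shows "continuous_action G T (subtopology X W) (\<lambda>g. restrict (\<phi> g) W)"
proof -
  interpret group_action G "topspace X" \<phi> using act by (simp add: continuous_action_def)
  have grp: "group G" using group_hom by (simp add: group_hom_def)
  have "group_action G (topspace (subtopology X W)) (\<lambda>g. restrict (\<phi> g) W)"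
  proof (rule group_actionI[OF grp])
    fix x assume "x \<in> topspace (subtopology X W)"
    then show "restrict (\<phi> \<one>\<^bsub>G\<^esub>) W x = x"
      using fun_cong[OF id_eq_one, of x] by simp
  next
    fix g h x assume "g \<in> carrier G" "h \<in> carrier G" "x \<in> topspace (subtopology X W)"
    then show "restrict (\<phi> (g \<otimes>\<^bsub>G\<^esub> h)) W x = restrict (\<phi> g) W (restrict (\<phi> h) W x)"
      using inv W by (simp add: composition_rule)
  qed (use inv W in \<open>auto simp: extensional_def\<close>)
  moreover have "continuous_map (prod_topology T (subtopology X W)) (subtopology X W)
                   (\<lambda>(g, x). restrict (\<phi> g) W x)"
  proof (rule continuous_map_eq)
    show "continuous_map (prod_topology T (subtopology X W)) (subtopology X W) (\<lambda>(g, x). \<phi> g x)"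
      using act W inv T prod_topology_subtopology(2)[of T X W]
      by (auto simp: continuous_action_def continuous_map_in_subtopology
          continuous_map_from_subtopology)
  qed auto
  ultimately show ?thesis by (simp add: continuous_action_def)
qed

lemma continuous_action_homeomorphic:
  assumes act: "continuous_action G T X \<phi>" and fg: "homeomorphic_maps X Y f g"
    and T: "topspace T = carrier G"
  shows "continuous_action G T Y (\<lambda>h. restrict (\<lambda>y. f (\<phi> h (g y))) (topspace Y))"
proof -
  interpret group_action G "topspace X" \<phi> using act by (simp add: continuous_action_def)
  have grp: "group G" using group_hom by (simp add: group_hom_def)
  have f: "continuous_map X Y f" and g: "continuous_map Y X g"
    and gf: "\<And>x. x \<in> topspace X \<Longrightarrow> g (f x) = x" and fg': "\<And>y. y \<in> topspace Y \<Longrightarrow> f (g y) = y"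
    using fg by (auto simp: homeomorphic_maps_def)
  have fX: "\<And>x. x \<in> topspace X \<Longrightarrow> f x \<in> topspace Y" and gY: "\<And>y. y \<in> topspace Y \<Longrightarrow> g y \<in> topspace X"
    using f g by (auto simp: continuous_map_def)
  have one: "\<phi> \<one>\<^bsub>G\<^esub> x = x" if "x \<in> topspace X" for x
    using id_eq_one that by (metis restrict_apply')
  have "group_action G (topspace Y) (\<lambda>h. restrict (\<lambda>y. f (\<phi> h (g y))) (topspace Y))"
  proof (rule group_actionI[OF grp])
    fix h y assume h: "h \<in> carrier G" and y: "y \<in> topspace Y"
    then show "restrict (\<lambda>y. f (\<phi> h (g y))) (topspace Y) y \<in> topspace Y"
      using fX[OF element_image[OF h gY[OF y] refl]] by simp
  next
    fix y assume "y \<in> topspace Y"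
    then show "restrict (\<lambda>y. f (\<phi> \<one>\<^bsub>G\<^esub> (g y))) (topspace Y) y = y"
      by (simp add: one gY fg')
  next
    fix h k y assume h: "h \<in> carrier G" "k \<in> carrier G" and y: "y \<in> topspace Y"
    have "\<phi> k (g y) \<in> topspace X" using element_image[OF h(2) gY[OF y] refl] .
    then show "restrict (\<lambda>y. f (\<phi> (h \<otimes>\<^bsub>G\<^esub> k) (g y))) (topspace Y) y =
        restrict (\<lambda>y. f (\<phi> h (g y))) (topspace Y) (restrict (\<lambda>y. f (\<phi> k (g y))) (topspace Y) y)"
      using y by (simp add: composition_rule[OF gY[OF y] h] fX gf)
  qed simp
  moreover have "continuous_map (prod_topology T Y) Y
     (\<lambda>(h, y). restrict (\<lambda>y. f (\<phi> h (g y))) (topspace Y) y)"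
  proof (rule continuous_map_eq)
    have "continuous_map (prod_topology T Y) (prod_topology T X) (\<lambda>(h, y). (id h, g y))"
      using continuous_map_prod_top[of T Y T X id g] g by simp
    with act show "continuous_map (prod_topology T Y) Y
        (f \<circ> (\<lambda>(h, x). \<phi> h x) \<circ> (\<lambda>(h, y). (id h, g y)))"
      unfolding continuous_action_def using f by (auto intro: continuous_map_compose)
  qed auto
  ultimately show ?thesis by (simp add: continuous_action_def)
qed

lemma coamenable_in_transfer:
  fixes f :: "'v::real_vector \<Rightarrow> 'w::real_vector" and G :: "('g, 'm) monoid_scheme"
  assumes co: "coamenable_in TYPE('w) G T H" and T: "topspace T = carrier G"
    and V: "locally_convex_tvs V S" "Hausdorff_space S"
    and K: "K \<noteq> {}" "K \<subseteq> V" "convex K" "compactin S K"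
    and act: "continuous_action G T (subtopology S K) \<phi>" "affine_action G K \<phi>"
    and fp: "has_fixed_point H K \<phi>"
    and f: "linear f" "inj_on f V"
  shows "has_fixed_point (carrier G) K \<phi>"
proof -
  obtain S' where S': "locally_convex_tvs (f ` V) S'"
    and hom: "homeomorphic_maps S S' f (inv_into V f)"
    using locally_convex_tvs_image[OF V(1) f] by blast
  define g where "g = inv_into V f"
  have gf: "g (f x) = x" if "x \<in> K" for x
    using that f(2) K(2) by (auto simp: g_def)
  have top: "topspace S = V" "topspace S' = f ` V"
    using V(1) S' by (auto simp: locally_convex_tvs_def)
  have sub: "subspace V" using V(1) by (simp add: locally_convex_tvs_def)
  define \<psi> where "\<psi> h = restrict (\<lambda>y. f (\<phi> h (g y))) (f ` K)" for h
  have homK: "homeomorphic_maps (subtopology S K) (subtopology S' (f ` K)) f g"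
    unfolding g_def by (rule homeomorphic_maps_subtopologies[OF hom]) (use K top in auto)
  have topK: "topspace (subtopology S' (f ` K)) = f ` K" "topspace (subtopology S K) = K"
    using top K by auto
  have closed: "\<phi> h x \<in> K" if "h \<in> carrier G" "x \<in> K" for h x
    using act(1) that topK group_action.element_image[of G "topspace (subtopology S K)" \<phi> h x]
    by (auto simp: continuous_action_def)
  have H: "H \<subseteq> carrier G"
    using co by (simp add: coamenable_in_def subgroup.subset)
  have 1: "Hausdorff_space S'"
    using V(2) hom homeomorphic_Hausdorff_space homeomorphic_space_def by blast
  have 2: "compactin S' (f ` K)"
    using K(4) hom by (auto simp: homeomorphic_maps_def intro: image_compactin)
  have 3: "continuous_action G T (subtopology S' (f ` K)) \<psi>"
    using continuous_action_homeomorphic[OF act(1) homK T] topK unfolding \<psi>_def by simp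
  have 4: "convex (f ` K)" using K(3) f(1) by (simp add: convex_linear_image)
  have comb: "(1 - t) *\<^sub>R x + t *\<^sub>R y \<in> K" if "x \<in> K" "y \<in> K" "t \<in> {0..1}" for x y t
    using K(3) that by (auto simp: convex_alt)
  have lin: "f ((1 - t) *\<^sub>R x + t *\<^sub>R y) = (1 - t) *\<^sub>R f x + t *\<^sub>R f y" for x y t
    using f(1) by (simp add: linear_add linear_scale)
  have 5: "affine_action G (f ` K) \<psi>"
    unfolding affine_action_def
  proof (intro ballI)
    fix h x' y' t assume *: "h \<in> carrier G" "x' \<in> f ` K" "y' \<in> f ` K" "t \<in> {0..1::real}"
    then obtain x y where xy: "x \<in> K" "y \<in> K" "x' = f x" "y' = f y" by auto
    have "\<psi> h (f ((1 - t) *\<^sub>R x + t *\<^sub>R y)) = f (\<phi> h ((1 - t) *\<^sub>R x + t *\<^sub>R y))"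
      using comb[OF xy(1,2) *(4)] by (simp add: \<psi>_def gf)
    also have "\<dots> = f ((1 - t) *\<^sub>R \<phi> h x + t *\<^sub>R \<phi> h y)"
      using act(2)[unfolded affine_action_def, rule_format, OF *(1) xy(1,2) *(4)] by simp
    finally show "\<psi> h ((1 - t) *\<^sub>R x' + t *\<^sub>R y') = (1 - t) *\<^sub>R \<psi> h x' + t *\<^sub>R \<psi> h y'"
      using xy by (simp add: lin \<psi>_def gf)
  qed
  have 6: "has_fixed_point H (f ` K) \<psi>"
    using fp gf unfolding has_fixed_point_def \<psi>_def by (force simp: image_iff)
  have "has_fixed_point (carrier G) (f ` K) \<psi>"
    using co[unfolded coamenable_in_def, THEN conjunct2, rule_format, of "f ` V" S' "f ` K" \<psi>]
      S' 1 2 3 4 5 6 K(1,2) by (simp add: image_mono)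
  then obtain x where x: "x \<in> K" "\<forall>h\<in>carrier G. \<psi> h (f x) = f x"
    by (auto simp: has_fixed_point_def)
  have "\<phi> h x = x" if "h \<in> carrier G" for h
  proof -
    have "f (\<phi> h x) = f x" using x that by (simp add: \<psi>_def gf)
    then show ?thesis using gf closed[OF that x(1)] x(1) by metis
  qed
  then show ?thesis using x(1) by (auto simp: has_fixed_point_def)
qed

lemma linear_embedding_of_span:
  fixes A :: "'v::real_vector set" and j :: "'v \<Rightarrow> 's"
  assumes "inj_on j A"
  obtains f :: "'v \<Rightarrow> 's \<Rightarrow> real" where "linear f" "inj_on f (span A)"
proof -
  obtain B where B: "B \<subseteq> A" "independent B" "A \<subseteq> span B"
    using maximal_independent_subset[of A] .
  have j: "inj_on j B" using assms B(1) by (rule inj_on_subset)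
  define e where "e b = (\<lambda>s. if s = j b then 1 else 0 :: real)" for b
  obtain f :: "'v \<Rightarrow> 's \<Rightarrow> real" where f: "linear f" "\<And>b. b \<in> B \<Longrightarrow> f b = e b"
    using linear_independent_extend[OF B(2), of e] by auto
  have sum_apply: "(\<Sum>x\<in>F. h x) s = (\<Sum>x\<in>F. h x s)" for F :: "'v set" and h :: "'v \<Rightarrow> 's \<Rightarrow> real" and s
    by (induction F rule: infinite_finite_induct) auto
  have "x = 0" if x: "x \<in> span B" "f x = 0" for x
  proof -
    obtain F u where F: "finite F" "F \<subseteq> B" "x = (\<Sum>b\<in>F. u b *\<^sub>R b)"
      using x(1) unfolding span_explicit by auto
    have "u b = 0" if b: "b \<in> F" for b
    proof -
      have "f x = (\<Sum>b\<in>F. u b *\<^sub>R e b)"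
        unfolding F(3) linear_sum[OF f(1)] linear_scale[OF f(1)]
        by (rule sum.cong) (use F(2) f(2) in auto)
      then have "(\<Sum>c\<in>F. u c *\<^sub>R e c) (j b) = 0" using x(2) by simp
      then have "0 = (\<Sum>c\<in>F. (u c *\<^sub>R e c) (j b))" by (simp only: sum_apply)
      also have "\<dots> = (\<Sum>c\<in>F. if c = b then u c else 0)"
      proof (rule sum.cong[OF refl])
        fix c assume "c \<in> F"
        then have "j b = j c \<longleftrightarrow> c = b"
          using inj_on_eq_iff[OF j, of b c] F(2) b by auto
        then show "(u c *\<^sub>R e c) (j b) = (if c = b then u c else 0)"
          by (simp add: scaleR_fun_def e_def)
      qed
      also have "\<dots> = u b" using F(1) b by simp
      finally show ?thesis by simp
    qed
    then show "x = 0" by (simp add: F(3))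
  qed
  then have "inj_on f (span B)"
    by (simp add: linear_inj_on_iff_eq_0[OF f(1) subspace_span])
  moreover have "span A = span B"
    using span_minimal[OF B(3) subspace_span] span_mono[OF B(1)] by (rule subset_antisym)
  ultimately show ?thesis using that[OF f(1)] by simp
qed

text \<open>A convex hull of an orbit is a quotient of \<open>'g \<Rightarrow> real\<close>, and a point in its closure is
  determined by the traces of its neighbourhoods.\<close>

lemma closure_convex_hull_injection:
  fixes \<phi> :: "'g \<Rightarrow> 'v::real_vector"
  assumes "Hausdorff_space S" and C: "C = convex hull (\<phi> ` A)"
  obtains j :: "'v \<Rightarrow> ('g \<Rightarrow> real) set set" where "inj_on j (S closure_of C)"
proof -
  define D where "D a = (\<Sum>h\<in>{h. a h \<noteq> 0}. a h *\<^sub>R \<phi> h)" for a :: "'g \<Rightarrow> real"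
  have D: "\<exists>a. D a = c" if "c \<in> C" for c
  proof -
    have "\<exists>F u. finite F \<and> F \<subseteq> \<phi> ` A \<and> (\<forall>v\<in>F. 0 \<le> u v) \<and> sum u F = 1 \<and>
            (\<Sum>v\<in>F. u v *\<^sub>R v) = c"
      using that unfolding C convex_hull_explicit by (rule CollectD)
    then obtain F u where F: "finite F" "F \<subseteq> \<phi> ` A" "(\<Sum>v\<in>F. u v *\<^sub>R v) = c"
      by (elim exE conjE) (rule that)
    obtain B where B: "B \<subseteq> A" "inj_on \<phi> B" "F = \<phi> ` B"
      using F(2) unfolding subset_image_inj by auto
    have fin: "finite B" using finite_imageD[OF _ B(2)] F(1) B(3) by simp
    define a where "a h = (if h \<in> B then u (\<phi> h) else 0)" for h
    have "D a = (\<Sum>h\<in>B. a h *\<^sub>R \<phi> h)"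
      unfolding D_def by (rule sum.mono_neutral_left) (auto simp: fin a_def split: if_splits)
    also have "\<dots> = c"
      unfolding F(3)[symmetric] B(3) by (simp add: sum.reindex[OF B(2)] a_def)
    finally show ?thesis by blast
  qed
  define j where "j p = {{a. D a \<in> U} | U. openin S U \<and> p \<in> U}" for p
  have "p = q" if p: "p \<in> S closure_of C" and q: "q \<in> S closure_of C" and eq: "j p = j q" for p q
  proof (rule ccontr)
    assume "p \<noteq> q"
    then obtain U W where UW: "openin S U" "openin S W" "p \<in> U" "q \<in> W" "disjnt U W"
      using assms(1)[unfolded Hausdorff_space_def, rule_format, of p q] p q
      by (auto simp: in_closure_of)
    then have "{a. D a \<in> U} \<in> j q" using eq by (auto simp: j_def)
    then obtain U' where U': "{a. D a \<in> U} = {a. D a \<in> U'}" "openin S U'" "q \<in> U'"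
      by (auto simp: j_def)
    have "openin S (U' \<inter> W)" "q \<in> U' \<inter> W" using U' UW by auto
    then obtain c where c: "c \<in> C" "c \<in> U'" "c \<in> W" using q by (auto simp: in_closure_of)
    obtain a where "D a = c" using D[OF c(1)] by auto
    then have "c \<in> U" using U'(1) c(2) by auto
    then show False using UW(5) c(3) by (auto simp: disjnt_iff)
  qed
  then show ?thesis by (intro that[of j] inj_onI)
qed

lemma convex_closure_of:
  assumes V: "locally_convex_tvs V S" and "convex C" "C \<subseteq> V"
  shows "convex (S closure_of C)"
  unfolding convex_alt
proof (intro ballI allI impI)
  fix x y t assume x: "x \<in> S closure_of C" and y: "y \<in> S closure_of C" and t: "0 \<le> t \<and> t \<le> (1::real)"
  have V': "topspace S = V"
    and add: "continuous_map (prod_topology S S) S (\<lambda>(x, y). x + y)"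
    and scale: "continuous_map (prod_topology euclideanreal S) S (\<lambda>(c, x). c *\<^sub>R x)"
    using V by (auto simp: locally_convex_tvs_def)
  have sc: "continuous_map S S (\<lambda>x. c *\<^sub>R x)" for c
  proof -
    have "continuous_map S (prod_topology euclideanreal S) (\<lambda>x. (c, x))"
      by (simp add: continuous_map_paired)
    from continuous_map_compose[OF this scale] show ?thesis by (simp add: comp_def)
  qed
  have "continuous_map (prod_topology S S) (prod_topology S S) (\<lambda>(x, y). ((1 - t) *\<^sub>R x, t *\<^sub>R y))"
    using sc by (simp add: continuous_map_prod_top)
  from continuous_map_compose[OF this add]
  have m: "continuous_map (prod_topology S S) S (\<lambda>(x, y). (1 - t) *\<^sub>R x + t *\<^sub>R y)"
    by (simp add: comp_def case_prod_unfold)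
  have "(\<lambda>(x, y). (1 - t) *\<^sub>R x + t *\<^sub>R y) (x, y)
          \<in> S closure_of ((\<lambda>(x, y). (1 - t) *\<^sub>R x + t *\<^sub>R y) ` (C \<times> C))"
    using continuous_map_image_closure_subset[OF m, of "C \<times> C"] x y
    by (auto simp: closure_of_Times)
  moreover have "(\<lambda>(x, y). (1 - t) *\<^sub>R x + t *\<^sub>R y) ` (C \<times> C) \<subseteq> C"
    using assms(2) t by (auto simp: convex_alt)
  ultimately show "(1 - t) *\<^sub>R x + t *\<^sub>R y \<in> S closure_of C"
    using closure_of_mono by fastforce
qed

theorem coamenable_imp_coamenable_in:
  fixes G :: "('g, 'm) monoid_scheme"
  assumes T: "topological_group G T" and co: "coamenable G T H"
  shows "coamenable_in TYPE('v::real_vector) G T H"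
  unfolding coamenable_in_def
proof (intro conjI allI impI)
  show "subgroup H G" using co by (simp add: coamenable_def coamenable_in_def)
  then have H: "H \<subseteq> carrier G" by (rule subgroup.subset)
  fix V :: "'v set" and S K \<phi>
  assume *: "locally_convex_tvs V S \<and> Hausdorff_space S \<and>
        K \<noteq> {} \<and> K \<subseteq> V \<and> convex K \<and> compactin S K \<and>
        continuous_action G T (subtopology S K) \<phi> \<and> affine_action G K \<phi> \<and>
        has_fixed_point H K \<phi>"
  then have V: "locally_convex_tvs V S" "Hausdorff_space S"
    and K: "K \<noteq> {}" "K \<subseteq> V" "convex K" "compactin S K"
    and act: "continuous_action G T (subtopology S K) \<phi>" "affine_action G K \<phi>"
    and fp: "has_fixed_point H K \<phi>" by auto
  have TG: "topspace T = carrier G" using T by (simp add: topological_group.topspace_carrier)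
  have top: "topspace S = V" and sub: "subspace V" using V(1) by (auto simp: locally_convex_tvs_def)
  have topK: "topspace (subtopology S K) = K" using top K by auto
  interpret group_action G K \<phi> using act(1) topK by (simp add: continuous_action_def)
  have grp: "group G" using group_hom by (simp add: group_hom_def)
  have one: "\<phi> \<one>\<^bsub>G\<^esub> x = x" if "x \<in> K" for x
    using id_eq_one that by (metis restrict_apply')
  obtain x where x: "x \<in> K" "\<And>h. h \<in> H \<Longrightarrow> \<phi> h x = x" using fp by (auto simp: has_fixed_point_def)
  define C where "C = convex hull ((\<lambda>g. \<phi> g x) ` carrier G)"
  define L where "L = S closure_of C"
  have closed: "\<phi> g y \<in> K" if "g \<in> carrier G" "y \<in> K" for g y
    using that element_image by blast
  have CK: "C \<subseteq> K"
    unfolding C_def by (rule hull_minimal) (use closed x K in auto)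
  have "closedin S K" using compactin_imp_closedin V(2) K(4) by blast
  then have LK: "L \<subseteq> K" unfolding L_def using CK closure_of_minimal by blast
  have CL: "C \<subseteq> L" unfolding L_def using CK K top by (simp add: closure_of_subset)
  have "x \<in> C"
    unfolding C_def using grp one[OF x(1)]
    by (intro hull_inc) (metis group.is_monoid image_eqI monoid.one_closed)
  then have xL: "x \<in> L" using CL by blast
  have aff: "\<phi> g ((1 - t) *\<^sub>R y + t *\<^sub>R z) = (1 - t) *\<^sub>R \<phi> g y + t *\<^sub>R \<phi> g z"
    if "g \<in> carrier G" "y \<in> K" "z \<in> K" "0 \<le> t" "t \<le> 1" for g y z t
    using act(2) that by (simp add: affine_action_def)
  have convC: "convex C" by (simp add: C_def)
  have Cinv: "\<phi> g ` C \<subseteq> C" if g: "g \<in> carrier G" for g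
  proof -
    have "C \<subseteq> {y \<in> K. \<phi> g y \<in> C}"
      unfolding C_def
    proof (rule hull_minimal, fold C_def)
      show "(\<lambda>h. \<phi> h x) ` carrier G \<subseteq> {y \<in> K. \<phi> g y \<in> C}"
      proof safe
        fix h assume h: "h \<in> carrier G"
        then show "\<phi> h x \<in> K" using closed x by blast
        have "\<phi> g (\<phi> h x) = \<phi> (g \<otimes>\<^bsub>G\<^esub> h) x" using composition_rule x g h by simp
        also have "\<dots> \<in> C"
          unfolding C_def using g h grp by (intro hull_inc) (simp add: group.is_monoid monoid.m_closed)
        finally show "\<phi> g (\<phi> h x) \<in> C" .
      qed
      show "convex {y \<in> K. \<phi> g y \<in> C}"
        using K(3) convC aff[OF g] by (auto simp: convex_alt)
    qed
    then show ?thesis by auto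
  qed
  have Linv: "\<phi> g y \<in> L" if g: "g \<in> carrier G" and y: "y \<in> L" for g y
  proof -
    have "continuous_map (subtopology S K) (prod_topology T (subtopology S K)) (\<lambda>y. (g, y))"
      using g TG by (simp add: continuous_map_paired)
    moreover have "continuous_map (prod_topology T (subtopology S K)) (subtopology S K) (\<lambda>(g, x). \<phi> g x)"
      using act(1) by (simp add: continuous_action_def)
    ultimately have "continuous_map (subtopology S K) (subtopology S K) (\<phi> g)"
      using continuous_map_compose by (fastforce simp: comp_def)
    then have "\<phi> g ` (subtopology S K closure_of C) \<subseteq> subtopology S K closure_of (\<phi> g ` C)"
      by (rule continuous_map_image_closure_subset)
    also have "\<dots> \<subseteq> subtopology S K closure_of C"
      using Cinv[OF g] by (rule closure_of_mono)
    finally have "\<phi> g ` (subtopology S K closure_of C) \<subseteq> subtopology S K closure_of C" .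
    moreover have "subtopology S K closure_of C = L"
      using CK LK by (simp add: closure_of_subtopology L_def Int_absorb1)
    ultimately show ?thesis using y by blast
  qed
  define W where "W = span L"
  have WV: "W \<subseteq> V" unfolding W_def using LK K(2) sub by (simp add: span_minimal)
  have LW: "L \<subseteq> W" unfolding W_def by (rule span_superset)
  obtain j :: "'v \<Rightarrow> ('g \<Rightarrow> real) set set" where "inj_on j L"
    using closure_convex_hull_injection[OF V(2) C_def] unfolding L_def by blast
  then obtain f :: "'v \<Rightarrow> 'g vector_universe" where f: "linear f" "inj_on f W"
    unfolding W_def using linear_embedding_of_span by blast
  let ?S = "subtopology S W" and ?\<phi> = "\<lambda>g. restrict (\<phi> g) L"
  have convL: "convex L"
    unfolding L_def using convex_closure_of[OF V(1) convC] CK K(2) by blast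
  have "has_fixed_point (carrier G) L ?\<phi>"
  proof (rule coamenable_in_transfer[OF co[unfolded coamenable_def] TG _ _ _ LW convL _ _ _ _ f])
    show "locally_convex_tvs W ?S"
      using locally_convex_tvs_subtopology[OF V(1) _ WV] by (simp add: W_def)
    show "Hausdorff_space ?S" using V(2) by (rule Hausdorff_space_subtopology)
    show "L \<noteq> {}" using xL by blast
    have "compactin S L"
      using closed_compactin[OF K(4) LK] by (simp add: L_def)
    then show "compactin ?S L" using LW by (simp add: compactin_subtopology)
    have "subtopology ?S L = subtopology (subtopology S K) L"
      using LW LK by (simp add: subtopology_subtopology Int_absorb1)
    then show "continuous_action G T (subtopology ?S L) ?\<phi>"
      using continuous_action_subtopology[OF act(1) _ Linv TG] LK unfolding topK by metis
    show "affine_action G L ?\<phi>"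
      using aff LK convL by (auto simp: affine_action_def convex_alt subset_iff)
    show "has_fixed_point H L ?\<phi>"
      using x(2) xL by (auto simp: has_fixed_point_def)
  qed
  then show "has_fixed_point (carrier G) K \<phi>"
    using LK by (auto simp: has_fixed_point_def)
qed

end

theory Submission
  imports Defs "HOL-Probability.Discrete_Topology"
begin

text \<open>
  A dendrite is a tree-like space, and the proof uses two facts about groups acting on it.

  First, commuting groups cannot both move everything: if \<open>A\<close> and \<open>B\<close> commute, then one of them
  fixes a point (\<open>commuting_groups_fixed_point\<close>). Suppose that \<open>A\<close> has no fixed point. Then any two
  closed convex \<open>A\<close>-invariant sets meet, for otherwise the end of the bridge between them would be
  fixed; by Helly's theorem there is a least such set \<open>M\<close>, which \<open>B\<close> must preserve. The fixed
  points in \<open>M\<close> of an element \<open>h\<close> of \<open>B\<close> form a nonempty \<open>A\<close>-invariant closed set, because a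
  homeomorphism of a dendrite has a fixed point (\<open>homeomorphism_fixed_point\<close>). The closed convex
  hull of these points is all of \<open>M\<close>, so every end of \<open>M\<close> is among them. Hence \<open>B\<close> fixes each end of
  \<open>M\<close>, and there is one (\<open>end_exists\<close>).

  Second, a group that preserves a mean on the continuous functions is elementary
  (\<open>invariant_mean_imp_invariant_pair\<close>). Call a point a median if no component of its complement
  has mass more than one half. The medians form a nonempty compact set, no three of them span a
  tripod, and so this set has one or two ends, which the group permutes.

  Co-amenability links the two. The means form a compact convex set on which \<open>G\<close> acts by
  continuous affine maps, and a point fixed by \<open>H1\<close> or \<open>H2\<close> gives a Dirac mean fixed by that
  subgroup. Therefore \<open>G\<close> fixes some mean, and its action is elementary.

  Both facts are proved from the following description of a dendrite \<open>S\<close>: it is compact and locally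
  connected, and for any two points the intersection of all connected sets containing them is an arc
  (the locale \<open>dendritic_set\<close>). To reach this description, the dendrite is embedded
  into a Banach space of bounded functions. There, locally connected compacta are locally path
  connected, and two arcs with the same ends whose images differ would produce a circle.
\<close>

section \<open>Arcs in locally connected compacta\<close>

lemma connected_imp_chain:
  fixes C :: "'b::metric_space set"
  assumes "connected C" "x \<in> C" "y \<in> C" "0 < d"
  obtains f :: "nat \<Rightarrow> 'b" and n where
    "f 0 = x" "\<And>i. n \<le> i \<Longrightarrow> f i = y" "\<And>i. f i \<in> C" "\<And>i. dist (f i) (f (Suc i)) < d"
proof -
  define R where "R a b \<longleftrightarrow> a \<in> C \<and> b \<in> C \<and> dist a b < d" for a b
  have "R\<^sup>*\<^sup>* x y"
  proof (rule connected_equivalence_relation[OF assms(1-3)])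
    have "symp R" by (auto simp: symp_def R_def dist_commute)
    then show "R\<^sup>*\<^sup>* b a" if "R\<^sup>*\<^sup>* a b" for a b
      using that symp_rtranclp sympD by metis
    show "R\<^sup>*\<^sup>* a c" if "R\<^sup>*\<^sup>* a b" "R\<^sup>*\<^sup>* b c" for a b c
      using that by simp
    show "\<exists>T. openin (top_of_set C) T \<and> a \<in> T \<and> (\<forall>x\<in>T. R\<^sup>*\<^sup>* a x)" if "a \<in> C" for a
      using that assms(4) by (intro exI[of _ "C \<inter> ball a d"]) (auto simp: R_def intro!: r_into_rtranclp)
  qed
  then obtain n where "(R ^^ n) x y" by (auto simp: rtranclp_power)
  then obtain f where f: "f 0 = x" "f n = y" "\<And>i. i < n \<Longrightarrow> R (f i) (f (Suc i))"
    by (auto simp: relpowp_fun_conv)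
  have "f i \<in> C" if "i \<le> n" for i
    using f(1,2) f(3)[of i] that assms by (cases "i = n") (auto simp: R_def)
  moreover have "dist (f (min i n)) (f (min (Suc i) n)) < d" for i
    using f(3)[of i] assms(4) by (cases "i < n") (auto simp: R_def min_def)
  ultimately show ?thesis
    using f by (intro that[of "\<lambda>i. f (min i n)" n]) auto
qed

text \<open>Local connectedness of a compact space is uniform, by the Lebesgue number lemma applied to small
  open sets with connected trace.\<close>

lemma uniformly_locally_connected:
  fixes S :: "'b::metric_space set"
  assumes "compact S" "locally connected S" "0 < e"
  obtains d where "0 < d"
    "\<And>x y. \<lbrakk>x \<in> S; y \<in> S; dist x y < d\<rbrakk> \<Longrightarrow>
       \<exists>C. connected C \<and> C \<subseteq> S \<and> x \<in> C \<and> y \<in> C \<and> (\<forall>z\<in>C. dist x z < e)"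
proof -
  define \<G> where "\<G> = {W. open W \<and> connected (S \<inter> W) \<and> (\<forall>a\<in>W. \<forall>b\<in>W. dist a b < e)}"
  have "S \<subseteq> \<Union>\<G>"
  proof
    fix z assume z: "z \<in> S"
    have "openin (top_of_set S) (S \<inter> ball z (e/2))" by (simp add: openin_open_Int)
    then obtain U where U: "openin (top_of_set S) U" "connected U" "z \<in> U" "U \<subseteq> S \<inter> ball z (e/2)"
      using assms(2,3) z unfolding locally_connected by (metis IntI centre_in_ball half_gt_zero)
    then obtain W where W: "open W" "U = S \<inter> W" by (auto simp: openin_open)
    have "W \<inter> ball z (e/2) \<in> \<G>"
    proof -
      have "S \<inter> (W \<inter> ball z (e/2)) = U" using U W by blast
      moreover have "dist a b < e" if "a \<in> ball z (e/2)" "b \<in> ball z (e/2)" for a b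
        using that dist_triangle_half_r[of z a e b] by auto
      ultimately show ?thesis using U W by (auto simp: \<G>_def)
    qed
    moreover have "z \<in> W \<inter> ball z (e/2)" using U W assms(3) by auto
    ultimately show "z \<in> \<Union>\<G>" by blast
  qed
  moreover have "\<And>W. W \<in> \<G> \<Longrightarrow> open W" by (simp add: \<G>_def)
  ultimately obtain d where d: "0 < d" "\<And>x. x \<in> S \<Longrightarrow> \<exists>W\<in>\<G>. ball x d \<subseteq> W"
    using Heine_Borel_lemma[OF assms(1), of \<G>] by metis
  show ?thesis
  proof (rule that[OF d(1)])
    fix x y assume xy: "x \<in> S" "y \<in> S" "dist x y < d"
    then obtain W where W: "W \<in> \<G>" "ball x d \<subseteq> W" using d(2)[OF xy(1)] by blast
    have "x \<in> W" "y \<in> W" using W(2) xy d(1) by (auto simp: subset_iff)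
    moreover have "connected (S \<inter> W)" "\<forall>a\<in>W. \<forall>b\<in>W. dist a b < e"
      using W(1) by (simp_all add: \<G>_def)
    ultimately show "\<exists>C. connected C \<and> C \<subseteq> S \<and> x \<in> C \<and> y \<in> C \<and> (\<forall>z\<in>C. dist x z < e)"
      using xy by (intro exI[of _ "S \<inter> W"]) blast
  qed
qed

text \<open>The path is a uniform limit of step functions. Start with the two points \<open>x\<close>, \<open>y\<close> and refine
  repeatedly: consecutive points of the \<open>n\<close>-th chain lie in a connected set of size \<open>r n\<close>, so they can
  be joined inside it by a chain of mesh \<open>\<delta> (n + 1)\<close>. Padding with repeated points
  gives all links the same number \<open>k\<close> of subdivisions, so that \<open>g n t\<close>, the entry number
  \<open>\<lfloor>t * N n\<rfloor>\<close> of the \<open>n\<close>-th chain of length \<open>N n\<close>, moves by less than \<open>r n\<close> in each refinement. The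
  radii are chosen to be summable.\<close>

lemma path_between_close_points:
  fixes S :: "'b::metric_space set"
  assumes S: "compact S" "locally connected S" and e: "0 < e"
  obtains d where "0 < d"
    "\<And>x y. \<lbrakk>x \<in> S; y \<in> S; dist x y < d\<rbrakk> \<Longrightarrow>
       \<exists>p. path p \<and> path_image p \<subseteq> S \<inter> cball x e \<and> pathstart p = x \<and> pathfinish p = y"
proof -
  define r where "r n = e / 2 ^ (n + 2)" for n :: nat
  have r: "0 < r n" "r n = 2 * r n - 2 * r (Suc n)" for n
    using e by (auto simp: r_def)
  have "\<exists>d>0. \<forall>x\<in>S. \<forall>y\<in>S. dist x y < d \<longrightarrow>
     (\<exists>C. connected C \<and> C \<subseteq> S \<and> x \<in> C \<and> y \<in> C \<and> (\<forall>z\<in>C. dist x z < r n))" for n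
    using uniformly_locally_connected[OF S r(1)[of n]] by metis
  then obtain \<delta> where \<delta>: "\<And>n. 0 < \<delta> n"
    "\<And>n x y. \<lbrakk>x \<in> S; y \<in> S; dist x y < \<delta> n\<rbrakk> \<Longrightarrow>
        \<exists>C. connected C \<and> C \<subseteq> S \<and> x \<in> C \<and> y \<in> C \<and> (\<forall>z\<in>C. dist x z < r n)"
    by metis
  have \<delta>r: "dist x y < r n" if "x \<in> S" "y \<in> S" "dist x y < \<delta> n" for x y n
    using \<delta>(2)[OF that] by blast
  show ?thesis
  proof (rule that[OF \<delta>(1)[of 0]])
    fix x y assume x: "x \<in> S" and y: "y \<in> S" and xy: "dist x y < \<delta> 0"
    \<comment> \<open>\<open>Q n (N, f)\<close>: the sequence \<open>f\<close> is a chain of mesh \<open>\<delta> n\<close> that reaches \<open>y\<close> at index \<open>N\<close>\<close>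
    define Q where "Q n u \<longleftrightarrow> (case u of (N, f) \<Rightarrow> 0 < N \<and> f 0 = x \<and> (\<forall>i\<ge>N. f i = y) \<and>
        (\<forall>i. f i \<in> S) \<and> (\<forall>i. dist (f i) (f (Suc i)) < \<delta> n) \<and>
        (n = 0 \<longrightarrow> (\<forall>i. dist x (f i) < r 0)))" for n and u :: "nat \<times> (nat \<Rightarrow> 'b)"
    \<comment> \<open>\<open>P n u v\<close>: the chain \<open>v\<close> splits each link of \<open>u\<close> into \<open>k\<close> links within distance \<open>r n\<close>\<close>
    define P where "P n u v \<longleftrightarrow> (case u of (N, f) \<Rightarrow> case v of (N', f') \<Rightarrow>
        \<exists>k>0. N' = k * N \<and> (\<forall>i. \<forall>j<k. dist (f i) (f' (k * i + j)) < r n))"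
      for n and u v :: "nat \<times> (nat \<Rightarrow> 'b)"
    have "\<exists>w. \<forall>n. Q n (w n) \<and> P n (w n) (w (Suc n))"
    proof (rule dependent_nat_choice)
      show "\<exists>u. Q 0 u"
        using x y xy \<delta>(1)[of 0] \<delta>r[OF x y xy] r(1)[of 0]
        by (intro exI[of _ "(1, \<lambda>i. if i = 0 then x else y)"]) (auto simp: Q_def)
    next
      fix u n assume u: "Q n u"
      obtain N f where uN: "u = (N, f)" by force
      have f: "0 < N" "f 0 = x" "\<And>i. N \<le> i \<Longrightarrow> f i = y" "\<And>i. f i \<in> S"
        "\<And>i. dist (f i) (f (Suc i)) < \<delta> n"
        using u by (auto simp: Q_def uN)
      have "\<exists>h m. h 0 = f i \<and> (\<forall>j\<ge>m. h j = f (Suc i)) \<and> (\<forall>j. h j \<in> S \<and> dist (f i) (h j) < r n) \<and>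
          (\<forall>j. dist (h j) (h (Suc j)) < \<delta> (Suc n))" for i
      proof -
        obtain C where C: "connected C" "C \<subseteq> S" "f i \<in> C" "f (Suc i) \<in> C" "\<forall>z\<in>C. dist (f i) z < r n"
          using \<delta>(2)[OF f(4) f(4) f(5)] by blast
        obtain h m where h: "h 0 = f i" "\<And>j. m \<le> j \<Longrightarrow> h j = f (Suc i)" "\<And>j. h j \<in> C"
          "\<And>j. dist (h j) (h (Suc j)) < \<delta> (Suc n)"
          using connected_imp_chain[OF C(1,3,4) \<delta>(1)[of "Suc n"]] by metis
        then show ?thesis using C by (intro exI[of _ h] exI[of _ m]) blast
      qed
      then obtain h m where h: "\<And>i. h i 0 = f i" "\<And>i j. m i \<le> j \<Longrightarrow> h i j = f (Suc i)"
        "\<And>i j. h i j \<in> S" "\<And>i j. dist (f i) (h i j) < r n"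
        "\<And>i j. dist (h i j) (h i (Suc j)) < \<delta> (Suc n)"
        by metis
      define k where "k = Suc (\<Sum>i<N. m i)"
      have k: "0 < k" "m i \<le> k" if "i < N" for i
        using that member_le_sum[of i "{..<N}" m] by (auto simp: k_def)
      have k0: "0 < k" by (simp add: k_def)
      define f' where "f' l = (if l < k * N then h (l div k) (l mod k) else y)" for l
      have blk: "f' (k * i + j) = h i j" if "i < N" "j < k" for i j
      proof -
        have "k * i + j < k * Suc i" using that by simp
        also have "\<dots> \<le> k * N" using that by (intro mult_le_mono2) simp
        finally show ?thesis using that by (simp add: f'_def)
      qed
      have fin: "f' (k * i + j) = y" if "N \<le> i" for i j
      proof -
        have "\<not> k * i + j < k * N" using mult_le_mono2[OF that, of k] by linarith
        then show ?thesis by (simp add: f'_def)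
      qed
      have start: "f' (k * i) = f i" for i
        using blk[of i 0] fin[of i 0] f(3)[of i] h(1) k0 by (cases "i < N") auto
      have "dist (f' l) (f' (Suc l)) < \<delta> (Suc n)" for l
      proof -
        define i j where "i = l div k" and "j = l mod k"
        have l: "l = k * i + j" "j < k" using k0 by (auto simp: i_def j_def)
        show ?thesis
        proof (cases "i < N")
          case True
          show ?thesis
          proof (cases "Suc j < k")
            case 2: True
            then show ?thesis using blk[OF True l(2)] blk[OF True 2] h(5) l by simp
          next
            case False
            then have "Suc j = k" using l by simp
            then have "Suc l = k * Suc i" "h i (Suc j) = f (Suc i)"
              using l h(2)[of i k] k(2)[OF True] by auto
            then show ?thesis using blk[OF True l(2)] h(5)[of i j] start l by metis
          qed
        next
          case False
          then have "f' l = y" "f' (Suc l) = y" using fin[of i j] fin[of i "Suc j"] l by auto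
          then show ?thesis using \<delta>(1) by simp
        qed
      qed
      moreover have "f' 0 = x" using start[of 0] f by simp
      moreover have "f' l \<in> S" for l using h(3) y by (simp add: f'_def)
      ultimately have "Q (Suc n) (k * N, f')"
        using f(1) k0 by (auto simp: Q_def f'_def)
      moreover have "dist (f i) (f' (k * i + j)) < r n" if "j < k" for i j
        using blk[of i j] fin[of i j] f(3)[of i] h(4)[of i j] that r(1)[of n] by (cases "i < N") auto
      then have "P n u (k * N, f')" using k0 by (auto simp: P_def uN)
      ultimately show "\<exists>v. Q (Suc n) v \<and> P n u v" by blast
    qed
    then obtain w where w: "\<And>n. Q n (w n)" "\<And>n. P n (w n) (w (Suc n))" by blast
    define N F where "N n = fst (w n)" and "F n = snd (w n)" for n
    have wNF: "w n = (N n, F n)" for n by (simp add: N_def F_def)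
    have F: "0 < N n" "F n 0 = x" "N n \<le> i \<Longrightarrow> F n i = y" "F n i \<in> S"
        "dist (F n i) (F n (Suc i)) < \<delta> n" for n i
      using w(1)[of n] by (auto simp: Q_def wNF)
    have F0: "dist x (F 0 i) < r 0" for i using w(1)[of 0] by (auto simp: Q_def wNF)
    define g where "g n t = F n (nat \<lfloor>t * N n\<rfloor>)" for n and t :: real
    have step: "dist (g n t) (g (Suc n) t) < r n" if t: "0 \<le> t" for n t
    proof -
      obtain k where k: "0 < k" "N (Suc n) = k * N n"
        "\<And>i j. j < k \<Longrightarrow> dist (F n i) (F (Suc n) (k * i + j)) < r n"
        using w(2)[of n] by (auto simp: P_def wNF)
      define i m where "i = nat \<lfloor>t * N n\<rfloor>" and "m = nat \<lfloor>t * N (Suc n)\<rfloor>"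
      have i: "real i \<le> t * N n" "t * N n < real i + 1"
        using t by (auto simp: i_def)
      have eq: "t * N (Suc n) = k * (t * N n)" using k by simp
      have "real (k * i) \<le> t * N (Suc n)"
        using i(1) k(1) by (simp add: eq)
      then have 1: "k * i \<le> m" unfolding m_def by (rule le_nat_floor)
      have "real m \<le> t * N (Suc n)" using t by (simp add: m_def)
      also have "\<dots> < k * (real i + 1)" using i(2) k(1) unfolding eq by (simp add: mult_strict_left_mono)
      also have "\<dots> = real (k * Suc i)" by (simp add: algebra_simps)
      finally have 2: "m < k * Suc i" by linarith
      then have "m = k * i + (m - k * i)" "m - k * i < k" using 1 by auto
      then show ?thesis using k(3) by (metis g_def i_def m_def)
    qed
    have gS: "g n t \<in> S" for n t using F by (simp add: g_def)
    \<comment> \<open>the sum of \<open>r i\<close> over \<open>n \<le> i < n + m\<close>, telescoped by the identity \<open>r i = 2 * r i - 2 * r (i + 1)\<close>\<close>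
    have tail: "dist (g n t) (g (n + m) t) \<le> 2 * r n - 2 * r (n + m)" if t: "0 \<le> t" for n m t
    proof (induction m)
      case (Suc m)
      have "dist (g n t) (g (n + Suc m) t) \<le> dist (g n t) (g (n + m) t) + dist (g (n + m) t) (g (Suc (n + m)) t)"
        using dist_triangle by auto
      then show ?case using Suc step[OF t, of "n + m"] r(2)[of "n + m"] by simp
    qed simp
    have r0: "\<exists>n. r n < c" if "0 < c" for c
    proof -
      have "r \<longlonglongrightarrow> 0" unfolding r_def
        by real_asymp
      then show ?thesis using order_tendstoD(2)[of r 0 sequentially c] that
        by (auto simp: eventually_sequentially)
    qed
    have "\<exists>l\<in>S. (\<lambda>n. g n t) \<longlonglongrightarrow> l" if t: "0 \<le> t" for t
    proof -
      have "Cauchy (\<lambda>n. g n t)"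
        unfolding Cauchy_altdef
      proof (intro allI impI)
        fix c :: real assume "0 < c"
        then obtain M where M: "r M < c / 4" using r0[of "c/4"] by auto
        have "dist (g m t) (g n t) < c" if "m \<ge> M" "n > m" for m n
        proof -
          have 1: "dist (g M t) (g m t) \<le> 2 * r M" "dist (g M t) (g n t) \<le> 2 * r M"
            using tail[OF t, of M "m - M"] tail[OF t, of M "n - M"] that r(1)[of m] r(1)[of n] by auto
          then show ?thesis using M dist_triangle3[of "g m t" "g n t" "g M t"] by simp
        qed
        then show "\<exists>M. \<forall>m\<ge>M. \<forall>n>m. dist (g m t) (g n t) < c" by blast
      qed
      then show ?thesis
        using compact_imp_complete[OF S(1)] gS unfolding complete_def by metis
    qed
    then obtain p where p: "\<And>t. 0 \<le> t \<Longrightarrow> p t \<in> S" "\<And>t. 0 \<le> t \<Longrightarrow> (\<lambda>n. g n t) \<longlonglongrightarrow> p t"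
      by metis
    have close: "dist (g n t) (p t) \<le> 2 * r n" if t: "0 \<le> t" for n t
    proof (rule tendsto_upperbound)
      show "(\<lambda>m. dist (g n t) (g m t)) \<longlonglongrightarrow> dist (g n t) (p t)"
        by (intro tendsto_intros p t)
      show "\<forall>\<^sub>F m in sequentially. dist (g n t) (g m t) \<le> 2 * r n"
        unfolding eventually_sequentially
      proof (intro exI allI impI)
        fix m assume "n \<le> m"
        then show "dist (g n t) (g m t) \<le> 2 * r n"
          using tail[OF t, of n "m - n"] r(1)[of m] by simp
      qed
    qed simp
    \<comment> \<open>times less than \<open>1 / N n\<close> apart select equal or neighbouring entries\<close>
    have near: "dist (g n s) (g n t) \<le> r n" if "0 \<le> s" "s \<le> t" "(t - s) * N n < 1" for n :: nat and s t :: real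
    proof -
      define i j where "i = nat \<lfloor>s * N n\<rfloor>" and "j = nat \<lfloor>t * N n\<rfloor>"
      have st: "0 \<le> s * N n" "s * N n \<le> t * N n" "t * N n < s * N n + 1"
        using that by (auto simp: algebra_simps mult_right_mono)
      then have "j = i \<or> j = Suc i" unfolding i_def j_def by linarith
      then show ?thesis
        using \<delta>r[OF F(4) F(4) F(5)] r(1)[of n] by (auto simp: g_def i_def j_def less_imp_le)
    qed
    have "continuous_on {0..1} p"
    proof (rule continuous_onI)
      fix t c :: real assume t: "t \<in> {0..1}" and c: "0 < c"
      obtain n where n: "r n < c / 5" using r0[of "c/5"] c by auto
      have "dist (p s) (p t) < c" if s: "s \<in> {0..1}" and st: "dist s t < 1 / N n" for s
      proof -
        have "\<bar>s - t\<bar> * N n < 1" using st F(1)[of n] by (simp add: dist_real_def field_simps)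
        then have "dist (g n s) (g n t) \<le> r n"
          using near[of s t n] near[of t s n] s t by (cases "s \<le> t") (auto simp: dist_commute)
        moreover have "dist (g n s) (p s) \<le> 2 * r n" "dist (g n t) (p t) \<le> 2 * r n"
          using close s t by auto
        moreover have "dist (p s) (p t) \<le> dist (g n s) (p s) + dist (g n s) (g n t) + dist (g n t) (p t)"
          using dist_triangle[of "p s" "p t" "g n s"] dist_triangle[of "g n s" "p t" "g n t"]
          by (simp add: dist_commute)
        ultimately show ?thesis using n by linarith
      qed
      then have "\<forall>s\<in>{0..1}. dist s t < 1 / N n \<longrightarrow> dist (p s) (p t) \<le> c"
        by (blast intro: less_imp_le)
      moreover have "0 < 1 / real (N n)" using F(1)[of n] by simp
      ultimately show "\<exists>d>0. \<forall>s\<in>{0..1}. dist s t < d \<longrightarrow> dist (p s) (p t) \<le> c" by blast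
    qed
    moreover have "p 0 = x"
      using p(2)[of 0] F(2) by (auto simp: g_def LIMSEQ_const_iff)
    moreover have "p 1 = y"
      using p(2)[of 1] F(3) by (auto simp: g_def LIMSEQ_const_iff)
    moreover have "dist x (p t) \<le> e" if "0 \<le> t" for t
    proof -
      have "dist x (p t) \<le> dist x (g 0 t) + dist (g 0 t) (p t)" by (rule dist_triangle)
      also have "\<dots> \<le> 3 * r 0" using close[OF that, of 0] F0[of "nat \<lfloor>t * N 0\<rfloor>"] by (simp add: g_def)
      also have "\<dots> \<le> e" using e by (simp add: r_def)
      finally show ?thesis .
    qed
    ultimately show "\<exists>p. path p \<and> path_image p \<subseteq> S \<inter> cball x e \<and> pathstart p = x \<and> pathfinish p = y"
      using p(1) by (intro exI[of _ p]) (auto simp: path_def path_image_def pathstart_def pathfinish_def)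
  qed
qed

proposition locally_connected_compact_imp_locally_path_connected:
  fixes S :: "'b::metric_space set"
  assumes S: "compact S" "locally connected S"
  shows "locally path_connected S"
  unfolding locally_path_connected_im_kleinen
proof (intro allI impI)
  fix v x assume v: "openin (top_of_set S) v \<and> x \<in> v"
  then obtain e where e: "0 < e" "cball x e \<inter> S \<subseteq> v" by (meson openin_contains_cball)
  obtain d where d: "0 < d" "\<And>x y. \<lbrakk>x \<in> S; y \<in> S; dist x y < d\<rbrakk> \<Longrightarrow>
       \<exists>p. path p \<and> path_image p \<subseteq> S \<inter> cball x e \<and> pathstart p = x \<and> pathfinish p = y"
    using path_between_close_points[OF S e(1)] by metis
  have x: "x \<in> S" using v openin_imp_subset by blast
  have *: "\<exists>p. path p \<and> path_image p \<subseteq> v \<and> pathstart p = x \<and> pathfinish p = y"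
    if y: "y \<in> S \<inter> ball x d" for y
  proof -
    obtain p where "path p" "path_image p \<subseteq> S \<inter> cball x e" "pathstart p = x" "pathfinish p = y"
      using d(2)[OF x, of y] y by auto
    then show ?thesis using e(2) by blast
  qed
  then have "S \<inter> ball x d \<subseteq> v" using pathfinish_in_path_image by blast
  then show "\<exists>u. openin (top_of_set S) u \<and> x \<in> u \<and> u \<subseteq> v \<and>
     (\<forall>y. y \<in> u \<longrightarrow> (\<exists>p. path p \<and> path_image p \<subseteq> v \<and> pathstart p = x \<and> pathfinish p = y))"
    using x d(1) * by (intro exI[of _ "S \<inter> ball x d"]) (auto simp: openin_open_Int)
qed

text \<open>The point \<open>c\<close> lies in a subarc of \<open>g\<close> that meets \<open>h\<close> only at its two ends; together with the part of
  \<open>h\<close> between these ends it forms a simple closed path.\<close>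

lemma two_arcs_contain_circle:
  fixes g h :: "real \<Rightarrow> 'b::real_normed_vector"
  assumes g: "arc g" and h: "arc h" and ends: "pathstart g = pathstart h" "pathfinish g = pathfinish h"
    and c: "c \<in> path_image g" "c \<notin> path_image h"
  obtains C where "C \<subseteq> path_image g \<union> path_image h" "C homeomorphic sphere (0::complex) 1"
proof -
  obtain t0 where t0: "t0 \<in> {0..1}" "c = g t0" using c by (auto simp: path_image_def)
  define K where "K = {t \<in> {0..1}. g t \<in> path_image h}"
  have "continuous_on {0..1} g" using g by (simp add: arc_def path_def)
  moreover have "closed (path_image h)" using h by (simp add: closed_arc_image)
  ultimately have K: "closed K"
    unfolding K_def by (simp add: continuous_closed_preimage_constant continuous_on_closed_vimage vimage_def Int_def Collect_conj_eq[symmetric] conj_commute)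
  have "0 \<in> K" "1 \<in> K"
    using ends h g by (auto simp: K_def pathstart_def pathfinish_def path_image_def)
  have t0K: "t0 \<notin> K" using c t0 by (simp add: K_def)
  have "compact (K \<inter> {0..t0})" "compact (K \<inter> {t0..1})" using K by (auto simp: closed_Int_compact)
  moreover have "K \<inter> {0..t0} \<noteq> {}" "K \<inter> {t0..1} \<noteq> {}" using \<open>0 \<in> K\<close> \<open>1 \<in> K\<close> t0 by auto
  ultimately obtain s u where s: "s \<in> K \<inter> {0..t0}" "\<And>t. t \<in> K \<inter> {0..t0} \<Longrightarrow> t \<le> s"
    and u: "u \<in> K \<inter> {t0..1}" "\<And>t. t \<in> K \<inter> {t0..1} \<Longrightarrow> u \<le> t"
    by (metis compact_attains_sup compact_attains_inf)
  have su: "s < t0" "t0 < u" using s(1) u(1) t0K by (auto simp: less_le)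
  have s01: "s \<in> {0..1}" "u \<in> {0..1}" "g s \<in> path_image h" "g u \<in> path_image h"
    using s(1) u(1) by (auto simp: K_def)
  then obtain a b where ab: "a \<in> {0..1}" "b \<in> {0..1}" "h a = g u" "h b = g s"
    by (auto simp: path_image_def)
  have "g s \<noteq> g u" using g s01 su by (metis arc_def inj_onD less_asym')
  then have "a \<noteq> b" using ab by auto
  define g' h' where "g' = subpath s u g" and "h' = subpath a b h"
  have im: "path_image g' = g ` {s..u}" "path_image h' \<subseteq> path_image h"
    using su ab path_image_subpath_subset[of a b h] by (auto simp: g'_def h'_def path_image_subpath)
  have "simple_path (g' +++ h')"
  proof (rule simple_path_join_loop)
    show "arc g'" "arc h'" unfolding g'_def h'_def
      using g h s01 su ab \<open>a \<noteq> b\<close> by (auto intro!: arc_subpath_arc)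
    show "pathfinish g' = pathstart h'" "pathfinish h' = pathstart g'"
      using ab by (auto simp: g'_def h'_def)
    show "path_image g' \<inter> path_image h' \<subseteq> {pathstart g', pathstart h'}"
    proof
      fix z assume "z \<in> path_image g' \<inter> path_image h'"
      then obtain t where t: "t \<in> {s..u}" "z = g t" "g t \<in> path_image h" using im by auto
      then have "t \<in> K" using s01 by (auto simp: K_def)
      then have "t = s \<or> t = u" using s(2)[of t] u(2)[of t] t s01 by (cases "t \<le> t0") auto
      then show "z \<in> {pathstart g', pathstart h'}" using t ab by (auto simp: g'_def h'_def)
    qed
  qed
  moreover have "pathfinish (g' +++ h') = pathstart (g' +++ h')"
    using ab by (auto simp: g'_def h'_def)
  ultimately have "path_image (g' +++ h') homeomorphic sphere (0::complex) 1"
    by (intro homeomorphic_simple_path_image_circle) auto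
  moreover have "path_image (g' +++ h') \<subseteq> path_image g \<union> path_image h"
  proof -
    have "path_image g' \<subseteq> path_image g"
      using s01 by (simp add: g'_def path_image_subpath_subset)
    then show ?thesis using path_image_join_subset[of g' h'] im(2) by blast
  qed
  ultimately show ?thesis using that by blast
qed

text \<open>An arc from \<open>x\<close> to \<open>y\<close> is contained in every connected set \<open>C\<close> that contains its ends. If \<open>C\<close>
  missed a point \<open>c\<close> of the arc, then the component of \<open>S - {c}\<close> containing \<open>C\<close> would be open, hence path
  connected, and would yield a second arc from \<open>x\<close> to \<open>y\<close> avoiding \<open>c\<close>.\<close>

proposition arc_least_connected:
  fixes S :: "'b::{real_normed_vector, complete_space} set"
  assumes S: "compact S" "locally connected S" "connected S"
    and no_circle: "\<And>C. C \<subseteq> S \<Longrightarrow> \<not> C homeomorphic sphere (0::complex) 1"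
    and xy: "x \<in> S" "y \<in> S" "x \<noteq> y"
  obtains g where "arc g" "pathstart g = x" "pathfinish g = y" "path_image g \<subseteq> S"
    "\<And>C. \<lbrakk>connected C; C \<subseteq> S; x \<in> C; y \<in> C\<rbrakk> \<Longrightarrow> path_image g \<subseteq> C"
proof -
  have lpc: "locally path_connected S"
    by (rule locally_connected_compact_imp_locally_path_connected[OF S(1,2)])
  have arcs: "\<exists>g. arc g \<and> path_image g \<subseteq> U \<and> pathstart g = x \<and> pathfinish g = y"
    if U: "openin (top_of_set S) U" "connected U" "x \<in> U" "y \<in> U" for U
  proof -
    have "path_connected U"
    proof -
      have "locally path_connected U" using lpc U(1) by (rule locally_open_subset)
      have "path_component_set U a = U" if "a \<in> U" for a
        by (rule trans[OF path_component_eq_connected_component_set[OF \<open>locally path_connected U\<close>]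
              connected_component_eq_self[OF U(2) that]])
      then show ?thesis by (intro path_connected_component_set[THEN iffD2] ballI)
    qed
    from path_connected_arcwise[THEN iffD1, OF this, rule_format, OF U(3,4) xy(3)]
    show ?thesis .
  qed
  obtain g where g: "arc g" "path_image g \<subseteq> S" "pathstart g = x" "pathfinish g = y"
    using arcs[OF openin_subtopology_self S(3) xy(1,2)] by blast
  show ?thesis
  proof (rule that[OF g(1,3,4,2)], rule ccontr)
    fix C assume C: "connected C" "C \<subseteq> S" "x \<in> C" "y \<in> C" "\<not> path_image g \<subseteq> C"
    then obtain c where c: "c \<in> path_image g" "c \<notin> C" by blast
    define U where "U = connected_component_set (S - {c}) x"
    have "openin (top_of_set S) (S - {c})"
      by (simp add: openin_delete)
    then have "openin (top_of_set S) U"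
      using S(2) c C unfolding U_def locally_connected_open_connected_component by blast
    moreover have "C \<subseteq> U" unfolding U_def using C c by (intro connected_component_maximal) auto
    moreover have "connected U" by (simp add: U_def)
    ultimately obtain h where h: "arc h" "path_image h \<subseteq> U" "pathstart h = x" "pathfinish h = y"
      using arcs[of U] C by blast
    have US: "U \<subseteq> S - {c}" unfolding U_def by (rule connected_component_subset)
    then have "c \<notin> path_image h" using h by blast
    then obtain D where "D \<subseteq> path_image g \<union> path_image h" "D homeomorphic sphere (0::complex) 1"
      using two_arcs_contain_circle[OF g(1) h(1)] g h c by metis
    then show False using no_circle[of D] g h US by blast
  qed
qed

section \<open>Segments, branches and gates in a dendrite\<close>

text \<open>All that is used about dendrites: any two points are joined by an arc that is the least connected
  set containing them. Since \<open>S\<close> is locally connected, components of complements of points are open.\<close>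

locale dendritic_set =
  fixes S :: "'b::metric_space set"
  assumes compact_S: "compact S"
    and locally_connected_S: "locally connected S"
    and least_arc: "\<lbrakk>x \<in> S; y \<in> S; x \<noteq> y\<rbrakk> \<Longrightarrow>
      \<exists>g. arc g \<and> pathstart g = x \<and> pathfinish g = y \<and> path_image g \<subseteq> S \<and>
        (\<forall>C. connected C \<longrightarrow> C \<subseteq> S \<longrightarrow> x \<in> C \<longrightarrow> y \<in> C \<longrightarrow> path_image g \<subseteq> C)"
begin

text \<open>The arc between two points, and the component of \<open>S - {x}\<close> containing \<open>y\<close>; see
  \<open>seg_arc\<close> and \<open>branch_eq_component\<close>. By this definition of \<open>seg\<close>, \<open>x \<notin> seg y z\<close>
  says that \<open>x\<close> does not separate \<open>y\<close> from \<open>z\<close>, which turns topological arguments into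
  manipulations of betweenness.\<close>

definition seg :: "'b \<Rightarrow> 'b \<Rightarrow> 'b set" where
  "seg x y = \<Inter>{C. connected C \<and> C \<subseteq> S \<and> x \<in> C \<and> y \<in> C}"

definition branch :: "'b \<Rightarrow> 'b \<Rightarrow> 'b set" where
  "branch x y = {z \<in> S. x \<notin> seg y z}"

definition seg_convex :: "'b set \<Rightarrow> bool" where
  "seg_convex A \<longleftrightarrow> A \<subseteq> S \<and> (\<forall>x\<in>A. \<forall>y\<in>A. seg x y \<subseteq> A)"

lemma compact_if_closed_subset: "closed C \<Longrightarrow> C \<subseteq> S \<Longrightarrow> compact C"
  using closed_Int_compact[OF _ compact_S, of C] by (simp add: Int_absorb2)

lemma seg_commute: "seg x y = seg y x"
  by (auto simp: seg_def)

lemma seg_least: "\<lbrakk>connected C; C \<subseteq> S; x \<in> C; y \<in> C\<rbrakk> \<Longrightarrow> seg x y \<subseteq> C"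
  by (auto simp: seg_def)

lemma end_in_seg [simp]: "x \<in> seg x y" "y \<in> seg x y"
  by (auto simp: seg_def)

lemma seg_arc:
  assumes "x \<in> S" "y \<in> S" "x \<noteq> y"
  obtains g where "arc g" "pathstart g = x" "pathfinish g = y" "path_image g = seg x y"
proof -
  obtain g where g: "arc g" "pathstart g = x" "pathfinish g = y" "path_image g \<subseteq> S"
    "\<And>C. \<lbrakk>connected C; C \<subseteq> S; x \<in> C; y \<in> C\<rbrakk> \<Longrightarrow> path_image g \<subseteq> C"
    using least_arc[OF assms] by blast
  have "path_image g \<subseteq> seg x y" unfolding seg_def using g(5) by blast
  moreover have "seg x y \<subseteq> path_image g"
    using g pathstart_in_path_image[of g] pathfinish_in_path_image[of g]
    by (intro seg_least) (auto simp: connected_arc_image)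
  ultimately show ?thesis using that g by blast
qed

lemma seg_refl: "x \<in> S \<Longrightarrow> seg x x = {x}"
  using seg_least[of "{x}" x x] end_in_seg(1)[of x x] by auto

lemma
  assumes "x \<in> S" "y \<in> S"
  shows seg_subset: "seg x y \<subseteq> S" and connected_seg: "connected (seg x y)"
    and compact_seg: "compact (seg x y)"
proof -
  have "seg x y \<subseteq> S \<and> connected (seg x y) \<and> compact (seg x y)"
  proof (cases "x = y")
    case True
    then show ?thesis using seg_refl assms by simp
  next
    case False
    then show ?thesis
      using least_arc[OF assms False] seg_arc[OF assms False]
      by (metis compact_arc_image connected_arc_image end_in_seg pathfinish_in_path_image
          pathstart_in_path_image seg_least subset_trans)
  qed
  then show "seg x y \<subseteq> S" "connected (seg x y)" "compact (seg x y)" by auto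
qed

lemma closed_seg: "x \<in> S \<Longrightarrow> y \<in> S \<Longrightarrow> closed (seg x y)"
  by (simp add: compact_imp_closed compact_seg)

lemma seg_triangle:
  assumes "x \<in> S" "y \<in> S" "z \<in> S"
  shows "seg x z \<subseteq> seg x y \<union> seg y z"
proof (rule seg_least)
  have "y \<in> seg x y \<inter> seg y z" by simp
  then show "connected (seg x y \<union> seg y z)"
    using assms by (intro connected_Un connected_seg) blast+
qed (use assms seg_subset in auto)

lemma seg_mono:
  assumes "x \<in> S" "z \<in> S" "y \<in> seg x z"
  shows "seg x y \<subseteq> seg x z"
proof (rule seg_least)
  show "connected (seg x z)" "seg x z \<subseteq> S" using assms connected_seg seg_subset by auto
qed (use assms in auto)

text \<open>For fixed \<open>a\<close>, the relation \<open>x \<in> seg a y\<close> is the tree order with root \<open>a\<close>. The part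
  of the arc from \<open>a\<close> to \<open>y\<close> that ends at \<open>x\<close> is connected, so it contains \<open>seg a x\<close>, and
  it does not reach \<open>y\<close> before its end.\<close>

lemma seg_antisym:
  assumes "a \<in> S" "y \<in> S" and x: "x \<in> seg a y" and y: "y \<in> seg a x"
  shows "x = y"
proof (cases "a = y")
  case True
  then show ?thesis using x assms by (simp add: seg_refl)
next
  case False
  obtain g where g: "arc g" "pathstart g = a" "pathfinish g = y" "path_image g = seg a y"
    using seg_arc[OF assms(1,2) False] .
  have "x \<in> path_image g" using x g by simp
  then obtain t where t: "t \<in> {0..1}" "x = g t" unfolding path_image_def by blast
  have "seg a x \<subseteq> g ` {0..t}"
  proof (rule seg_least)
    have "continuous_on {0..t} g"
      using g(1) t by (auto simp: arc_def path_def intro: continuous_on_subset)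
    then show "connected (g ` {0..t})" by (rule connected_continuous_image) simp
    have "g ` {0..t} \<subseteq> path_image g" using t by (auto simp: path_image_def)
    then show "g ` {0..t} \<subseteq> S" using g(4) seg_subset[OF assms(1,2)] by simp
    show "a \<in> g ` {0..t}" using g(2) t by (auto simp: pathstart_def)
    show "x \<in> g ` {0..t}" using t by auto
  qed
  then obtain s where s: "s \<in> {0..t}" "g s = g 1" using y g(3) by (auto simp: pathfinish_def)
  then have "s = 1" using g(1) t by (auto simp: arc_def inj_on_def)
  then show ?thesis using s t g(3) by (simp add: pathfinish_def)
qed

lemma seg_between:
  assumes "a \<in> S" "z \<in> S" and y: "y \<in> seg a z" and x: "x \<in> seg a y"
  shows "y \<in> seg x z"
proof -
  have yS: "y \<in> S" using y seg_subset assms by blast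
  then have xS: "x \<in> S" using x seg_subset assms by blast
  have "y \<in> seg a x \<or> y \<in> seg x z" using y seg_triangle[OF assms(1) xS assms(2)] by blast
  then show ?thesis using seg_antisym[OF assms(1) yS x] by auto
qed

lemma seg_accumulates_at_end:
  assumes "z \<in> S" "w \<in> S" "z \<noteq> w" "0 < e"
  obtains x where "x \<in> seg z w" "x \<noteq> z" "dist x z < e"
proof -
  obtain g where g: "arc g" "pathstart g = z" "path_image g = seg z w"
    using seg_arc[OF assms(1-3)] by metis
  have "continuous_on {0..1} g" using g(1) by (simp add: arc_def path_def)
  then obtain d where d: "0 < d" "\<And>t. t \<in> {0..1} \<Longrightarrow> dist t 0 < d \<Longrightarrow> dist (g t) (g 0) < e"
    unfolding continuous_on_iff using assms(4) by (metis atLeastAtMost_iff le_numeral_extra(1,3))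
  define t where "t = min (d / 2) 1"
  have t: "0 < t" "t \<in> {0..1}" "dist t 0 < d" using d(1) by (auto simp: t_def)
  have "g t \<noteq> g 0" using g(1) t unfolding arc_def inj_on_def by force
  moreover have "g t \<in> seg z w" using g(3) t(2) unfolding path_image_def by blast
  moreover have "g 0 = z" using g(2) by (simp add: pathstart_def)
  ultimately show ?thesis using that[of "g t"] d(2)[OF t(2,3)] by simp
qed

text \<open>The segment from \<open>a\<close> to \<open>b\<close> is connected and covered by the closed sets \<open>seg a c\<close> and \<open>seg b c\<close>, so
  these meet on it.\<close>

lemma median_exists:
  assumes "a \<in> S" "b \<in> S" "c \<in> S"
  obtains m where "m \<in> S" "m \<in> seg a b" "m \<in> seg b c" "m \<in> seg a c"
proof -
  have "\<not> (seg a c \<inter> seg b c \<inter> seg a b = {})"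
  proof
    assume "seg a c \<inter> seg b c \<inter> seg a b = {}"
    moreover have "seg a b \<subseteq> seg a c \<union> seg b c"
      using seg_triangle[OF assms(1,3,2)] by (simp add: seg_commute[of c b])
    ultimately have "seg a c \<inter> seg a b = {} \<or> seg b c \<inter> seg a b = {}"
      using assms by (intro connected_closedD connected_seg closed_seg) auto
    then show False using end_in_seg by blast
  qed
  then show ?thesis using that seg_subset assms by blast
qed

lemma branch_subset: "branch x y \<subseteq> S"
  by (auto simp: branch_def)

lemma branch_eq_component:
  assumes "x \<in> S" "y \<in> S"
  shows "branch x y = connected_component_set (S - {x}) y"
proof (intro Set.set_eqI iffI)
  fix z assume "z \<in> branch x y"
  then have "z \<in> S" "x \<notin> seg y z" by (auto simp: branch_def)
  moreover have "connected (seg y z)" "seg y z \<subseteq> S"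
    using assms \<open>z \<in> S\<close> connected_seg seg_subset by auto
  ultimately show "z \<in> connected_component_set (S - {x}) y"
    unfolding mem_Collect_eq connected_component_def by (intro exI[of _ "seg y z"]) auto
next
  fix z assume "z \<in> connected_component_set (S - {x}) y"
  then obtain C where "connected C" "C \<subseteq> S - {x}" "y \<in> C" "z \<in> C"
    unfolding mem_Collect_eq connected_component_def by auto
  then show "z \<in> branch x y" using seg_least[of C y z] by (auto simp: branch_def)
qed

lemma connected_branch: "x \<in> S \<Longrightarrow> y \<in> S \<Longrightarrow> connected (branch x y)"
  by (simp add: branch_eq_component)

lemma openin_branch:
  assumes "x \<in> S" "y \<in> S"
  shows "openin (top_of_set S) (branch x y)"
proof (cases "x = y")
  case False
  have "openin (top_of_set S) (S - {x})" by (simp add: openin_delete)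
  then show ?thesis
    using locally_connected_S False assms
    unfolding branch_eq_component[OF assms] locally_connected_open_connected_component by auto
qed (auto simp: branch_def)

lemma branch_self: "y \<in> S \<Longrightarrow> x \<noteq> y \<Longrightarrow> y \<in> branch x y"
  by (auto simp: branch_def seg_refl)

lemma centre_notin_branch: "x \<notin> branch x y"
  by (simp add: branch_def)

lemma branch_eq:
  assumes "y \<in> S" "z \<in> branch x y"
  shows "branch x z = branch x y"
proof -
  have z: "z \<in> S" "x \<notin> seg y z" using assms(2) by (auto simp: branch_def)
  have "x \<in> seg z w \<longleftrightarrow> x \<in> seg y w" if "w \<in> S" for w
    using seg_triangle[OF assms(1) z(1) that] seg_triangle[OF z(1) assms(1) that] z(2)
    by (auto simp: seg_commute[of z y])
  then show ?thesis by (auto simp: branch_def)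
qed

lemma seg_convex_connected: "connected A \<Longrightarrow> A \<subseteq> S \<Longrightarrow> seg_convex A"
  by (auto simp: seg_convex_def dest: seg_least)

lemma seg_convex_seg: "x \<in> S \<Longrightarrow> y \<in> S \<Longrightarrow> seg_convex (seg x y)"
  by (simp add: seg_convex_connected connected_seg seg_subset)

lemma seg_convex_Int: "seg_convex A \<Longrightarrow> seg_convex B \<Longrightarrow> seg_convex (A \<inter> B)"
  by (auto simp: seg_convex_def)

lemma seg_convex_Inter:
  assumes "\<F> \<noteq> {}" "\<And>A. A \<in> \<F> \<Longrightarrow> seg_convex A"
  shows "seg_convex (\<Inter>\<F>)"
  unfolding seg_convex_def
proof (intro conjI ballI)
  show "\<Inter>\<F> \<subseteq> S" using assms unfolding seg_convex_def by blast
  fix x y assume xy: "x \<in> \<Inter>\<F>" "y \<in> \<Inter>\<F>"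
  show "seg x y \<subseteq> \<Inter>\<F>"
  proof (rule Inter_greatest)
    fix A assume A: "A \<in> \<F>"
    then have "x \<in> A" "y \<in> A" using xy by auto
    then show "seg x y \<subseteq> A" using assms(2)[OF A] by (simp add: seg_convex_def)
  qed
qed

lemma seg_convex_branch_closure:
  assumes "x \<in> S" "y \<in> S" "x \<noteq> y"
  shows "seg_convex (insert x (branch x y))" "closed (insert x (branch x y))"
proof -
  have S: "insert x (branch x y) \<subseteq> S" using assms branch_subset by blast
  have *: "seg x b \<subseteq> insert x (branch x y)" if b: "b \<in> branch x y" for b
  proof
    fix u assume u: "u \<in> seg x b"
    have bS: "b \<in> S" using b by (auto simp: branch_def)
    have uS: "u \<in> S" using u seg_subset[OF assms(1) bS] by blast
    show "u \<in> insert x (branch x y)"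
    proof (cases "x \<in> seg b u")
      case True
      then have "u = x" using seg_antisym[OF bS assms(1), of u] u seg_commute by metis
      then show ?thesis by simp
    next
      case False
      then have "u \<in> branch x b" using uS by (simp add: branch_def)
      then show ?thesis using branch_eq[OF assms(2) b] by simp
    qed
  qed
  have "seg_convex (branch x y)"
    using connected_branch assms branch_subset seg_convex_connected by blast
  then show "seg_convex (insert x (branch x y))"
    using * S assms unfolding seg_convex_def
    by (metis insert_iff insert_subset seg_commute seg_refl subset_insertI2 empty_subsetI)
  \<comment> \<open>the complement is the union of the other branches at \<open>x\<close>\<close>
  have "openin (top_of_set S) (S - insert x (branch x y))"
  proof (subst openin_subopen, intro ballI)
    fix w assume "w \<in> S - insert x (branch x y)"
    then have w: "w \<in> S" "x \<noteq> w" "w \<notin> branch x y" by auto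
    have "v \<notin> branch x y" if v: "v \<in> branch x w" for v
    proof
      assume "v \<in> branch x y"
      from branch_eq[OF assms(2) this] have "branch x w = branch x y"
        unfolding branch_eq[OF w(1) v] .
      then show False using w(3) branch_self[OF w(1,2)] by simp
    qed
    then have "branch x w \<subseteq> S - insert x (branch x y)"
      using branch_subset[of x w] centre_notin_branch[of x w] by blast
    then show "\<exists>T. openin (top_of_set S) T \<and> w \<in> T \<and> T \<subseteq> S - insert x (branch x y)"
      using openin_branch[OF assms(1) w(1)] branch_self[OF w(1,2)] by blast
  qed
  then have "closedin (top_of_set S) (insert x (branch x y))"
    using S by (simp add: closedin_def)
  then show "closed (insert x (branch x y))"
    using compact_imp_closed[OF compact_S] by (rule closedin_closed_trans)
qed

lemma closed_beyond:
  assumes "x \<in> S" "y \<in> S"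
  shows "closed {z \<in> S. x \<in> seg y z}"
proof -
  have "{z \<in> S. x \<in> seg y z} = S - branch x y" by (auto simp: branch_def)
  moreover have "closedin (top_of_set S) (S - branch x y)"
    using openin_branch[OF assms] by (simp add: closedin_diff)
  ultimately show ?thesis
    using compact_imp_closed[OF compact_S] by (metis closedin_closed_trans)
qed

text \<open>If \<open>x\<close> separates \<open>y\<close> from \<open>z\<close> and from \<open>w\<close> but not from some \<open>u\<close> between \<open>z\<close> and \<open>w\<close>, then \<open>x\<close>
  lies on both halves of the segment, which only share the point \<open>u\<close>.\<close>

lemma seg_convex_beyond:
  assumes "x \<in> S" "y \<in> S"
  shows "seg_convex {z \<in> S. x \<in> seg y z}"
  unfolding seg_convex_def
proof (intro conjI ballI subsetI)
  fix z w u assume z: "z \<in> {z \<in> S. x \<in> seg y z}" and w: "w \<in> {z \<in> S. x \<in> seg y z}" and u: "u \<in> seg z w"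
  then have uS: "u \<in> S" using seg_subset by blast
  have "x \<in> seg y u"
  proof (rule ccontr)
    assume x: "x \<notin> seg y u"
    have zw: "z \<in> S" "w \<in> S" "x \<in> seg y z" "x \<in> seg y w" using z w by auto
    have 1: "x \<in> seg u z" using seg_triangle[OF assms(2) uS zw(1)] zw(3) x by blast
    have 2: "x \<in> seg u w" using seg_triangle[OF assms(2) uS zw(2)] zw(4) x by blast
    have "x \<in> seg z u" using 1 by (simp only: seg_commute)
    then have "u \<in> seg x w" using seg_between[OF zw(1,2) u] by blast
    then have "u \<in> seg w x" "x \<in> seg w u" using 2 by (simp_all only: seg_commute)
    then have "x = u" using seg_antisym[OF zw(2) uS] by blast
    then show False using x by simp
  qed
  then show "u \<in> {z \<in> S. x \<in> seg y z}" using uS by simp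
qed auto

text \<open>Three convex sets with common points in pairs contain the median of these points.\<close>

lemma seg_convex_Int3:
  assumes "seg_convex A" "seg_convex B" "seg_convex C" "A \<inter> B \<noteq> {}" "B \<inter> C \<noteq> {}" "A \<inter> C \<noteq> {}"
  shows "A \<inter> B \<inter> C \<noteq> {}"
proof -
  obtain a b c where abc: "a \<in> B \<inter> C" "b \<in> A \<inter> C" "c \<in> A \<inter> B" using assms by blast
  then have "a \<in> S" "b \<in> S" "c \<in> S" using assms by (auto simp: seg_convex_def)
  then obtain m where "m \<in> seg a b" "m \<in> seg b c" "m \<in> seg a c" using median_exists by metis
  then have "m \<in> A \<inter> B \<inter> C" using abc assms(1-3) unfolding seg_convex_def by blast
  then show ?thesis by blast
qed

lemma Helly_finite:
  assumes "finite \<F>" "\<And>A. A \<in> \<F> \<Longrightarrow> seg_convex A"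
    "\<And>A B. A \<in> \<F> \<Longrightarrow> B \<in> \<F> \<Longrightarrow> A \<inter> B \<noteq> {}"
    "seg_convex K" "K \<noteq> {}" "\<And>A. A \<in> \<F> \<Longrightarrow> K \<inter> A \<noteq> {}"
  shows "K \<inter> \<Inter>\<F> \<noteq> {}"
  using assms
proof (induction arbitrary: K rule: finite_induct)
  case (insert A \<F>)
  have "(K \<inter> A) \<inter> \<Inter>\<F> \<noteq> {}"
  proof (rule insert.IH)
    show "seg_convex (K \<inter> A)" using insert.prems by (simp add: seg_convex_Int)
    show "K \<inter> A \<noteq> {}" using insert.prems by blast
    show "K \<inter> A \<inter> B \<noteq> {}" if "B \<in> \<F>" for B
      using that insert.prems by (intro seg_convex_Int3) auto
  qed (use insert.prems in auto)
  then show ?case by (simp add: Int_assoc)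
qed simp

text \<open>Compactness reduces the claim to finite families, where \<open>seg_convex_Int3\<close> drives an induction.\<close>

proposition Helly:
  assumes "\<And>A. A \<in> \<F> \<Longrightarrow> closed A" "\<And>A. A \<in> \<F> \<Longrightarrow> seg_convex A"
    "\<And>A B. A \<in> \<F> \<Longrightarrow> B \<in> \<F> \<Longrightarrow> A \<inter> B \<noteq> {}" "\<F> \<noteq> {}"
  shows "\<Inter>\<F> \<noteq> {}"
proof -
  have S: "A \<subseteq> S" if "A \<in> \<F>" for A using assms(2) that by (auto simp: seg_convex_def)
  obtain A where A: "A \<in> \<F>" using assms(4) by blast
  have "A \<inter> \<Inter>\<F> \<noteq> {}"
  proof (rule compact_imp_fip)
    show "compact A" using assms(1)[OF A] S[OF A] by (rule compact_if_closed_subset)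
    show "A \<inter> \<Inter>\<F>' \<noteq> {}" if "finite \<F>'" "\<F>' \<subseteq> \<F>" for \<F>'
      using that assms(2,3) A by (intro Helly_finite) blast+
  qed (use assms in auto)
  then show ?thesis by blast
qed

text \<open>The gate is the point of \<open>A\<close> through which every segment from \<open>b\<close> enters \<open>A\<close>. The sets
  \<open>A \<inter> seg a b\<close> have common points in pairs, because a median of \<open>a\<close>, \<open>a'\<close>, \<open>b\<close> lies in \<open>A\<close>; so Helly's
  theorem applies.\<close>

lemma gate_exists:
  assumes A: "seg_convex A" "closed A" "A \<noteq> {}" and b: "b \<in> S"
  obtains p where "p \<in> A" "\<And>a. a \<in> A \<Longrightarrow> p \<in> seg a b"
proof -
  have AS: "A \<subseteq> S" using A by (simp add: seg_convex_def)
  have "\<Inter>((\<lambda>a. A \<inter> seg a b) ` A) \<noteq> {}"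
  proof (rule Helly)
    fix C assume "C \<in> (\<lambda>a. A \<inter> seg a b) ` A"
    then obtain a where a: "a \<in> A" "C = A \<inter> seg a b" by blast
    then show "closed C" "seg_convex C"
      using A b AS by (auto intro!: closed_Int closed_seg seg_convex_Int seg_convex_seg)
  next
    fix C D assume "C \<in> (\<lambda>a. A \<inter> seg a b) ` A" "D \<in> (\<lambda>a. A \<inter> seg a b) ` A"
    then obtain a a' where a: "a \<in> A" "C = A \<inter> seg a b" "a' \<in> A" "D = A \<inter> seg a' b" by blast
    then obtain m where "m \<in> seg a a'" "m \<in> seg a' b" "m \<in> seg a b"
      using median_exists[of a a' b] AS b by blast
    moreover have "seg a a' \<subseteq> A" using a A(1) by (auto simp: seg_convex_def)
    ultimately show "C \<inter> D \<noteq> {}" using a by blast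
  qed (use A in auto)
  then show ?thesis using that A(3) by blast
qed

lemma gate_unique:
  assumes "A \<subseteq> S" "b \<in> S" "p \<in> A" "q \<in> A" "\<And>a. a \<in> A \<Longrightarrow> p \<in> seg a b" "\<And>a. a \<in> A \<Longrightarrow> q \<in> seg a b"
  shows "p = q"
  using seg_antisym[of b q p] assms by (metis seg_commute subsetD)

text \<open>One point near \<open>z\<close> separates \<open>z\<close> from all of \<open>Q\<close>. Each \<open>q\<close> has a point \<open>h q\<close> strictly between \<open>z\<close> and
  \<open>q\<close>, which also separates \<open>z\<close> from a neighbourhood of \<open>q\<close>. Finitely many of these points suffice,
  and they can be merged because medians of \<open>z\<close> and two points of one branch at \<open>z\<close> stay in the
  branch. This replaces continuity of measure and approximation along an arc.\<close>

lemma separating_point: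
  assumes z: "z \<in> S" and y: "y \<in> S" "z \<noteq> y" and Q: "compact Q" "Q \<subseteq> branch z y"
  obtains x where "x \<in> branch z y" "\<And>q. q \<in> Q \<Longrightarrow> x \<in> seg z q"
proof -
  have QS: "Q \<subseteq> S" using Q branch_subset by blast
  have "\<exists>x. x \<in> seg z q \<and> x \<noteq> z \<and> x \<noteq> q" if "q \<in> Q" for q
  proof -
    have "z \<noteq> q" using that Q(2) centre_notin_branch by blast
    moreover have "q \<in> S" using that QS by blast
    ultimately obtain x where "x \<in> seg z q" "x \<noteq> z" "dist x z < dist q z"
      using seg_accumulates_at_end[OF z, of q "dist q z"] by auto
    then show ?thesis by auto
  qed
  then obtain h where h: "\<And>q. q \<in> Q \<Longrightarrow> h q \<in> seg z q \<and> h q \<noteq> z \<and> h q \<noteq> q" by metis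
  have hS: "h q \<in> S" if "q \<in> Q" for q using h[OF that] seg_subset z QS that by blast
  have h_sep: "h q \<in> seg z w" if q: "q \<in> Q" and w: "w \<in> branch (h q) q" for q w
  proof -
    have "w \<in> S" "h q \<notin> seg q w" using w by (auto simp: branch_def)
    then show ?thesis
      using seg_triangle[OF z \<open>w \<in> S\<close>, of q] QS q h[OF q] by (auto simp: seg_commute[of w q])
  qed
  have h_branch: "h q \<in> branch z y" if q: "q \<in> Q" for q
  proof -
    have "z \<notin> seg q (h q)"
      using seg_antisym[of q z "h q"] h[OF q] q QS z by (auto simp: seg_commute)
    then have "h q \<in> branch z q" using hS[OF q] by (simp add: branch_def)
    then show ?thesis using branch_eq[OF y(1), of q z] q Q(2) by blast
  qed
  \<comment> \<open>finitely many of the separating points suffice\<close>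
  have "\<exists>T. open T \<and> branch (h q) q = S \<inter> T" if "q \<in> Q" for q
    using openin_branch[of "h q" q] hS QS that by (auto simp: openin_open)
  then obtain T where T: "\<And>q. q \<in> Q \<Longrightarrow> open (T q) \<and> branch (h q) q = S \<inter> T q" by metis
  have "Q \<subseteq> (\<Union>q\<in>Q. T q)"
  proof
    fix q assume q: "q \<in> Q"
    then have "q \<in> branch (h q) q" using branch_self[of q "h q"] h QS by blast
    then show "q \<in> (\<Union>q\<in>Q. T q)" using T q by blast
  qed
  then obtain P where P: "P \<subseteq> Q" "finite P" "Q \<subseteq> (\<Union>q\<in>P. T q)"
    using compactE_image[OF Q(1), of Q T] T by metis
  have "\<exists>x\<in>branch z y. \<forall>p\<in>P. x \<in> seg z (h p)"
    using P(2,1)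
  proof (induction rule: finite_induct)
    case empty
    then show ?case using branch_self[OF y(1), of z] y by auto
  next
    case (insert p P)
    then obtain x where x: "x \<in> branch z y" "\<And>p. p \<in> P \<Longrightarrow> x \<in> seg z (h p)" by auto
    have p: "h p \<in> branch z y" "p \<in> Q" using h_branch insert by auto
    have xS: "x \<in> S" using x branch_subset by blast
    obtain m where m: "m \<in> S" "m \<in> seg z x" "m \<in> seg x (h p)" "m \<in> seg z (h p)"
      using median_exists[OF z xS hS[OF p(2)]] by metis
    have "seg_convex (branch z y)"
      using connected_branch[OF z y(1)] branch_subset by (rule seg_convex_connected)
    then have "m \<in> branch z y" using x p m unfolding seg_convex_def by blast
    moreover have "m \<in> seg z (h r)" if "r \<in> P" for r
      using seg_mono[OF z hS x(2)[OF that]] m that insert.prems by blast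
    ultimately show ?case using m by blast
  qed
  then obtain x where x: "x \<in> branch z y" "\<And>p. p \<in> P \<Longrightarrow> x \<in> seg z (h p)" by blast
  show ?thesis
  proof (rule that[OF x(1)])
    fix q assume q: "q \<in> Q"
    then obtain p where p: "p \<in> P" "q \<in> T p" using P by blast
    then have "q \<in> branch (h p) p" using T P QS q by blast
    then have "h p \<in> seg z q" using h_sep P p by blast
    then show "x \<in> seg z q" using seg_mono[OF z _ \<open>h p \<in> seg z q\<close>] x(2)[OF p(1)] q QS by blast
  qed
qed

text \<open>For a closed convex set these are the usual end points. For the set of medians, which lies on
  an arc, they are its extreme points.\<close>

definition is_end :: "'b set \<Rightarrow> 'b \<Rightarrow> bool" where
  "is_end F e \<longleftrightarrow> e \<in> F \<and> (\<forall>x\<in>F - {e}. \<forall>y\<in>F - {e}. e \<notin> seg x y)"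

text \<open>A maximal element of \<open>F\<close> in the tree order with a root \<open>p\<close> in \<open>F\<close> is an end. Chains are bounded because
  the sets of points beyond a given point are closed.\<close>

lemma end_exists:
  assumes F: "compact F" "F \<subseteq> S" "F \<noteq> {}"
  obtains e where "is_end F e"
proof -
  obtain p where p: "p \<in> F" using F by blast
  then have pS: "p \<in> S" using F by blast
  define P where "P x y \<longleftrightarrow> x \<in> seg p y" for x y
  have P_trans: "P a c" if "P a b" "P b c" "c \<in> F" for a b c
    using that seg_mono[OF pS, of c b] F by (auto simp: P_def)
  have "\<exists>m\<in>F. \<forall>a\<in>F. P m a \<longrightarrow> a = m"
  proof (rule predicate_Zorn)
    show "partial_order_on F (relation_of P F)"
    proof (rule partial_order_on_relation_ofI)
      show "P a a" for a by (simp add: P_def)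
      show "P a c" if "a \<in> F" "b \<in> F" "c \<in> F" "P a b" "P b c" for a b c
        using that P_trans by blast
      show "a = b" if "a \<in> F" "b \<in> F" "P a b" "P b a" for a b
        using that seg_antisym[OF pS, of b a] F by (auto simp: P_def)
    qed
  next
    fix C assume C: "C \<in> Chains (relation_of P F)"
    have CF: "C \<subseteq> F" and tot: "\<And>a b. a \<in> C \<Longrightarrow> b \<in> C \<Longrightarrow> P a b \<or> P b a"
      using C by (auto simp: Chains_def relation_of_def)
    have "F \<inter> (\<Inter>a\<in>C. {w \<in> S. a \<in> seg p w}) \<noteq> {}"
    proof (rule compact_imp_fip_image[OF F(1)])
      show "closed {w \<in> S. a \<in> seg p w}" if "a \<in> C" for a
        using that CF F pS by (intro closed_beyond) auto
      fix D assume D: "finite D" "D \<subseteq> C"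
      have "\<exists>m\<in>insert p D. \<forall>a\<in>D. P a m"
        using D
      proof (induction rule: finite_induct)
        case (insert a D)
        then obtain m where m: "m \<in> insert p D" "\<And>b. b \<in> D \<Longrightarrow> P b m" by auto
        have aC: "a \<in> C" "a \<in> F" using insert.prems CF by auto
        have "P m a \<or> P a m" using m(1) tot aC insert.prems by (auto simp: P_def)
        then show ?case
        proof
          assume "P m a"
          then have "P b a" if "b \<in> D" for b using m(2)[OF that] P_trans aC by blast
          then show ?thesis by (auto simp: P_def)
        next
          assume "P a m"
          then show ?thesis using m by auto
        qed
      qed simp
      then obtain m where "m \<in> insert p D" "\<And>a. a \<in> D \<Longrightarrow> P a m" by blast
      then have m: "m \<in> F" "\<And>a. a \<in> D \<Longrightarrow> P a m" using p D CF by auto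
      then have "m \<in> F \<inter> (\<Inter>a\<in>D. {w \<in> S. a \<in> seg p w})" using F by (auto simp: P_def)
      then show "F \<inter> (\<Inter>a\<in>D. {w \<in> S. a \<in> seg p w}) \<noteq> {}" by blast
    qed
    then show "\<exists>u\<in>F. \<forall>a\<in>C. P a u" by (auto simp: P_def)
  qed
  then obtain e where e: "e \<in> F" "\<And>a. a \<in> F \<Longrightarrow> e \<in> seg p a \<Longrightarrow> a = e" by (auto simp: P_def)
  have "is_end F e"
    unfolding is_end_def
  proof (intro conjI ballI)
    fix x y assume xy: "x \<in> F - {e}" "y \<in> F - {e}"
    then have "e \<notin> seg p x" "e \<notin> seg p y" using e(2) by blast+
    then show "e \<notin> seg x y"
      using seg_triangle[of x p y] xy F pS by (auto simp: seg_commute[of x p])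
  qed (fact e(1))
  then show ?thesis by (rule that)
qed

text \<open>At each \<open>x\<close> a direction is chosen, namely the branch containing \<open>d x\<close>. If no two directions point
  away from each other, then Helly's theorem gives a point \<open>z\<close> towards which all directions point.
  In both applications this point is contradictory: \<open>d x\<close> is \<open>f x\<close> for a homeomorphism without fixed
  points, or leads to a branch with more than half of the mass.\<close>

lemma compatible_directions_meet:
  assumes "S \<noteq> {}" and d: "\<And>x. x \<in> S \<Longrightarrow> d x \<in> S \<and> d x \<noteq> x"
    and meet: "\<And>x y. \<lbrakk>x \<in> S; y \<in> S; x \<noteq> y\<rbrakk> \<Longrightarrow>
       insert x (branch x (d x)) \<inter> insert y (branch y (d y)) \<noteq> {}"
  obtains z where "z \<in> S" "\<And>x. x \<in> S \<Longrightarrow> x \<noteq> z \<Longrightarrow> z \<in> branch x (d x)"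
proof -
  have "\<Inter>((\<lambda>x. insert x (branch x (d x))) ` S) \<noteq> {}"
  proof (rule Helly)
    fix A assume "A \<in> (\<lambda>x. insert x (branch x (d x))) ` S"
    then show "closed A" "seg_convex A"
      using seg_convex_branch_closure d by (metis (no_types, lifting) imageE)+
  next
    fix A B assume "A \<in> (\<lambda>x. insert x (branch x (d x))) ` S" "B \<in> (\<lambda>x. insert x (branch x (d x))) ` S"
    then obtain x y where "x \<in> S" "y \<in> S" "A = insert x (branch x (d x))" "B = insert y (branch y (d y))"
      by blast
    then show "A \<inter> B \<noteq> {}" using meet[of x y] by (cases "x = y") auto
  qed (use assms in auto)
  then obtain z where z: "\<And>x. x \<in> S \<Longrightarrow> z \<in> insert x (branch x (d x))" by blast
  obtain x where "x \<in> S" using assms(1) by blast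
  then have "z \<in> S" using z[of x] branch_subset by blast
  then show ?thesis using that z by blast
qed

lemma homeomorphism_seg:
  assumes f: "homeomorphism S S f f'" and xy: "x \<in> S" "y \<in> S"
  shows "f ` seg x y = seg (f x) (f y)"
proof -
  have im: "seg (h x) (h y) \<subseteq> h ` seg x y" if h: "homeomorphism S S h h'" and "x \<in> S" "y \<in> S" for h h' x y
  proof (rule seg_least)
    have sub: "seg x y \<subseteq> S" using that seg_subset by blast
    with homeomorphism_cont1[OF h] have "continuous_on (seg x y) h" by (rule continuous_on_subset)
    then show "connected (h ` seg x y)" using that connected_seg connected_continuous_image by blast
    show "h ` seg x y \<subseteq> S" using sub homeomorphism_image1[OF h] by blast
  qed auto
  have fxy: "f x \<in> S" "f y \<in> S" "f' (f x) = x" "f' (f y) = y"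
    using xy homeomorphism_image1[OF f] homeomorphism_apply1[OF f] by blast+
  have "seg x y \<subseteq> f' ` seg (f x) (f y)"
    using im[OF homeomorphism_symD[OF f] fxy(1,2)] unfolding fxy .
  then have "f ` seg x y \<subseteq> f ` (f' ` seg (f x) (f y))" by blast
  also have "\<dots> = (\<lambda>u. u) ` seg (f x) (f y)"
    unfolding image_image
    using seg_subset[OF fxy(1,2)] homeomorphism_apply2[OF f] by (intro image_cong) auto
  finally show ?thesis using im[OF f xy] by auto
qed

lemma homeomorphism_mem_seg:
  assumes f: "homeomorphism S S f f'" and "x \<in> S" "y \<in> S" "u \<in> S"
  shows "f u \<in> seg (f x) (f y) \<longleftrightarrow> u \<in> seg x y"
proof -
  have "inj_on f S" using f by (metis homeomorphism_def inj_on_inverseI)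
  then show ?thesis
    using homeomorphism_seg[OF f assms(2,3)] seg_subset[OF assms(2,3)] assms(4)
    by (metis inj_on_image_mem_iff)
qed

lemma homeomorphism_branch:
  assumes f: "homeomorphism S S f f'" and "x \<in> S" "y \<in> S"
  shows "f ` branch x y = branch (f x) (f y)"
proof -
  have "branch (f x) (f y) = {w \<in> f ` S. f x \<notin> seg (f y) w}"
    using homeomorphism_image1[OF f] by (simp add: branch_def)
  also have "\<dots> = f ` branch x y"
    using homeomorphism_mem_seg[OF f assms(3) _ assms(2)] by (auto simp: branch_def)
  finally show ?thesis by simp
qed

text \<open>Suppose that \<open>f\<close> has no fixed point and let every \<open>x\<close> point towards \<open>f x\<close>. If \<open>x\<close> and \<open>y\<close> point
  away from each other, then \<open>f\<close> stretches \<open>seg x y\<close> over itself, so \<open>f'\<close> maps this arc to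
  itself and has a fixed point there. Otherwise all points \<open>x\<close> point towards one \<open>z\<close>. But for \<open>x\<close> close
  to \<open>z\<close> and between \<open>z\<close> and \<open>f z\<close>, the image \<open>f x\<close> is close to \<open>f z\<close>, so \<open>x\<close> points away from \<open>z\<close>.\<close>

theorem homeomorphism_fixed_point:
  assumes f: "homeomorphism S S f f'" and ne: "S \<noteq> {}"
  obtains x where "x \<in> S" "f x = x"
proof -
  have fS: "f x \<in> S" "f' x \<in> S" "f (f' x) = x" "f' (f x) = x" if "x \<in> S" for x
    using that homeomorphism_image1[OF f] homeomorphism_image2[OF f]
      homeomorphism_apply1[OF f] homeomorphism_apply2[OF f] by blast+
  have "\<exists>x\<in>S. f x = x"
  proof (rule ccontr)
    assume "\<not> (\<exists>x\<in>S. f x = x)"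
    then have nofix: "\<And>x. x \<in> S \<Longrightarrow> f x \<noteq> x" by blast
    have meet: "insert x (branch x (f x)) \<inter> insert y (branch y (f y)) \<noteq> {}"
      if xy: "x \<in> S" "y \<in> S" "x \<noteq> y" for x y
    proof
      assume "insert x (branch x (f x)) \<inter> insert y (branch y (f y)) = {}"
      then have "y \<notin> branch x (f x)" "x \<notin> branch y (f y)" by auto
      then have 1: "x \<in> seg (f x) y" "y \<in> seg (f y) x" using xy by (auto simp: branch_def)
      have "x \<in> seg (f x) (f y)"
        using seg_triangle[of "f x" "f y" y] seg_antisym[of "f y" y x] 1 xy fS by blast
      moreover have "y \<in> seg (f x) (f y)"
        using seg_triangle[of "f y" "f x" x] seg_antisym[of "f x" x y] 1 xy fS
        by (auto simp: seg_commute[of "f y" "f x"])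
      ultimately have "seg x y \<subseteq> f ` seg x y"
        using seg_convex_seg[of "f x" "f y"] xy fS homeomorphism_seg[OF f xy(1,2)]
        unfolding seg_convex_def by auto
      then have "f' ` seg x y \<subseteq> seg x y"
        using seg_subset[OF xy(1,2)] fS(4) by force
      moreover have "continuous_on (seg x y) f'"
        using f seg_subset[OF xy(1,2)] unfolding homeomorphism_def by (metis continuous_on_subset)
      moreover obtain g where "arc g" "path_image g = seg x y" using seg_arc[OF xy] by metis
      then have "seg x y homeomorphic {0..1::real}"
        using homeomorphic_arc_image_interval[of g 0 1] by simp
      moreover have "\<forall>h. continuous_on {0..1::real} h \<and> h \<in> {0..1} \<rightarrow> {0..1} \<longrightarrow> (\<exists>t\<in>{0..1}. h t = t)"
        using brouwer[of "{0..1::real}"] by (metis atLeastAtMost_iff compact_Icc convex_real_interval(5) empty_iff le_numeral_extra(3) zero_le_one)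
      ultimately obtain u where "u \<in> seg x y" "f' u = u"
        using homeomorphic_fixpoint_property[of "seg x y" "{0..1::real}"] by blast
      then show False using fS(3)[of u] nofix[of u] seg_subset[OF xy(1,2)] by (metis subsetD)
    qed
    obtain z where z: "z \<in> S" "\<And>x. x \<in> S \<Longrightarrow> x \<noteq> z \<Longrightarrow> z \<in> branch x (f x)"
      using compatible_directions_meet[of f] meet nofix fS(1) ne by metis
    have fz: "f z \<in> S" "z \<noteq> f z" using fS nofix z by (metis, metis)
    have "f z \<in> branch z (f z)" using branch_self fz by blast
    then obtain e where e: "0 < e" "cball (f z) e \<inter> S \<subseteq> branch z (f z)"
      using openin_branch[OF z(1) fz(1)] by (meson openin_contains_cball)
    have "compact (cball (f z) e \<inter> S)" using compact_S by (simp add: closed_Int_compact)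
    then obtain w where w: "w \<in> branch z (f z)" "\<And>q. q \<in> cball (f z) e \<inter> S \<Longrightarrow> w \<in> seg z q"
      using separating_point[OF z(1) fz] e(2) by metis
    have wS: "w \<in> S" "z \<noteq> w" using w(1) branch_subset centre_notin_branch by (blast, blast)
    have "continuous_on S f" using f by (simp add: homeomorphism_def)
    then obtain d where d: "0 < d" "\<And>x. x \<in> S \<Longrightarrow> dist x z < d \<Longrightarrow> dist (f x) (f z) < e"
      unfolding continuous_on_iff using z(1) e(1) by blast
    obtain x where x: "x \<in> seg z w" "x \<noteq> z" "dist x z < d"
      using seg_accumulates_at_end[OF z(1) wS d(1)] by blast
    have xS: "x \<in> S" using x(1) seg_subset z(1) wS by blast
    have "f x \<in> cball (f z) e \<inter> S" using d(2)[OF xS x(3)] fS(1)[OF xS] by (simp add: dist_commute)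
    then have "x \<in> seg z (f x)" using w(2) seg_mono[OF z(1)] x(1) by blast
    then show False using z(2)[OF xS x(2)] by (simp add: branch_def seg_commute)
  qed
  then show ?thesis using that by blast
qed

section \<open>Commuting groups of homeomorphisms\<close>

lemma homeomorphism_image_seg_convex:
  assumes f: "homeomorphism S S f f'" and C: "seg_convex C" "closed C"
  shows "seg_convex (f ` C)" "closed (f ` C)"
proof -
  have CS: "C \<subseteq> S" using C by (simp add: seg_convex_def)
  have "seg (f x) (f y) \<subseteq> f ` C" if "x \<in> C" "y \<in> C" for x y
  proof -
    have "seg x y \<subseteq> C" using C that by (auto simp: seg_convex_def)
    then show ?thesis using homeomorphism_seg[OF f, of x y] CS that by blast
  qed
  moreover have "f ` C \<subseteq> S" using CS homeomorphism_image1[OF f] by blast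
  ultimately show "seg_convex (f ` C)" by (auto simp: seg_convex_def)
  have "compact C" using C(2) CS by (rule compact_if_closed_subset)
  moreover have "continuous_on C f" using homeomorphism_cont1[OF f] CS by (rule continuous_on_subset)
  ultimately show "closed (f ` C)" by (intro compact_imp_closed compact_continuous_image)
qed

text \<open>The gate \<open>p\<close> of \<open>C\<close> towards a point of \<open>D\<close> lies on all segments between \<open>C\<close> and \<open>D\<close>; it is
  determined by the two sets, hence fixed.\<close>

lemma disjoint_invariant_sets_fixed_point:
  assumes hom: "\<And>f. f \<in> A \<Longrightarrow> \<exists>f'\<in>A. homeomorphism S S f f'"
    and C: "closed C" "seg_convex C" "C \<noteq> {}" "\<And>f. f \<in> A \<Longrightarrow> f ` C \<subseteq> C"
    and D: "closed D" "seg_convex D" "D \<noteq> {}" "\<And>f. f \<in> A \<Longrightarrow> f ` D \<subseteq> D"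
    and disj: "C \<inter> D = {}"
  obtains p where "p \<in> S" "\<And>f. f \<in> A \<Longrightarrow> f p = p"
proof -
  obtain b where b: "b \<in> D" using D by blast
  have CS: "C \<subseteq> S" and DS: "D \<subseteq> S" using C D by (auto simp: seg_convex_def)
  obtain p where p: "p \<in> C" "\<And>a. a \<in> C \<Longrightarrow> p \<in> seg a b"
    using gate_exists[OF C(2,1,3), of b] b DS by blast
  have pd: "p \<in> seg a d" if "a \<in> C" "d \<in> D" for a d
  proof -
    have "seg d b \<subseteq> D" using D that b by (auto simp: seg_convex_def)
    then have "p \<notin> seg d b" using p disj by blast
    moreover have "seg a b \<subseteq> seg a d \<union> seg d b"
      using that b CS DS by (intro seg_triangle) auto
    ultimately show ?thesis using p(2)[OF that(1)] by blast
  qed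
  show ?thesis
  proof (rule that)
    show "p \<in> S" using p CS by blast
    fix f assume f: "f \<in> A"
    then obtain f' where f': "f' \<in> A" "homeomorphism S S f f'" using hom by blast
    have "f p \<in> seg a b" if a: "a \<in> C" for a
    proof -
      have "f' a \<in> C" "f' b \<in> D" using C(4)[OF f'(1)] D(4)[OF f'(1)] a b by auto
      then have "p \<in> seg (f' a) (f' b)" by (rule pd)
      then have "f p \<in> seg (f (f' a)) (f (f' b))"
        using homeomorphism_mem_seg[OF f'(2), of "f' a" "f' b" p] \<open>f' a \<in> C\<close> \<open>f' b \<in> D\<close> CS DS p
        by auto
      moreover have "f (f' a) = a" "f (f' b) = b"
        using homeomorphism_apply2[OF f'(2)] a b CS DS by auto
      ultimately show ?thesis by simp
    qed
    moreover have "f p \<in> C" using C(4)[OF f] p by blast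
    ultimately show "f p = p" using gate_unique[OF CS, of b "f p" p] p b DS by blast
  qed
qed

text \<open>When \<open>A\<close> has no fixed point, \<open>B\<close> fixes every
  end \<open>e\<close> of the least nonempty closed convex \<open>A\<close>-invariant set \<open>M\<close>: the hull of the fixed points
  in \<open>M\<close> of an element of \<open>B\<close> is \<open>A\<close>-invariant, so if \<open>e\<close> were not among them, then a point
  separating \<open>e\<close> from all of them would bound a smaller invariant set.\<close>

theorem commuting_groups_fixed_point:
  assumes ne: "S \<noteq> {}"
    and A: "\<And>f. f \<in> A \<Longrightarrow> \<exists>f'\<in>A. homeomorphism S S f f'"
    and B: "\<And>h. h \<in> B \<Longrightarrow> \<exists>h'\<in>B. homeomorphism S S h h'"
    and comm: "\<And>f h x. f \<in> A \<Longrightarrow> h \<in> B \<Longrightarrow> x \<in> S \<Longrightarrow> f (h x) = h (f x)"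
  shows "(\<exists>x\<in>S. \<forall>f\<in>A. f x = x) \<or> (\<exists>x\<in>S. \<forall>h\<in>B. h x = x)"
proof (cases "\<exists>x\<in>S. \<forall>f\<in>A. f x = x")
  case nofix: False
  define \<F> where "\<F> = {C. closed C \<and> seg_convex C \<and> C \<noteq> {} \<and> (\<forall>f\<in>A. f ` C \<subseteq> C)}"
  define M where "M = \<Inter>\<F>"
  have AS: "f x \<in> S" if "f \<in> A" "x \<in> S" for f x
    using A[OF that(1)] that(2) homeomorphism_image1 by blast
  have "seg_convex S" using seg_subset by (auto simp: seg_convex_def)
  then have S\<F>: "S \<in> \<F>" using ne compact_S compact_imp_closed AS by (auto simp: \<F>_def)
  have "\<Inter>\<F> \<noteq> {}"
  proof (rule Helly)
    fix C D assume CD: "C \<in> \<F>" "D \<in> \<F>"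
    show "C \<inter> D \<noteq> {}"
    proof
      assume *: "C \<inter> D = {}"
      obtain p where "p \<in> S" "\<And>f. f \<in> A \<Longrightarrow> f p = p"
        by (rule disjoint_invariant_sets_fixed_point[OF A _ _ _ _ _ _ _ _ *]) (use CD in \<open>auto simp: \<F>_def\<close>)
      then show False using nofix by blast
    qed
  qed (use S\<F> in \<open>auto simp: \<F>_def\<close>)
  then have Mne: "M \<noteq> {}" by (simp add: M_def)
  have MS: "M \<subseteq> S" using S\<F> by (auto simp: M_def)
  have Mcl: "closed M" unfolding M_def by (rule closed_Inter) (auto simp: \<F>_def)
  have Mcv: "seg_convex M"
    unfolding M_def using S\<F> by (intro seg_convex_Inter) (auto simp: \<F>_def)
  have Minv: "f ` M \<subseteq> M" if "f \<in> A" for f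
    using that unfolding M_def \<F>_def by blast
  have Mc: "compact M" using Mcl MS by (rule compact_if_closed_subset)
  have least: "M \<subseteq> C" if "C \<in> \<F>" for C using that by (auto simp: M_def)
  have Msub: "M \<subseteq> h ` M" if h: "h \<in> B" for h
  proof -
    obtain h' where h': "homeomorphism S S h h'" using B[OF h] by blast
    have "f ` (h ` M) \<subseteq> h ` M" if f: "f \<in> A" for f
    proof -
      have "f ` (h ` M) = h ` (f ` M)"
        unfolding image_image using comm[OF f h] MS by (intro image_cong) auto
      then show ?thesis using Minv[OF f] by auto
    qed
    then have "h ` M \<in> \<F>"
      using homeomorphism_image_seg_convex[OF h' Mcv Mcl] Mne by (simp add: \<F>_def)
    then show ?thesis by (rule least)
  qed
  obtain e where e: "is_end M e" using end_exists[OF Mc MS Mne] .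
  then have eM: "e \<in> M" by (simp add: is_end_def)
  have eS: "e \<in> S" using eM MS by blast
  have "h e = e" if h: "h \<in> B" for h
  proof (rule ccontr)
    assume he: "h e \<noteq> e"
    obtain h' where h': "h' \<in> B" "homeomorphism S S h h'" using B[OF h] by blast
    have hM: "h x \<in> M" "h' x \<in> M" if "x \<in> M" for x
    proof -
      obtain y where y: "y \<in> M" "x = h y" using Msub[OF h] \<open>x \<in> M\<close> by blast
      obtain z where z: "z \<in> M" "x = h' z" using Msub[OF h'(1)] \<open>x \<in> M\<close> by blast
      have "h x = z" unfolding z(2) using homeomorphism_apply2[OF h'(2)] z(1) MS by blast
      moreover have "h' x = y" unfolding y(2) using homeomorphism_apply1[OF h'(2)] y(1) MS by blast
      ultimately show "h x \<in> M" "h' x \<in> M" using y(1) z(1) by simp_all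
    qed
    define F where "F = {x \<in> M. h x = x}"
    \<comment> \<open>a fixed point of \<open>h\<close> in \<open>S\<close> has a gate in \<open>M\<close>, which \<open>h\<close> fixes too\<close>
    have "F \<noteq> {}"
    proof -
      obtain x where x: "x \<in> S" "h x = x" using homeomorphism_fixed_point[OF h'(2) ne] .
      obtain p where p: "p \<in> M" "\<And>a. a \<in> M \<Longrightarrow> p \<in> seg a x"
        using gate_exists[OF Mcv Mcl Mne x(1)] by blast
      have "h p \<in> seg a x" if a: "a \<in> M" for a
      proof -
        have "h p \<in> seg (h (h' a)) (h x)"
          using homeomorphism_mem_seg[OF h'(2), of "h' a" x p] p hM(2)[OF a] x MS by auto
        then show ?thesis using homeomorphism_apply2[OF h'(2)] a MS x by auto
      qed
      then have "h p = p" using gate_unique[OF MS x(1), of "h p" p] p hM by blast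
      then show ?thesis using p by (auto simp: F_def)
    qed
    then obtain q0 where q0: "q0 \<in> F" by blast
    have FM: "F \<subseteq> M" by (auto simp: F_def)
    have "continuous_on M (\<lambda>x. dist (h x) x)"
      using homeomorphism_cont1[OF h'(2)] MS by (intro continuous_intros) (rule continuous_on_subset)
    then have "closed {x \<in> M. dist (h x) x = 0}"
      using Mcl by (rule continuous_closed_preimage_constant)
    then have "closed F" by (simp add: F_def)
    then have Fc: "compact F" using FM MS by (intro compact_if_closed_subset) auto
    have eF: "e \<notin> F" using he by (simp add: F_def)
    have "F \<subseteq> branch e q0"
    proof
      fix q assume q: "q \<in> F"
      then have "e \<notin> seg q0 q" using e q0 FM eF unfolding is_end_def by blast
      then show "q \<in> branch e q0" using q FM MS by (auto simp: branch_def)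
    qed
    moreover have "q0 \<in> S" "e \<noteq> q0" using q0 FM MS eF by auto
    ultimately obtain x where x: "x \<in> branch e q0" "\<And>q. q \<in> F \<Longrightarrow> x \<in> seg e q"
      using separating_point[OF eS _ _ Fc] by blast
    have xS: "x \<in> S" "x \<noteq> e" using x(1) branch_subset centre_notin_branch by (blast, blast)
    \<comment> \<open>the closed convex hull of \<open>F\<close> is the intersection of \<open>\<K>\<close>\<close>
    define \<K> where "\<K> = {C. closed C \<and> seg_convex C \<and> F \<subseteq> C}"
    have beyond: "{z \<in> S. x \<in> seg e z} \<in> \<K>"
      using closed_beyond[OF xS(1) eS] seg_convex_beyond[OF xS(1) eS] x(2) FM MS by (auto simp: \<K>_def)
    then have K1: "\<Inter>\<K> \<subseteq> {z \<in> S. x \<in> seg e z}" by blast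
    have "\<Inter>\<K> \<in> \<F>"
    proof -
      have "closed (\<Inter>\<K>)" by (rule closed_Inter) (auto simp: \<K>_def)
      moreover have "seg_convex (\<Inter>\<K>)"
        using beyond by (intro seg_convex_Inter) (auto simp: \<K>_def)
      moreover have "F \<subseteq> \<Inter>\<K>" by (auto simp: \<K>_def)
      then have "\<Inter>\<K> \<noteq> {}" using q0 by blast
      moreover have "f ` \<Inter>\<K> \<subseteq> \<Inter>\<K>" if f: "f \<in> A" for f
      proof (rule Inter_greatest)
        fix C assume C: "C \<in> \<K>"
        obtain f' where f': "f' \<in> A" "homeomorphism S S f f'" using A[OF f] by blast
        have CS: "C \<subseteq> S" using C by (simp add: \<K>_def seg_convex_def)
        have "F \<subseteq> f' ` C"
        proof
          fix q assume q: "q \<in> F"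
          then have qM: "q \<in> M" "h q = q" "q \<in> S" using MS by (auto simp: F_def)
          have "f q \<in> F" using comm[OF f h qM(3)] qM Minv[OF f] by (auto simp: F_def)
          then have "f q \<in> C" using C by (auto simp: \<K>_def)
          then show "q \<in> f' ` C"
            using homeomorphism_apply1[OF f'(2) qM(3)] by (metis imageI)
        qed
        then have "f' ` C \<in> \<K>"
          using C homeomorphism_image_seg_convex[OF homeomorphism_symD[OF f'(2)]] by (simp add: \<K>_def)
        then have "f ` \<Inter>\<K> \<subseteq> f ` (f' ` C)" by blast
        also have "\<dots> = (\<lambda>u. u) ` C"
          unfolding image_image using CS homeomorphism_apply2[OF f'(2)] by (intro image_cong) auto
        finally show "f ` \<Inter>\<K> \<subseteq> C" by simp
      qed
      ultimately show ?thesis by (simp add: \<F>_def)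
    qed
    then have "e \<in> {z \<in> S. x \<in> seg e z}" using least eM K1 by blast
    then show False using xS by (simp add: seg_refl eS)
  qed
  then show ?thesis using eS by blast
qed simp

section \<open>Medians of a mean\<close>

text \<open>By positivity \<open>m f\<close> depends only on the restriction of \<open>f\<close> to \<open>S\<close>, so \<open>m\<close> is a state on the algebra
  of continuous functions on \<open>S\<close>. That an open set \<open>U\<close> has mass more
  than one half is witnessed by a single function supported in \<open>U\<close>.\<close>

definition mean :: "(('b \<Rightarrow> real) \<Rightarrow> real) \<Rightarrow> bool" where
  "mean m \<longleftrightarrow>
     (\<forall>f g. continuous_on S f \<longrightarrow> continuous_on S g \<longrightarrow> m (\<lambda>x. f x + g x) = m f + m g) \<and>
     (\<forall>c f. continuous_on S f \<longrightarrow> m (\<lambda>x. c * f x) = c * m f) \<and>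
     (\<forall>f. continuous_on S f \<longrightarrow> (\<forall>x\<in>S. 0 \<le> f x) \<longrightarrow> 0 \<le> m f) \<and>
     m (\<lambda>x. 1) = 1"

definition heavy :: "(('b \<Rightarrow> real) \<Rightarrow> real) \<Rightarrow> 'b set \<Rightarrow> bool" where
  "heavy m U \<longleftrightarrow> (\<exists>f. continuous_on S f \<and> (\<forall>x\<in>S. 0 \<le> f x \<and> f x \<le> 1) \<and>
     (\<forall>x\<in>S - U. f x = 0) \<and> 1/2 < m f)"

definition medians :: "(('b \<Rightarrow> real) \<Rightarrow> real) \<Rightarrow> 'b set" where
  "medians m = {x \<in> S. \<forall>y\<in>S - {x}. \<not> heavy m (branch x y)}"

lemma
  assumes "mean m" "continuous_on S f"
  shows mean_add: "continuous_on S g \<Longrightarrow> m (\<lambda>x. f x + g x) = m f + m g"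
    and mean_mult: "m (\<lambda>x. c * f x) = c * m f"
    and mean_nonneg: "(\<And>x. x \<in> S \<Longrightarrow> 0 \<le> f x) \<Longrightarrow> 0 \<le> m f"
  using assms by (simp_all add: mean_def)

lemma mean_diff:
  assumes "mean m" "continuous_on S f" "continuous_on S g"
  shows "m (\<lambda>x. f x - g x) = m f - m g"
proof -
  have "continuous_on S (\<lambda>x. f x - g x)" using assms by (intro continuous_intros)
  then have "m (\<lambda>x. (f x - g x) + g x) = m (\<lambda>x. f x - g x) + m g"
    using assms unfolding mean_def by blast
  then show ?thesis by simp
qed

lemma mean_const: "mean m \<Longrightarrow> m (\<lambda>x. c) = c"
proof -
  assume m: "mean m"
  then have "m (\<lambda>x. c * 1) = c * m (\<lambda>x. 1)"
    unfolding mean_def using continuous_on_const by blast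
  then show ?thesis using m by (simp add: mean_def)
qed

lemma mean_mono:
  assumes m: "mean m" and "continuous_on S f" "continuous_on S g" "\<And>x. x \<in> S \<Longrightarrow> f x \<le> g x"
  shows "m f \<le> m g"
proof -
  have "continuous_on S (\<lambda>x. g x - f x)" using assms by (intro continuous_intros)
  moreover have "\<forall>x\<in>S. 0 \<le> g x - f x" using assms(4) by auto
  ultimately have "0 \<le> m (\<lambda>x. g x - f x)" using m unfolding mean_def by blast
  then show ?thesis using mean_diff[OF m assms(3,2)] by simp
qed

lemma heavy_sets_meet:
  assumes m: "mean m" and U: "heavy m U" and V: "heavy m V"
  shows "U \<inter> V \<noteq> {}"
proof
  assume disj: "U \<inter> V = {}"
  obtain f where f: "continuous_on S f" "\<forall>x\<in>S. 0 \<le> f x \<and> f x \<le> 1" "\<forall>x\<in>S - U. f x = 0" "1/2 < m f"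
    using U unfolding heavy_def by blast
  obtain g where g: "continuous_on S g" "\<forall>x\<in>S. 0 \<le> g x \<and> g x \<le> 1" "\<forall>x\<in>S - V. g x = 0" "1/2 < m g"
    using V unfolding heavy_def by blast
  have "f x + g x \<le> 1" if "x \<in> S" for x
  proof (cases "x \<in> U")
    case True
    then have "g x = 0" using g(3) that disj by blast
    then show ?thesis using f(2) that by simp
  next
    case False
    then have "f x = 0" using f(3) that by blast
    then show ?thesis using g(2) that by simp
  qed
  then have "m (\<lambda>x. f x + g x) \<le> m (\<lambda>x. 1)"
    using f(1) g(1) by (intro mean_mono[OF m] continuous_intros) auto
  moreover have "m (\<lambda>x. f x + g x) = m f + m g"
    using m f(1) g(1) unfolding mean_def by blast
  ultimately show False using f(4) g(4) mean_const[OF m, of 1] by simp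
qed

text \<open>Inner regularity: the part of the witness above a small level \<open>c\<close> still has mean more than one half,
  and it vanishes off the compact set where the witness is at least \<open>c\<close>.\<close>

lemma heavy_compact_core:
  assumes m: "mean m" and U: "heavy m U"
  obtains Q where "compact Q" "Q \<subseteq> S" "Q \<subseteq> U" "\<And>V. Q \<subseteq> V \<Longrightarrow> heavy m V"
proof -
  obtain f where f: "continuous_on S f" "\<forall>x\<in>S. 0 \<le> f x \<and> f x \<le> 1" "\<forall>x\<in>S - U. f x = 0" "1/2 < m f"
    using U unfolding heavy_def by blast
  define c where "c = (m f - 1/2) / 2"
  have c: "0 < c" "1/2 < m f - c" using f(4) by (auto simp: c_def field_simps)
  define g where "g x = max 0 (f x - c)" for x
  define Q where "Q = {x \<in> S. c \<le> f x}"
  have g: "continuous_on S g" unfolding g_def using f(1) by (intro continuous_intros)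
  have "m (\<lambda>x. f x - c) \<le> m g"
    by (rule mean_mono[OF m _ g]) (use f(1) in \<open>auto simp: g_def intro!: continuous_intros\<close>)
  then have mg: "1/2 < m g"
    using mean_diff[OF m f(1) continuous_on_const, of c] mean_const[OF m, of c] c by simp
  show ?thesis
  proof (rule that)
    have "closedin (top_of_set S) (S \<inter> f -` {c..})"
      using f(1) by (intro continuous_closedin_preimage) auto
    moreover have "S \<inter> f -` {c..} = Q" by (auto simp: Q_def)
    ultimately show "compact Q" using closedin_compact[OF compact_S] by auto
    show "Q \<subseteq> S" by (auto simp: Q_def)
    show "Q \<subseteq> U"
    proof
      fix x assume "x \<in> Q"
      then show "x \<in> U" using f(3) c(1) by (cases "x \<in> U") (auto simp: Q_def)
    qed
    fix V assume V: "Q \<subseteq> V"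
    have "g x = 0" if "x \<in> S - V" for x using that V by (auto simp: g_def Q_def)
    moreover have "0 \<le> g x \<and> g x \<le> 1" if "x \<in> S" for x
      using that f(2) c(1) by (fastforce simp: g_def)
    ultimately show "heavy m V" unfolding heavy_def using g mg by blast
  qed
qed

text \<open>If every point has a heavy branch, these branches pairwise meet, and all point towards some \<open>z\<close>. A
  compact core \<open>Q\<close> of the heavy branch at \<open>z\<close> is separated from \<open>z\<close> by a point \<open>x\<close>, whose heavy branch
  contains \<open>z\<close> and therefore misses \<open>Q\<close>. Disjoint sets cannot both be heavy.\<close>

lemma medians_nonempty:
  assumes m: "mean m" and ne: "S \<noteq> {}"
  shows "medians m \<noteq> {}"
proof
  assume "medians m = {}"
  then have "\<forall>x\<in>S. \<exists>y. y \<in> S \<and> y \<noteq> x \<and> heavy m (branch x y)" by (fastforce simp: medians_def)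
  then obtain d where d: "\<And>x. x \<in> S \<Longrightarrow> d x \<in> S \<and> d x \<noteq> x \<and> heavy m (branch x (d x))" by metis
  have "insert x (branch x (d x)) \<inter> insert y (branch y (d y)) \<noteq> {}" if "x \<in> S" "y \<in> S" for x y
    using heavy_sets_meet[OF m, of "branch x (d x)" "branch y (d y)"] d that by blast
  then obtain z where z: "z \<in> S" "\<And>x. x \<in> S \<Longrightarrow> x \<noteq> z \<Longrightarrow> z \<in> branch x (d x)"
    using compatible_directions_meet[OF ne, of d] d by metis
  obtain Q where Q: "compact Q" "Q \<subseteq> branch z (d z)" "heavy m Q"
    using heavy_compact_core[OF m, of "branch z (d z)"] d[OF z(1)] by (metis order_refl)
  obtain x where x: "x \<in> branch z (d z)" "\<And>q. q \<in> Q \<Longrightarrow> x \<in> seg z q"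
    using separating_point[OF z(1) _ _ Q(1,2)] d[OF z(1)] by metis
  have xS: "x \<in> S" "x \<noteq> z" using x(1) branch_subset centre_notin_branch by (blast, blast)
  have "branch x z = branch x (d x)" using branch_eq[of "d x" z x] z(2)[OF xS] d[OF xS(1)] by blast
  moreover have "Q \<inter> branch x z = {}" using x(2) by (auto simp: branch_def)
  ultimately show False using heavy_sets_meet[OF m Q(3), of "branch x z"] d[OF xS(1)] by simp
qed

text \<open>If a branch at \<open>z\<close> is heavy, let \<open>x\<close> separate \<open>z\<close> from a compact core \<open>Q\<close> of it. Every point \<open>w\<close> on the
  same side of \<open>x\<close> as \<open>z\<close> has all of \<open>Q\<close> in its branch towards \<open>x\<close>, so \<open>w\<close> is not a median either.\<close>

lemma compact_medians:
  assumes m: "mean m"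
  shows "compact (medians m)"
proof -
  have MS: "medians m \<subseteq> S" by (auto simp: medians_def)
  have "openin (top_of_set S) (S - medians m)"
  proof (subst openin_subopen, intro ballI)
    fix z assume "z \<in> S - medians m"
    then obtain y where zy: "z \<in> S" "y \<in> S" "z \<noteq> y" "heavy m (branch z y)"
      by (auto simp: medians_def)
    obtain Q where Q: "compact Q" "Q \<subseteq> S" "Q \<subseteq> branch z y" "\<And>V. Q \<subseteq> V \<Longrightarrow> heavy m V"
      by (rule heavy_compact_core[OF m zy(4)]) (rule that)
    obtain x where x: "x \<in> branch z y" "\<And>q. q \<in> Q \<Longrightarrow> x \<in> seg z q"
      using separating_point[OF zy(1-3) Q(1,3)] by metis
    have xS: "x \<in> S" "x \<noteq> z" using x(1) branch_subset centre_notin_branch by (blast, blast)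
    have "w \<notin> medians m" if w: "w \<in> branch x z" for w
    proof -
      have wS: "w \<in> S" "x \<notin> seg z w" "x \<noteq> w"
        using w centre_notin_branch by (auto simp: branch_def)
      have "Q \<subseteq> branch w x"
      proof
        fix q assume q: "q \<in> Q"
        then have qS: "q \<in> S" using Q(2) by blast
        have xwq: "x \<in> seg q w"
          using seg_triangle[OF zy(1) wS(1) qS] x(2)[OF q] wS(2) seg_commute[of w q] by blast
        have "w \<notin> seg q x"
          using seg_antisym[OF qS xS(1) _ xwq] wS(3) by blast
        then show "q \<in> branch w x" using qS by (simp add: branch_def seg_commute)
      qed
      then have "heavy m (branch w x)" by (rule Q(4))
      then show ?thesis using xS(1) wS(3) by (auto simp: medians_def)
    qed
    then have "branch x z \<subseteq> S - medians m" using branch_subset[of x z] by blast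
    then show "\<exists>T. openin (top_of_set S) T \<and> z \<in> T \<and> T \<subseteq> S - medians m"
      using openin_branch[OF xS(1) zy(1)] branch_self[OF zy(1) xS(2)] by blast
  qed
  then have "closedin (top_of_set S) (medians m)" using MS by (simp add: closedin_def)
  then show ?thesis using closedin_compact[OF compact_S] by blast
qed

text \<open>If none of the medians \<open>x\<close>, \<open>y\<close>, \<open>z\<close> is between the other two, the complements \<open>Dx\<close>, \<open>Dy\<close>, \<open>Dz\<close>
  of the branches containing the respective other two points are disjoint closed sets, and each has
  mass at least one half, which exceeds the total mass.\<close>

lemma medians_collinear:
  assumes m: "mean m" and x: "x \<in> medians m" and y: "y \<in> medians m" and z: "z \<in> medians m"
    and distinct: "x \<noteq> y" "y \<noteq> z" "x \<noteq> z"
  shows "x \<in> seg y z \<or> y \<in> seg x z \<or> z \<in> seg x y"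
proof (rule ccontr)
  assume "\<not> ?thesis"
  then have tri: "x \<notin> seg y z" "y \<notin> seg x z" "z \<notin> seg x y" by auto
  have S: "x \<in> S" "y \<in> S" "z \<in> S" using x y z by (auto simp: medians_def)
  define Dx Dy Dz where "Dx = {w \<in> S. x \<in> seg y w}" and "Dy = {w \<in> S. y \<in> seg x w}"
    and "Dz = {w \<in> S. z \<in> seg x w}"
  have eq: "Dx = {w \<in> S. x \<in> seg z w}" "Dy = {w \<in> S. y \<in> seg z w}"
    "Dx = S - branch x y" "Dy = S - branch y x" "Dz = S - branch z x" "Dz = {w \<in> S. z \<in> seg y w}"
    using branch_eq[OF S(2), of z x] branch_eq[OF S(1), of z y] branch_eq[OF S(1), of y z] tri S
    unfolding Dx_def Dy_def Dz_def branch_def by blast+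
  have cl: "closed Dx" "closed Dy" "closed Dz"
    unfolding Dx_def Dy_def Dz_def using S by (auto intro!: closed_beyond)
  have mem: "x \<in> Dx" "y \<in> Dy" "z \<in> Dz" using S by (auto simp: Dx_def Dy_def Dz_def)
  have no2: "a = b" if "a \<in> S" "b \<in> S" "w \<in> S" "a \<in> seg b w" "b \<in> seg a w" for a b w
    using seg_antisym[of w b a] that seg_commute by metis
  have disj: "Dx \<inter> Dy = {}" "Dx \<inter> Dz = {}" "Dy \<inter> Dz = {}"
  proof -
    show "Dx \<inter> Dy = {}" using no2[OF S(1,2)] distinct unfolding Dx_def Dy_def by blast
    show "Dx \<inter> Dz = {}" using no2[OF S(1,3)] distinct unfolding eq(1) Dz_def by blast
    show "Dy \<inter> Dz = {}" using no2[OF S(2,3)] distinct unfolding eq(2) eq(6) by blast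
  qed
  define a b c where "a w = infdist w Dx" and "b w = infdist w Dy" and "c w = infdist w Dz" for w
  have nn: "0 \<le> a w" "0 \<le> b w" "0 \<le> c w" for w by (auto simp: a_def b_def c_def infdist_nonneg)
  have zero: "a w = 0 \<longleftrightarrow> w \<in> Dx" "b w = 0 \<longleftrightarrow> w \<in> Dy" "c w = 0 \<longleftrightarrow> w \<in> Dz" for w
    unfolding a_def b_def c_def using in_closed_iff_infdist_zero cl mem by (metis empty_iff)+
  \<comment> \<open>the quotients by \<open>s\<close> of its three summands form a partition of unity; the summand \<open>b * c\<close> belongs to \<open>Dx\<close>, where \<open>a\<close> vanishes\<close>
  define s where "s w = b w * c w + a w * c w + a w * b w" for w
  have s: "s w > 0" for w
  proof -
    have "\<not> (a w = 0 \<and> b w = 0)" "\<not> (a w = 0 \<and> c w = 0)" "\<not> (b w = 0 \<and> c w = 0)"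
      using disj zero by auto
    then have "b w * c w > 0 \<or> a w * c w > 0 \<or> a w * b w > 0"
      using nn[of w] by (metis less_eq_real_def mult_pos_pos)
    then show ?thesis using nn[of w] unfolding s_def
      by (smt (verit) mult_nonneg_nonneg)
  qed
  have cont: "continuous_on S a" "continuous_on S b" "continuous_on S c"
    unfolding a_def b_def c_def by (intro continuous_intros)+
  have quot: "continuous_on S (\<lambda>w. u w / s w)" if "continuous_on S u" for u
  proof (rule continuous_on_divide[OF that])
    show "continuous_on S s" unfolding s_def by (intro continuous_intros cont)
    show "\<forall>w\<in>S. s w \<noteq> 0" using s by (metis less_irrefl)
  qed
  have half: "1/2 \<le> m (\<lambda>w. u w / s w)"
    if u: "continuous_on S u" "\<And>w. 0 \<le> u w" "\<And>w. u w \<le> s w"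
      "\<And>w. w \<in> D \<Longrightarrow> u w = s w" and D: "D = S - branch p q" "p \<in> medians m" "q \<in> S" "q \<noteq> p" for u D p q
  proof -
    have us: "continuous_on S (\<lambda>w. u w / s w)" using u(1) by (rule quot)
    have light: "\<not> heavy m (branch p q)" using D by (auto simp: medians_def)
    have "continuous_on S (\<lambda>w. 1 - u w / s w)" by (rule continuous_on_diff[OF continuous_on_const us])
    moreover have "0 \<le> 1 - u w / s w \<and> 1 - u w / s w \<le> 1" for w
      using u(2,3)[of w] s[of w] by (simp add: divide_simps)
    moreover have "1 - u w / s w = 0" if "w \<in> S - branch p q" for w
      using u(4)[of w] that D(1) s[of w] by simp
    ultimately have "heavy m (branch p q)" if "1/2 < m (\<lambda>w. 1 - u w / s w)"
      unfolding heavy_def using that by (intro exI[of _ "\<lambda>w. 1 - u w / s w"]) blast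
    then have "m (\<lambda>w. 1 - u w / s w) \<le> 1/2" using light by (meson not_le)
    then show ?thesis
      using mean_diff[OF m continuous_on_const us, of 1] mean_const[OF m, of 1] by simp
  qed
  have bnd: "0 \<le> b w * c w" "0 \<le> a w * c w" "0 \<le> a w * b w" for w using nn[of w] by simp_all
  have van: "w \<in> Dx \<Longrightarrow> a w = 0" "w \<in> Dy \<Longrightarrow> b w = 0" "w \<in> Dz \<Longrightarrow> c w = 0" for w
    using zero by blast+
  have 1: "1/2 \<le> m (\<lambda>w. b w * c w / s w)"
    by (rule half[OF _ _ _ _ eq(3) x S(2)]) (use cont bnd van distinct in \<open>auto simp: s_def intro!: continuous_intros\<close>)
  have 2: "1/2 \<le> m (\<lambda>w. a w * c w / s w)"
    by (rule half[OF _ _ _ _ eq(4) y S(1)]) (use cont bnd van distinct in \<open>auto simp: s_def intro!: continuous_intros\<close>)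
  have 3: "1/2 \<le> m (\<lambda>w. a w * b w / s w)"
    by (rule half[OF _ _ _ _ eq(5) z S(1)]) (use cont bnd van distinct in \<open>auto simp: s_def intro!: continuous_intros\<close>)
  have cs: "continuous_on S (\<lambda>w. b w * c w / s w)" "continuous_on S (\<lambda>w. a w * c w / s w)"
    "continuous_on S (\<lambda>w. a w * b w / s w)"
    by (intro quot continuous_intros cont)+
  have "m (\<lambda>w. b w * c w / s w + a w * c w / s w + a w * b w / s w)
      = m (\<lambda>w. b w * c w / s w + a w * c w / s w) + m (\<lambda>w. a w * b w / s w)"
    using m cs continuous_on_add[OF cs(1,2)] unfolding mean_def by blast
  also have "m (\<lambda>w. b w * c w / s w + a w * c w / s w)
      = m (\<lambda>w. b w * c w / s w) + m (\<lambda>w. a w * c w / s w)"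
    using m cs unfolding mean_def by blast
  finally have sum: "m (\<lambda>w. b w * c w / s w + a w * c w / s w + a w * b w / s w)
      = m (\<lambda>w. b w * c w / s w) + m (\<lambda>w. a w * c w / s w) + m (\<lambda>w. a w * b w / s w)" by simp
  have "b w * c w / s w + a w * c w / s w + a w * b w / s w = 1" for w
  proof -
    have "b w * c w / s w + a w * c w / s w + a w * b w / s w = s w / s w"
      unfolding add_divide_distrib[symmetric] by (simp add: s_def)
    then show ?thesis using s[of w] by simp
  qed
  then have "(\<lambda>w. b w * c w / s w + a w * c w / s w + a w * b w / s w) = (\<lambda>w. 1)" by (intro ext)
  then show False using sum 1 2 3 mean_const[OF m, of 1] by simp
qed

text \<open>The set of medians is invariant and compact, so it has an end, and its ends are permuted. By
  \<open>medians_collinear\<close> there cannot be three ends, since one of them would separate the others.\<close>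

theorem invariant_mean_imp_invariant_pair:
  assumes m: "mean m" and ne: "S \<noteq> {}"
    and A: "\<And>f. f \<in> A \<Longrightarrow> \<exists>f'\<in>A. homeomorphism S S f f'"
    and inv: "\<And>f g. f \<in> A \<Longrightarrow> continuous_on S g \<Longrightarrow> m (\<lambda>x. g (f x)) = m g"
  shows "(\<exists>x\<in>S. \<forall>f\<in>A. f x = x) \<or> (\<exists>x\<in>S. \<exists>y\<in>S. x \<noteq> y \<and> (\<forall>f\<in>A. f ` {x, y} = {x, y}))"
proof -
  define M where "M = medians m"
  have MS: "M \<subseteq> S" by (auto simp: M_def medians_def)
  have heavy_image: "heavy m (f ` U)" if f: "f \<in> A" and U: "heavy m U" for f U
  proof -
    obtain f' where f': "f' \<in> A" "homeomorphism S S f f'" using A[OF f] by blast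
    obtain g where g: "continuous_on S g" "\<forall>x\<in>S. 0 \<le> g x \<and> g x \<le> 1" "\<forall>x\<in>S - U. g x = 0" "1/2 < m g"
      using U unfolding heavy_def by blast
    have im: "f' x \<in> S" if "x \<in> S" for x using homeomorphism_image2[OF f'(2)] that by blast
    have "continuous_on S (\<lambda>x. g (f' x))"
      using continuous_on_compose2[OF g(1) homeomorphism_cont2[OF f'(2)]] im by blast
    moreover have "m (\<lambda>x. g (f' x)) = m g" using inv[OF f'(1) g(1)] .
    moreover have "g (f' x) = 0" if x: "x \<in> S - f ` U" for x
    proof -
      have "f' x \<notin> U" using x homeomorphism_apply2[OF f'(2), of x] by (metis DiffD1 DiffD2 imageI)
      then show ?thesis using g(3) im x by blast
    qed
    moreover have "0 \<le> g (f' x) \<and> g (f' x) \<le> 1" if "x \<in> S" for x using g(2) im[OF that] by blast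
    ultimately show ?thesis using g(4) unfolding heavy_def by auto
  qed
  have M_inv: "f x \<in> M" if f: "f \<in> A" and x: "x \<in> M" for f x
  proof -
    obtain f' where f': "f' \<in> A" "homeomorphism S S f f'" using A[OF f] by blast
    have xS: "x \<in> S" "f x \<in> S" "f' (f x) = x"
      using x MS homeomorphism_image1[OF f'(2)] homeomorphism_apply1[OF f'(2)] by blast+
    have "\<not> heavy m (branch (f x) y)" if y: "y \<in> S - {f x}" for y
    proof
      assume "heavy m (branch (f x) y)"
      then have "heavy m (f' ` branch (f x) y)" by (rule heavy_image[OF f'(1)])
      then have "heavy m (branch x (f' y))"
        using homeomorphism_branch[OF homeomorphism_symD[OF f'(2)], of "f x" y] xS y by simp
      moreover have "f' y \<in> S - {x}"
      proof -
        have "f (f' y) = y" "f' y \<in> S"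
          using y homeomorphism_apply2[OF f'(2)] homeomorphism_image2[OF f'(2)] by blast+
        then show ?thesis using y by auto
      qed
      ultimately show False using x by (auto simp: M_def medians_def)
    qed
    then show ?thesis using xS by (simp add: M_def medians_def)
  qed
  obtain a where a: "is_end M a"
    using end_exists[of M] compact_medians[OF m] medians_nonempty[OF m ne] MS unfolding M_def by blast
  have end_inv: "is_end M (f e)" if f: "f \<in> A" and e: "is_end M e" for f e
    unfolding is_end_def
  proof (intro conjI ballI)
    have eM: "e \<in> M" using e by (simp add: is_end_def)
    then show "f e \<in> M" using M_inv[OF f] by blast
    fix x y assume xy: "x \<in> M - {f e}" "y \<in> M - {f e}"
    obtain f' where f': "f' \<in> A" "homeomorphism S S f f'" using A[OF f] by blast
    have ff: "f (f' x) = x" "f (f' y) = y"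
      using homeomorphism_apply2[OF f'(2)] xy MS by blast+
    then have "f' x \<in> M - {e}" "f' y \<in> M - {e}" using xy M_inv[OF f'(1)] by auto
    then have "e \<notin> seg (f' x) (f' y)" "f' x \<in> S" "f' y \<in> S" "e \<in> S"
      using e eM MS unfolding is_end_def by blast+
    then show "f e \<notin> seg x y" using homeomorphism_mem_seg[OF f'(2), of "f' x" "f' y" e] ff by simp
  qed
  have two: "e = a \<or> e = b \<or> a = b" if e: "is_end M e" and b: "is_end M b" for e b
  proof (rule ccontr)
    assume "\<not> ?thesis"
    then have d: "e \<noteq> a" "a \<noteq> b" "e \<noteq> b" by auto
    have "e \<in> M" "a \<in> M" "b \<in> M" using e a b by (auto simp: is_end_def)
    then have "e \<in> seg a b \<or> a \<in> seg e b \<or> b \<in> seg e a"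
      using medians_collinear[OF m, of e a b] d by (simp add: M_def)
    then show False using e a b d \<open>e \<in> M\<close> \<open>a \<in> M\<close> \<open>b \<in> M\<close> unfolding is_end_def by blast
  qed
  have aS: "a \<in> S" using a MS by (auto simp: is_end_def)
  show ?thesis
  proof (cases "\<exists>b. is_end M b \<and> b \<noteq> a")
    case False
    then have "f a = a" if "f \<in> A" for f using end_inv[OF that a] by blast
    then show ?thesis using aS by blast
  next
    case True
    then obtain b where b: "is_end M b" "b \<noteq> a" by blast
    have bS: "b \<in> S" using b(1) MS by (auto simp: is_end_def)
    have sub: "f ` {a, b} \<subseteq> {a, b}" if "f \<in> A" for f
      using two[OF end_inv[OF that a] b(1)] two[OF end_inv[OF that b(1)] b(1)] b(2) by auto
    have "f ` {a, b} = {a, b}" if f: "f \<in> A" for f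
    proof (rule card_subset_eq)
      obtain f' where "homeomorphism S S f f'" using A[OF f] by blast
      then have "f a \<noteq> f b" using homeomorphism_apply1 aS bS b(2) by metis
      then show "card (f ` {a, b}) = card {a, b}" using b(2) by simp
    qed (use sub[OF f] in auto)
    then show ?thesis using aS bS b(2) by blast
  qed
qed

end

section \<open>The compact convex set of means\<close>

lemma continuous_map_into_real_functions:
  fixes f :: "'a \<Rightarrow> 'i \<Rightarrow> real"
  shows "continuous_map X euclidean f \<longleftrightarrow> (\<forall>i. continuous_map X euclideanreal (\<lambda>x. f x i))"
  using continuous_map_componentwise_UNIV[of X "\<lambda>i. euclidean" f]
  by (simp add: euclidean_product_topology)

text \<open>The standard topology on a space of real functions is that of pointwise convergence.\<close>

lemma locally_convex_tvs_real_functions: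
  "locally_convex_tvs (UNIV :: ('i \<Rightarrow> real) set) euclidean"
  unfolding locally_convex_tvs_def
proof (intro conjI)
  have "continuous_map (prod_topology euclidean euclidean) euclideanreal (\<lambda>z. fst z i + snd z i)"
    for i :: 'i
    by (intro continuous_map_add continuous_map_into_real_functions[THEN iffD1, rule_format]
        continuous_map_fst continuous_map_snd)
  then show "continuous_map (prod_topology euclidean euclidean) euclidean
          (\<lambda>(x, y). x + y :: 'i \<Rightarrow> real)"
    unfolding continuous_map_into_real_functions by (simp add: case_prod_unfold)
  have "continuous_map (prod_topology euclideanreal euclidean) euclideanreal (\<lambda>z. fst z * snd z i)"
    for i :: 'i
    by (intro continuous_map_real_mult continuous_map_into_real_functions[THEN iffD1, rule_format]
        continuous_map_fst continuous_map_snd)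
  then show "continuous_map (prod_topology euclideanreal euclidean) euclidean
          (\<lambda>(c, x). c *\<^sub>R x :: 'i \<Rightarrow> real)"
    unfolding continuous_map_into_real_functions by (simp add: case_prod_unfold scaleR_fun_def)
  show "neighbourhood_base_of convex (euclidean :: ('i \<Rightarrow> real) topology)" 
    unfolding neighbourhood_base_of
  proof (intro allI impI)
    fix W :: "('i \<Rightarrow> real) set" and x assume W: "openin euclidean W \<and> x \<in> W"
    then have "openin (product_topology (\<lambda>i. euclidean) UNIV) W" by (simp add: euclidean_product_topology)
    then obtain U where U: "x \<in> PiE UNIV U" "\<And>i. openin euclidean (U i)"
      "finite {i. U i \<noteq> topspace (euclidean::real topology)}" "PiE UNIV U \<subseteq> W"
      using product_topology_open_contains_basis[of "\<lambda>i. euclidean" UNIV W x] W by blast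
    have "\<exists>e>0. ball (x i) e \<subseteq> U i" for i
      using U(1,2) open_contains_ball[of "U i"] by (auto simp: PiE_iff)
    then obtain e where e: "\<And>i. 0 < e i" "\<And>i. ball (x i) (e i) \<subseteq> U i" by metis
    define V where "V i = (if U i = UNIV then UNIV else ball (x i) (e i))" for i
    define P where "P = PiE UNIV V"
    have "openin (product_topology (\<lambda>i. euclidean) UNIV) P"
      unfolding P_def
    proof (rule product_topology_basis)
      show "openin euclidean (V i)" for i by (simp add: V_def)
      show "finite {i. V i \<noteq> topspace (euclidean::real topology)}"
        by (rule finite_subset[OF _ U(3)]) (auto simp: V_def)
    qed
    then have "openin euclidean P" by (simp add: euclidean_product_topology)
    moreover have "x \<in> P" using e by (auto simp: P_def V_def PiE_iff)
    moreover have "P \<subseteq> W"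
    proof -
      have "V i \<subseteq> U i" for i using e(2) by (auto simp: V_def)
      then have "P \<subseteq> PiE UNIV U" unfolding P_def by (intro PiE_mono)
      then show ?thesis using U(4) by (rule order_trans)
    qed
    moreover have "convex P"
    proof (rule convexI)
      fix f g :: "'i \<Rightarrow> real" and u v :: real
      assume fg: "f \<in> P" "g \<in> P" "0 \<le> u" "0 \<le> v" "u + v = 1"
      have "u *\<^sub>R f i + v *\<^sub>R g i \<in> V i" for i
      proof -
        have "convex (V i)" by (simp add: V_def)
        moreover have "f i \<in> V i" "g i \<in> V i" using fg(1,2) by (simp_all add: P_def PiE_iff)
        ultimately show ?thesis using fg(3-5) by (rule convexD)
      qed
      then show "u *\<^sub>R f + v *\<^sub>R g \<in> P"
        by (auto simp: P_def PiE_iff scaleR_fun_def)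
    qed
    ultimately show "\<exists>U V. openin euclidean U \<and> convex V \<and> x \<in> U \<and> U \<subseteq> V \<and> V \<subseteq> W" by blast
  qed
qed auto

lemma continuous_map_realI:
  fixes f :: "'a \<Rightarrow> real"
  assumes "\<And>x e. x \<in> topspace X \<Longrightarrow> 0 < e \<Longrightarrow> \<exists>U. openin X U \<and> x \<in> U \<and> (\<forall>y\<in>U. dist (f y) (f x) < e)"
  shows "continuous_map X euclideanreal f"
  using Met_TC.continuous_map_to_metric[of X f] assms
  by (simp add: mball_eq_ball dist_commute)

context dendritic_set begin

text \<open>A mean has arbitrary values at discontinuous functions. Prescribing the value 0 there makes it
  unique and the set of means compact.\<close>

definition mean_set :: "(('b \<Rightarrow> real) \<Rightarrow> real) set" where
  "mean_set = {m. mean m \<and> (\<forall>f. \<not> continuous_on S f \<longrightarrow> m f = 0)}"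

lemma mean_cong:
  assumes m: "mean m" and "continuous_on S f" "\<And>x. x \<in> S \<Longrightarrow> f x = g x"
  shows "m f = m g"
proof -
  have g: "continuous_on S g" using assms(2,3) by (metis continuous_on_cong)
  show ?thesis
    using mean_mono[OF m assms(2) g] mean_mono[OF m g assms(2)] assms(3) by force
qed

lemma mean_set_cong:
  assumes m: "m \<in> mean_set" and "\<And>x. x \<in> S \<Longrightarrow> f x = g x"
  shows "m f = m g"
proof (cases "continuous_on S f")
  case True
  then show ?thesis using mean_cong m assms(2) by (simp add: mean_set_def)
next
  case False
  then have "\<not> continuous_on S g" using assms(2) by (metis continuous_on_cong)
  then show ?thesis using False m by (simp add: mean_set_def)
qed

lemma mean_abs_le:
  assumes m: "mean m" and f: "continuous_on S f" and "\<And>x. x \<in> S \<Longrightarrow> \<bar>f x\<bar> \<le> c"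
  shows "\<bar>m f\<bar> \<le> c"
  using mean_mono[OF m f continuous_on_const, of c] mean_mono[OF m continuous_on_const f, of "- c"]
    mean_const[OF m] assms(3) by (fastforce simp: abs_le_iff)

lemma convex_mean_set: "convex mean_set"
proof (rule convexI)
  fix m n :: "('b \<Rightarrow> real) \<Rightarrow> real" and u v :: real
  assume mn: "m \<in> mean_set" "n \<in> mean_set" and uv: "0 \<le> u" "0 \<le> v" "u + v = 1"
  have "mean (u *\<^sub>R m + v *\<^sub>R n)"
    using mn uv unfolding mean_set_def mean_def
    by (auto simp: scaleR_fun_def algebra_simps)
  then show "u *\<^sub>R m + v *\<^sub>R n \<in> mean_set"
    using mn by (auto simp: mean_set_def scaleR_fun_def)
qed

text \<open>Tychonoff: the values at a continuous \<open>f\<close> are bounded by a bound of \<open>f\<close> on \<open>S\<close>, and the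
  defining conditions are closed for pointwise convergence.\<close>

lemma compact_mean_set: "compact mean_set"
proof -
  have "\<exists>c. \<forall>x\<in>S. \<bar>f x\<bar> \<le> c" if "continuous_on S f" for f :: "'b \<Rightarrow> real"
    using compact_imp_bounded[OF compact_continuous_image[OF that compact_S]]
    by (auto simp: bounded_iff)
  then have "\<forall>f. \<exists>c. continuous_on S f \<longrightarrow> (\<forall>x\<in>S. \<bar>f x :: real\<bar> \<le> c)"
    by blast
  from choice[OF this] obtain B :: "('b \<Rightarrow> real) \<Rightarrow> real"
    where B': "\<forall>f. continuous_on S f \<longrightarrow> (\<forall>x\<in>S. \<bar>f x\<bar> \<le> B f)" by (rule exE)
  have B: "\<bar>f x\<bar> \<le> B f" if "continuous_on S f" "x \<in> S" for f x
    using B'[rule_format, OF that] .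
  define P where "P = PiE UNIV (\<lambda>f. {- \<bar>B f\<bar>..\<bar>B f\<bar>})"
  have "compactin (product_topology (\<lambda>f. euclidean) UNIV) P"
    unfolding P_def compactin_PiE by (simp add: compactin_euclidean_iff)
  then have "compact P" by (simp add: euclidean_product_topology)
  moreover have "mean_set \<subseteq> P"
  proof
    fix m assume m: "m \<in> mean_set"
    have "\<bar>m f\<bar> \<le> \<bar>B f\<bar>" for f
    proof (cases "continuous_on S f")
      case True
      have "mean m" using m by (simp add: mean_set_def)
      then have "\<bar>m f\<bar> \<le> B f" using True B[OF True] by (rule mean_abs_le)
      then show ?thesis by simp
    next
      case False
      then show ?thesis using m by (simp add: mean_set_def)
    qed
    then have "m f \<in> {- \<bar>B f\<bar>..\<bar>B f\<bar>}" for f by (metis abs_le_D1 abs_le_iff atLeastAtMost_iff minus_le_iff)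
    then show "m \<in> P" by (simp add: P_def PiE_iff)
  qed
  moreover have "closed mean_set"
  proof -
    have imp: "closed {m. Q \<longrightarrow> R m}" if "Q \<Longrightarrow> closed {m. R m}"
      for Q and R :: "(('b \<Rightarrow> real) \<Rightarrow> real) \<Rightarrow> bool"
      using that by (cases Q) auto
    show ?thesis
      unfolding mean_set_def mean_def
      by (intro closed_Collect_conj closed_Collect_all imp closed_Collect_eq closed_Collect_le
          continuous_on_add continuous_on_mult_left continuous_on_const continuous_on_product_coordinates)
  qed
  ultimately show ?thesis by (metis compact_Int_closed inf.absorb2)
qed

definition dirac :: "'b \<Rightarrow> ('b \<Rightarrow> real) \<Rightarrow> real" where
  "dirac p f = (if continuous_on S f then f p else 0)"

lemma dirac_in_mean_set:
  assumes "p \<in> S"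
  shows "dirac p \<in> mean_set"
  using assms continuous_on_add continuous_on_mult_left
  unfolding mean_set_def mean_def dirac_def by (auto intro!: continuous_intros)

definition push :: "('g \<Rightarrow> 'b \<Rightarrow> 'b) \<Rightarrow> 'g \<Rightarrow> (('b \<Rightarrow> real) \<Rightarrow> real) \<Rightarrow> ('b \<Rightarrow> real) \<Rightarrow> real" where
  "push \<phi> g = (\<lambda>m\<in>mean_set. \<lambda>f. if continuous_on S f then m (\<lambda>x. f (\<phi> g x)) else 0)"

context
  fixes G :: "('g, 'm) monoid_scheme" and T :: "'g topology" and \<phi> :: "'g \<Rightarrow> 'b \<Rightarrow> 'b"
  assumes G: "topological_group G T" and act: "continuous_action G T (top_of_set S) \<phi>"
begin

lemma act_group_action: "group_action G S \<phi>"
  using act by (simp add: continuous_action_def)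

lemma act_closed: "g \<in> carrier G \<Longrightarrow> x \<in> S \<Longrightarrow> \<phi> g x \<in> S"
  using group_action.element_image[OF act_group_action] by blast

lemma act_one: "x \<in> S \<Longrightarrow> \<phi> \<one>\<^bsub>G\<^esub> x = x"
  using group_action.id_eq_one[OF act_group_action] by (metis restrict_apply')

lemma act_mult: "g \<in> carrier G \<Longrightarrow> h \<in> carrier G \<Longrightarrow> x \<in> S \<Longrightarrow> \<phi> (g \<otimes>\<^bsub>G\<^esub> h) x = \<phi> g (\<phi> h x)"
  by (rule group_action.composition_rule[OF act_group_action])

lemma act_continuous: "g \<in> carrier G \<Longrightarrow> continuous_on S (\<phi> g)"
proof -
  assume g: "g \<in> carrier G"
  have "continuous_map (top_of_set S) (prod_topology T (top_of_set S)) (\<lambda>x. (g, x))"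
    using g G by (simp add: continuous_map_paired topological_group.topspace_carrier)
  moreover have "continuous_map (prod_topology T (top_of_set S)) (top_of_set S) (\<lambda>(g, x). \<phi> g x)"
    using act by (simp add: continuous_action_def)
  ultimately have "continuous_map (top_of_set S) (top_of_set S) ((\<lambda>(g, x). \<phi> g x) \<circ> (\<lambda>x. (g, x)))"
    by (rule continuous_map_compose)
  then show ?thesis by (simp add: comp_def continuous_map_in_subtopology)
qed

lemma act_homeomorphism: "g \<in> carrier G \<Longrightarrow> homeomorphism S S (\<phi> g) (\<phi> (inv\<^bsub>G\<^esub> g))"
proof -
  assume g: "g \<in> carrier G"
  interpret group G using G by (simp add: topological_group_def)
  have *: "\<phi> (inv\<^bsub>G\<^esub> g) (\<phi> g x) = x" "\<phi> g (\<phi> (inv\<^bsub>G\<^esub> g) x) = x" if "x \<in> S" for x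
    using that g act_mult[of "inv\<^bsub>G\<^esub> g" g x] act_mult[of g "inv\<^bsub>G\<^esub> g" x] act_one by auto
  show ?thesis
    using g * act_closed act_continuous by (intro homeomorphismI) auto
qed

lemma continuous_on_act:
  assumes "g \<in> carrier G" "continuous_on S f"
  shows "continuous_on S (\<lambda>x. f (\<phi> g x))"
  using continuous_on_compose2[OF assms(2) act_continuous[OF assms(1)]] act_closed assms by blast

lemma push_in_mean_set:
  assumes g: "g \<in> carrier G" and m: "m \<in> mean_set"
  shows "push \<phi> g m \<in> mean_set"
proof -
  have mm: "mean m" using m by (simp add: mean_set_def)
  have "mean (push \<phi> g m)"
    unfolding mean_def
  proof (intro conjI allI impI)
    fix f h :: "'b \<Rightarrow> real" assume fh: "continuous_on S f" "continuous_on S h"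
    then have "m (\<lambda>x. f (\<phi> g x) + h (\<phi> g x)) = m (\<lambda>x. f (\<phi> g x)) + m (\<lambda>x. h (\<phi> g x))"
      by (intro mean_add mm continuous_on_act[OF g])
    then show "push \<phi> g m (\<lambda>x. f x + h x) = push \<phi> g m f + push \<phi> g m h"
      using fh m by (simp add: push_def continuous_on_add)
  next
    fix c and f :: "'b \<Rightarrow> real" assume f: "continuous_on S f"
    then have "m (\<lambda>x. c * f (\<phi> g x)) = c * m (\<lambda>x. f (\<phi> g x))"
      by (intro mean_mult mm continuous_on_act[OF g])
    then show "push \<phi> g m (\<lambda>x. c * f x) = c * push \<phi> g m f"
      using f m by (simp add: push_def continuous_on_mult_left)
  next
    fix f :: "'b \<Rightarrow> real" assume f: "continuous_on S f" "\<forall>x\<in>S. 0 \<le> f x"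
    have "0 \<le> m (\<lambda>x. f (\<phi> g x))"
    proof (rule mean_nonneg[OF mm continuous_on_act[OF g f(1)]])
      show "0 \<le> f (\<phi> g x)" if "x \<in> S" for x using f(2) act_closed[OF g that] by (rule bspec)
    qed
    then show "0 \<le> push \<phi> g m f" using f m by (simp add: push_def)
  next
    show "push \<phi> g m (\<lambda>x. 1) = 1" using m by (simp add: push_def mean_set_def mean_def)
  qed
  then show ?thesis using m by (simp add: mean_set_def push_def)
qed

lemma push_group_action: "group_action G mean_set (push \<phi>)"
proof (rule group_actionI)
  show "group G" using G by (simp add: topological_group_def)
  show "push \<phi> g m \<in> mean_set" if "g \<in> carrier G" "m \<in> mean_set" for g m
    using that by (rule push_in_mean_set)
  show "push \<phi> \<one>\<^bsub>G\<^esub> m = m" if m: "m \<in> mean_set" for m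
  proof
    fix f
    have "m (\<lambda>x. f (\<phi> \<one>\<^bsub>G\<^esub> x)) = m f" by (rule mean_set_cong[OF m]) (simp add: act_one)
    then show "push \<phi> \<one>\<^bsub>G\<^esub> m f = m f" using m by (simp add: push_def mean_set_def)
  qed
  show "push \<phi> (g \<otimes>\<^bsub>G\<^esub> h) m = push \<phi> g (push \<phi> h m)"
    if gh: "g \<in> carrier G" "h \<in> carrier G" and m: "m \<in> mean_set" for g h m
  proof
    fix f
    have "m (\<lambda>x. f (\<phi> (g \<otimes>\<^bsub>G\<^esub> h) x)) = m (\<lambda>x. f (\<phi> g (\<phi> h x)))"
      by (rule mean_set_cong[OF m]) (simp add: act_mult gh)
    then show "push \<phi> (g \<otimes>\<^bsub>G\<^esub> h) m f = push \<phi> g (push \<phi> h m) f"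
      using m push_in_mean_set[OF gh(2) m] continuous_on_act[OF gh(1), of f]
      by (simp add: push_def)
  qed
  show "push \<phi> g \<in> extensional mean_set" for g by (simp add: push_def)
qed

text \<open>Joint continuity at \<open>(g0, m0)\<close>: by compactness of \<open>S\<close> (tube lemma), \<open>f \<circ> \<phi> g\<close> is uniformly close to
  \<open>f0 = f \<circ> \<phi> g0\<close> for \<open>g\<close> near \<open>g0\<close>, and means are 1-Lipschitz for the uniform norm; moreover
  \<open>m f0\<close> is close to \<open>m0 f0\<close> for \<open>m\<close> near \<open>m0\<close>.\<close>

lemma push_continuous_action: "continuous_action G T (top_of_set mean_set) (push \<phi>)"
  unfolding continuous_action_def
proof
  have TG: "topspace T = carrier G" using G by (simp add: topological_group.topspace_carrier)
  show "group_action G (topspace (top_of_set mean_set)) (push \<phi>)"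
    using push_group_action by simp
  let ?X = "prod_topology T (top_of_set mean_set)"
  have "continuous_map ?X euclideanreal (\<lambda>z. push \<phi> (fst z) (snd z) f)" for f
  proof (cases "continuous_on S f")
    case False
    have "continuous_map ?X euclideanreal (\<lambda>z. 0)" by simp
    then show ?thesis
      by (rule continuous_map_eq) (use False in \<open>auto simp: push_def\<close>)
  next
    case f: True
    show ?thesis
    proof (rule continuous_map_realI)
      fix z and e :: real assume z: "z \<in> topspace ?X" and e: "0 < e"
      obtain g0 m0 where z0: "z = (g0, m0)" by force
      have g0: "g0 \<in> carrier G" and m0: "m0 \<in> mean_set" using z by (auto simp: z0 TG)
      define F where "F w = \<bar>f (\<phi> (fst w) (snd w)) - f (\<phi> g0 (snd w))\<bar>" for w
      define W where "W = {w \<in> topspace (prod_topology T (top_of_set S)). F w < e / 2}"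
      have fS: "continuous_map (top_of_set S) euclideanreal f" using f by simp
      have "continuous_map (prod_topology T (top_of_set S)) (top_of_set S) (\<lambda>w. \<phi> (fst w) (snd w))"
        using act by (simp add: continuous_action_def case_prod_unfold)
      from continuous_map_compose[OF this fS]
      have 1: "continuous_map (prod_topology T (top_of_set S)) euclideanreal (\<lambda>w. f (\<phi> (fst w) (snd w)))"
        by (simp add: comp_def)
      have "continuous_map (top_of_set S) euclideanreal (\<lambda>x. f (\<phi> g0 x))"
        using continuous_on_act[OF g0 f] by simp
      from continuous_map_compose[OF continuous_map_snd this]
      have 2: "continuous_map (prod_topology T (top_of_set S)) euclideanreal (\<lambda>w. f (\<phi> g0 (snd w)))"
        by (simp add: comp_def)
      have "continuous_map (prod_topology T (top_of_set S)) euclideanreal F"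
        unfolding F_def using continuous_map_norm[OF continuous_map_diff[OF 1 2]] by simp
      then have "openin (prod_topology T (top_of_set S)) {w \<in> topspace (prod_topology T (top_of_set S)). F w \<in> {..<e/2}}"
        by (rule openin_continuous_map_preimage) simp
      then have "openin (prod_topology T (top_of_set S)) W" by (simp add: W_def)
      moreover have "compactin (top_of_set S) S" using compact_S by (simp add: compactin_subtopology)
      moreover have "{g0} \<times> S \<subseteq> W" using g0 e by (auto simp: W_def F_def TG)
      ultimately obtain U V where UV: "openin T U" "g0 \<in> U" "S \<subseteq> V" "U \<times> V \<subseteq> W"
        using tube_lemma_right[of T "top_of_set S" W S g0] g0 TG by metis
      define f0 where "f0 x = f (\<phi> g0 x)" for x
      have f0: "continuous_on S f0" unfolding f0_def by (rule continuous_on_act[OF g0 f])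
      define N where "N = mean_set \<inter> {m. dist (m f0) (m0 f0) < e / 2}"
      have "open {m. dist (m f0) (m0 f0) < e / 2}"
        by (intro open_Collect_less continuous_intros) simp
      then have "openin (top_of_set mean_set) N" unfolding N_def by (rule openin_open_Int)
      then have "openin ?X (U \<times> N)" using UV(1) by (simp add: openin_prod_Times_iff)
      moreover have "z \<in> U \<times> N" using UV(2) m0 e by (simp add: z0 N_def)
      moreover have "dist (push \<phi> (fst y) (snd y) f) (push \<phi> (fst z) (snd z) f) < e" if y: "y \<in> U \<times> N" for y
      proof -
        obtain g m where y0: "y = (g, m)" by force
        have g: "g \<in> U" "g \<in> carrier G" and m: "m \<in> mean_set" "dist (m f0) (m0 f0) < e / 2"
          using y openin_subset[OF UV(1)] by (auto simp: y0 N_def TG)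
        have mm: "mean m" using m by (simp add: mean_set_def)
        have fg: "continuous_on S (\<lambda>x. f (\<phi> g x))" by (rule continuous_on_act[OF g(2) f])
        have "\<bar>m (\<lambda>x. f (\<phi> g x) - f0 x)\<bar> \<le> e / 2"
        proof (rule mean_abs_le[OF mm continuous_on_diff[OF fg f0]])
          fix x assume "x \<in> S"
          then have "(g, x) \<in> W" using UV g by blast
          then show "\<bar>f (\<phi> g x) - f0 x\<bar> \<le> e / 2" by (simp add: W_def F_def f0_def)
        qed
        then have "\<bar>m (\<lambda>x. f (\<phi> g x)) - m f0\<bar> \<le> e / 2"
          using mean_diff[OF mm fg f0] by simp
        moreover have "push \<phi> (fst y) (snd y) f = m (\<lambda>x. f (\<phi> g x))"
          "push \<phi> (fst z) (snd z) f = m0 f0"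
          using f m(1) m0 by (simp_all add: y0 z0 push_def f0_def[abs_def])
        ultimately show ?thesis using m(2) unfolding dist_real_def by linarith
      qed
      ultimately show "\<exists>U. openin ?X U \<and> z \<in> U \<and>
          (\<forall>y\<in>U. dist (push \<phi> (fst y) (snd y) f) (push \<phi> (fst z) (snd z) f) < e)"
        by blast
    qed
  qed
  then have "continuous_map ?X euclidean (\<lambda>z. push \<phi> (fst z) (snd z))"
    by (simp add: continuous_map_into_real_functions)
  then show "continuous_map ?X (top_of_set mean_set) (\<lambda>(g, m). push \<phi> g m)"
    using push_in_mean_set by (auto simp: continuous_map_in_subtopology case_prod_unfold TG)
qed

text \<open>The Dirac mean at the point fixed by \<open>H\<close> is fixed by \<open>H\<close>, so by co-amenability \<open>G\<close> fixes some mean.\<close>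

theorem elementary_if_coamenable_fixed_point:
  assumes H: "coamenable G T H" and fp: "has_fixed_point H S \<phi>"
  shows "elementary_action G (top_of_set S) \<phi>"
proof -
  obtain p where p: "p \<in> S" "\<And>h. h \<in> H \<Longrightarrow> \<phi> h p = p" using fp by (auto simp: has_fixed_point_def)
  have HG: "H \<subseteq> carrier G"
    using H by (simp add: coamenable_def coamenable_in_def subgroup.subset)
  have co: "coamenable_in TYPE(('b \<Rightarrow> real) \<Rightarrow> real) G T H"
    by (rule coamenable_imp_coamenable_in[OF G H])
  have "has_fixed_point (carrier G) mean_set (push \<phi>)"
  proof (rule co[unfolded coamenable_in_def, THEN conjunct2, rule_format], intro conjI)
    show "locally_convex_tvs (UNIV :: (('b \<Rightarrow> real) \<Rightarrow> real) set) euclidean"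
      by (rule locally_convex_tvs_real_functions)
    show "Hausdorff_space (euclidean :: (('b \<Rightarrow> real) \<Rightarrow> real) topology)"
      unfolding euclidean_product_topology[symmetric] Hausdorff_space_product_topology by simp
    show "mean_set \<noteq> {}" using dirac_in_mean_set[OF p(1)] by blast
    show "compactin euclidean mean_set" using compact_mean_set by simp
    show "affine_action G mean_set (push \<phi>)"
      unfolding affine_action_def
    proof (intro ballI)
      fix g m n and t :: real
      assume *: "g \<in> carrier G" "m \<in> mean_set" "n \<in> mean_set" "t \<in> {0..1}"
      then have "(1 - t) *\<^sub>R m + t *\<^sub>R n \<in> mean_set"
        using convex_mean_set by (auto simp: convex_alt)
      then show "push \<phi> g ((1 - t) *\<^sub>R m + t *\<^sub>R n) = (1 - t) *\<^sub>R push \<phi> g m + t *\<^sub>R push \<phi> g n"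
        using * by (auto simp: push_def scaleR_fun_def fun_eq_iff)
    qed
    have "push \<phi> h (dirac p) = dirac p" if h: "h \<in> H" for h
    proof
      fix f
      show "push \<phi> h (dirac p) f = dirac p f"
        using dirac_in_mean_set[OF p(1)] continuous_on_act[of h f] h HG p(2)[OF h]
        by (auto simp: push_def dirac_def)
    qed
    then show "has_fixed_point H mean_set (push \<phi>)"
      using dirac_in_mean_set[OF p(1)] by (auto simp: has_fixed_point_def)
  qed (use convex_mean_set push_continuous_action in auto)
  then obtain m where m: "m \<in> mean_set" "\<And>g. g \<in> carrier G \<Longrightarrow> push \<phi> g m = m"
    by (auto simp: has_fixed_point_def)
  have "(\<exists>x\<in>S. \<forall>f\<in>\<phi> ` carrier G. f x = x) \<or>
    (\<exists>x\<in>S. \<exists>y\<in>S. x \<noteq> y \<and> (\<forall>f\<in>\<phi> ` carrier G. f ` {x, y} = {x, y}))"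
  proof (rule invariant_mean_imp_invariant_pair)
    show "mean m" using m by (simp add: mean_set_def)
    show "S \<noteq> {}" using p by blast
    show "\<exists>f'\<in>\<phi> ` carrier G. homeomorphism S S f f'" if f: "f \<in> \<phi> ` carrier G" for f
    proof -
      obtain g where g: "g \<in> carrier G" "f = \<phi> g" using f by blast
      have "inv\<^bsub>G\<^esub> g \<in> carrier G" using g(1) G by (simp add: topological_group_def)
      then show ?thesis using act_homeomorphism[OF g(1)] g(2) by blast
    qed
    show "m (\<lambda>x. h (f x)) = m h" if f: "f \<in> \<phi> ` carrier G" and h: "continuous_on S h" for f h
    proof -
      obtain g where g: "g \<in> carrier G" "f = \<phi> g" using f by blast
      have "push \<phi> g m h = m h" using m(2)[OF g(1)] by simp
      then show ?thesis using m(1) h g(2) by (simp add: push_def)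
    qed
  qed
  then show ?thesis by (simp add: elementary_action_def has_fixed_point_def)
qed

theorem elementary_if_commuting_coamenable:
  assumes ne: "S \<noteq> {}" and H1: "coamenable G T H1" and H2: "coamenable G T H2"
    and comm: "\<forall>a\<in>H1. \<forall>b\<in>H2. a \<otimes>\<^bsub>G\<^esub> b = b \<otimes>\<^bsub>G\<^esub> a"
  shows "elementary_action G (top_of_set S) \<phi>"
proof -
  have sub: "subgroup H1 G" "subgroup H2 G"
    using H1 H2 by (auto simp: coamenable_def coamenable_in_def)
  have hom: "\<exists>f'\<in>\<phi> ` H. homeomorphism S S f f'" if H: "subgroup H G" and f: "f \<in> \<phi> ` H" for H f
  proof -
    obtain g where g: "g \<in> H" "f = \<phi> g" using f by blast
    then show ?thesis
      using act_homeomorphism[of g] subgroup.mem_carrier[OF H g(1)] subgroup.m_inv_closed[OF H g(1)]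
      by blast
  qed
  have "(\<exists>x\<in>S. \<forall>f\<in>\<phi> ` H1. f x = x) \<or> (\<exists>x\<in>S. \<forall>h\<in>\<phi> ` H2. h x = x)"
  proof (rule commuting_groups_fixed_point[OF ne])
    show "f (h x) = h (f x)" if "f \<in> \<phi> ` H1" "h \<in> \<phi> ` H2" "x \<in> S" for f h x
    proof -
      obtain a b where ab: "a \<in> H1" "b \<in> H2" "f = \<phi> a" "h = \<phi> b" using \<open>f \<in> _\<close> \<open>h \<in> _\<close> by blast
      then have "a \<in> carrier G" "b \<in> carrier G" using sub subgroup.mem_carrier by (metis, metis)
      moreover have "a \<otimes>\<^bsub>G\<^esub> b = b \<otimes>\<^bsub>G\<^esub> a" using comm ab by blast
      ultimately show ?thesis using act_mult[of a b x] act_mult[of b a x] ab \<open>x \<in> S\<close> by metis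
    qed
  qed (use hom sub in auto)
  then have "has_fixed_point H1 S \<phi> \<or> has_fixed_point H2 S \<phi>"
    by (auto simp: has_fixed_point_def)
  then show ?thesis
    using elementary_if_coamenable_fixed_point H1 H2 by blast
qed

end

end

section \<open>From abstract dendrites to subsets of a Banach space\<close>

text \<open>The map sends \<open>x\<close> to the distance function \<open>d x\<close>. Discrete copies of the points serve as index set, so
  that the target is the Banach space of all bounded functions on that set. This makes the
  results on arcs in Banach spaces available for abstract dendrites.\<close>

lemma Kuratowski_embedding:
  assumes X: "compact_space X" "metrizable_space X"
  obtains f :: "'x \<Rightarrow> ('x discrete \<Rightarrow>\<^sub>C real)" where "homeomorphic_map X (top_of_set (f ` topspace X)) f"
proof -
  obtain M d where M: "Metric_space M d" "X = Metric_space.mtopology M d"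
    using X(2) by (auto simp: metrizable_space_def)
  interpret Metric_space M d by fact
  have top: "topspace X = M" using M(2) by simp
  have "mtotally_bounded M"
    using X(1) M(2) compact_space_eq_mcomplete_mtotally_bounded by simp
  then have "mbounded M" by (rule mtotally_bounded_imp_mbounded)
  then obtain B where B: "\<And>x y. x \<in> M \<Longrightarrow> y \<in> M \<Longrightarrow> d x y \<le> B" by (auto simp: mbounded_alt)
  define r where "r x p = (if p \<in> M then d x p else 0)" for x p
  define f :: "'x \<Rightarrow> ('x discrete \<Rightarrow>\<^sub>C real)" where "f x = Bcontfun (\<lambda>p. r x (of_discrete p))" for x
  have f: "apply_bcontfun (f x) p = r x (of_discrete p)" if x: "x \<in> M" for x p
  proof -
    have "continuous_on UNIV h" for h :: "'x discrete \<Rightarrow> real"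
      by (auto simp: continuous_on_open_vimage intro: open_discrete)
    then have "(\<lambda>p. r x (of_discrete p)) \<in> bcontfun"
    proof (rule bcontfun_normI)
      show "norm (r x (of_discrete p)) \<le> \<bar>B\<bar>" for p
        using B[OF x, of "of_discrete p"] by (auto simp: r_def)
    qed
    then show ?thesis by (simp add: f_def Bcontfun_inverse)
  qed
  have lip: "dist (f x) (f y) \<le> d x y" if "x \<in> M" "y \<in> M" for x y
  proof (rule dist_bound)
    fix p show "dist (apply_bcontfun (f x) p) (apply_bcontfun (f y) p) \<le> d x y"
      using triangle[OF that, of "of_discrete p"] triangle[OF that(2,1), of "of_discrete p"]
        commute[of y x] by (auto simp: f that r_def dist_real_def abs_le_iff)
  qed
  have "homeomorphic_map X (top_of_set (f ` topspace X)) f"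
  proof (rule continuous_imp_homeomorphic_map[OF _ X(1)])
    have "continuous_map X euclidean f"
      unfolding mtopology_is_euclidean[symmetric] Met_TC.continuous_map_to_metric
    proof (intro ballI allI impI)
      fix x and e :: real assume x: "x \<in> topspace X" and e: "0 < e"
      have "openin X (mball x e)" using M(2) by simp
      moreover have "x \<in> mball x e" using x e top by simp
      moreover have "f y \<in> Met_TC.mball (f x) e" if "y \<in> mball x e" for y
        using lip[of x y] that by simp
      ultimately show "\<exists>U. openin X U \<and> x \<in> U \<and> (\<forall>y\<in>U. f y \<in> Met_TC.mball (f x) e)" by blast
    qed
    then show "continuous_map X (top_of_set (f ` topspace X)) f"
      by (simp add: continuous_map_in_subtopology)
    show "Hausdorff_space (top_of_set (f ` topspace X))" by (simp add: Hausdorff_space_subtopology)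
    show "inj_on f (topspace X)"
    proof (rule inj_onI)
      fix x y assume xy: "x \<in> topspace X" "y \<in> topspace X" "f x = f y"
      then have xM: "x \<in> M" "y \<in> M" by (auto simp: top)
      have "r x y = r y y"
        using f[OF xM(1), of "discrete y"] f[OF xM(2), of "discrete y"] xy(3)
        by (simp add: discrete_inverse)
      then show "x = y" using xM by (simp add: r_def)
    qed
  qed simp
  then show ?thesis by (rule that)
qed

lemma locally_connected_top_of_set:
  fixes S :: "'b::topological_space set"
  assumes "locally_connected_space (top_of_set S)"
  shows "locally connected S"
  using assms
  unfolding locally_def locally_connected_space_def neighbourhood_base_of
  by (simp add: connectedin_subtopology) meson

proposition dendrite_imp_dendritic_set:
  fixes S :: "'b::{real_normed_vector, complete_space} set"
  assumes "dendrite (top_of_set S)"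
  shows "dendritic_set S"
proof
  have D: "connected S" "compact S"
    using assms connectedin_iff_connected[of S] compactin_euclidean_iff[of S]
    by (simp_all add: dendrite_def continuum_def connectedin_def compactin_subspace)
  have D': "locally connected S" "\<not> (\<exists>C. simple_closed_curve_in (top_of_set S) C)"
    using assms by (auto simp: dendrite_def intro: locally_connected_top_of_set)
  show "compact S" "locally connected S" by (fact D(2) D'(1))+
  have "\<not> C homeomorphic sphere (0::complex) 1" if "C \<subseteq> S" for C
  proof
    assume "C homeomorphic sphere (0::complex) 1"
    then obtain h k where "homeomorphism C (sphere (0::complex) 1) h k"
      by (auto simp: homeomorphic_def)
    then have "homeomorphic_maps (top_of_set C) (top_of_set (sphere 0 1)) h k"
      by (auto simp: homeomorphic_maps_def homeomorphism_def continuous_map_in_subtopology)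
    then have "simple_closed_curve_in (top_of_set S) C"
      using that unfolding simple_closed_curve_in_def homeomorphic_space_def
      by (auto simp: subtopology_subtopology Int_absorb1)
    then show False using D'(2) by blast
  qed
  then show "\<exists>g. arc g \<and> pathstart g = x \<and> pathfinish g = y \<and> path_image g \<subseteq> S \<and>
      (\<forall>C. connected C \<longrightarrow> C \<subseteq> S \<longrightarrow> x \<in> C \<longrightarrow> y \<in> C \<longrightarrow> path_image g \<subseteq> C)"
    if "x \<in> S" "y \<in> S" "x \<noteq> y" for x y
    using arc_least_connected[OF D(2) D'(1) D(1) _ that] by metis
qed

lemma dendrite_homeomorphic:
  assumes "dendrite X" and h: "X homeomorphic_space Y"
  shows "dendrite Y"
proof -
  have "\<not> simple_closed_curve_in Y C" for C
  proof
    assume C: "simple_closed_curve_in Y C"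
    have CY: "C \<subseteq> topspace Y" using C by (simp add: simple_closed_curve_in_def)
    obtain f where f: "homeomorphic_map Y X f"
      using h[THEN homeomorphic_space_sym[THEN iffD1]] unfolding homeomorphic_space by blast
    have im: "f ` topspace Y = topspace X" using f by (rule homeomorphic_imp_surjective_map)
    then have fC: "f ` C \<subseteq> topspace X" using CY by blast
    have "homeomorphic_map (subtopology Y C) (subtopology X (f ` C)) f"
      using CY fC by (intro homeomorphic_map_subtopologies[OF f]) (simp add: Int_absorb1)
    then have "subtopology Y C homeomorphic_space subtopology X (f ` C)"
      unfolding homeomorphic_space by blast
    then have "subtopology X (f ` C) homeomorphic_space top_of_set (sphere (0::complex) 1)"
      using C homeomorphic_space_sym homeomorphic_space_trans unfolding simple_closed_curve_in_def by metis
    then have "simple_closed_curve_in X (f ` C)"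
      using fC by (simp add: simple_closed_curve_in_def)
    then show False using assms(1) by (auto simp: dendrite_def)
  qed
  then show ?thesis
    using assms homeomorphic_empty_space[OF h] homeomorphic_connected_space[OF h]
      homeomorphic_compact_space[OF h] homeomorphic_metrizable_space[OF h]
      homeomorphic_locally_connected_space[OF h]
    by (auto simp: dendrite_def continuum_def)
qed

lemma elementary_action_homeomorphic:
  assumes fg: "homeomorphic_maps X Y f g" and act: "group_action G (topspace X) \<phi>"
    and el: "elementary_action G Y (\<lambda>h. restrict (\<lambda>y. f (\<phi> h (g y))) (topspace Y))"
  shows "elementary_action G X \<phi>"
proof -
  have gY: "g y \<in> topspace X" "f (g y) = y" if "y \<in> topspace Y" for y
    using fg that by (auto simp: homeomorphic_maps_def continuous_map_def)
  have gf: "g (f x) = x" if "x \<in> topspace X" for x using fg that by (simp add: homeomorphic_maps_def)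
  have eq: "g (f (\<phi> h (g y))) = \<phi> h (g y)" if "h \<in> carrier G" "y \<in> topspace Y" for h y
    using gf group_action.element_image[OF act that(1) gY(1)[OF that(2)] refl] by simp
  from el consider y where "y \<in> topspace Y" "\<And>h. h \<in> carrier G \<Longrightarrow> f (\<phi> h (g y)) = y"
    | y z where "y \<in> topspace Y" "z \<in> topspace Y" "y \<noteq> z"
        "\<And>h. h \<in> carrier G \<Longrightarrow> {f (\<phi> h (g y)), f (\<phi> h (g z))} = {y, z}"
    unfolding elementary_action_def has_fixed_point_def by auto
  then show ?thesis
  proof cases
    case (1 y)
    then have "\<phi> h (g y) = g y" if "h \<in> carrier G" for h using eq that by metis
    then show ?thesis using gY(1)[OF 1(1)] by (auto simp: elementary_action_def has_fixed_point_def)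
  next
    case (2 y z)
    have "\<phi> h ` {g y, g z} = {g y, g z}" if h: "h \<in> carrier G" for h
    proof -
      have "\<phi> h ` {g y, g z} = g ` {f (\<phi> h (g y)), f (\<phi> h (g z))}"
        using eq[OF h 2(1)] eq[OF h 2(2)] by simp
      then show ?thesis using 2(4)[OF h] by simp
    qed
    moreover have "g y \<noteq> g z" using 2(3) gY(2)[OF 2(1)] gY(2)[OF 2(2)] by metis
    ultimately show ?thesis
      unfolding elementary_action_def
      using gY(1)[OF 2(1)] gY(1)[OF 2(2)] by (intro disjI2 bexI[of _ "g y"] bexI[of _ "g z"]) auto
  qed
qed

theorem theorem1p5:
  fixes G :: "('g, 'm) monoid_scheme" and T :: "'g topology"
    and H1 H2 :: "'g set"
    and X :: "'x topology" and \<phi> :: "'g \<Rightarrow> 'x \<Rightarrow> 'x"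
  assumes "topological_group G T"
    and "coamenable G T H1"
    and "coamenable G T H2"
    and "\<forall>a\<in>H1. \<forall>b\<in>H2. a \<otimes>\<^bsub>G\<^esub> b = b \<otimes>\<^bsub>G\<^esub> a"
    and "dendrite X"
    and "continuous_action G T X \<phi>"
  shows "elementary_action G X \<phi>"
proof -
  have X: "compact_space X" "metrizable_space X" "topspace X \<noteq> {}"
    using assms(5) by (auto simp: dendrite_def continuum_def)
  obtain f :: "'x \<Rightarrow> ('x discrete \<Rightarrow>\<^sub>C real)" where f: "homeomorphic_map X (top_of_set (f ` topspace X)) f"
    using Kuratowski_embedding[OF X(1,2)] .
  define S where "S = f ` topspace X"
  obtain g where fg: "homeomorphic_maps X (top_of_set S) f g"
    using f homeomorphic_map_maps unfolding S_def by blast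
  then have "dendrite (top_of_set S)"
    using dendrite_homeomorphic[OF assms(5)] homeomorphic_space_def by blast
  then interpret dendritic_set S by (rule dendrite_imp_dendritic_set)
  have TG: "topspace T = carrier G" using assms(1) by (rule topological_group.topspace_carrier)
  have "elementary_action G (top_of_set S)
      (\<lambda>h. restrict (\<lambda>y. f (\<phi> h (g y))) (topspace (top_of_set S)))"
    using X(3) assms(1-4) continuous_action_homeomorphic[OF assms(6) fg TG]
    by (intro elementary_if_commuting_coamenable) (auto simp: S_def)
  moreover have "group_action G (topspace X) \<phi>"
    using assms(6) by (simp add: continuous_action_def)
  ultimately show ?thesis by (intro elementary_action_homeomorphic[OF fg])
qed

end
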